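(* Let $1\le d<D$ and $k\ge 3$ be integers. There exist values of the regularity parameters $R_{\min}>0$, $\mathbf{L}=(L_\perp,L_3,\dots,L_k)$, $0<f_{\min}\le f_{\max}<\infty$ (depending only on $d$ and $k$) and a constant $c>0$, depending on $d$, $k$ and the regularity parameters, such that, with $\mathscr{P}^k=\mathscr{P}^k_{R_{\min},\mathbf{L}}(f_{\min},f_{\max})$, for every sample size $n$, $$\inf_{\widehat R}\ \sup_{P\in\mathscr{P}^k}\mathbf{E}_{P^{\otimes n}}\big[|\widehat R-R|\big]\ge c\,n^{-(k-2)/d},$$ where the infimum is over all estimators $\widehat R=\widehat R(X_1,\dots,X_n)$ and $R=R(\mathbf{M})$ is the reach of the support $\mathbf{M}$ of $P$.
   Context: Reach: for a submanifold $\mathbf{M}\subseteq\mathbf{R}^D$, $R(\mathbf{M})$ is the supremum of all $\delta\ge 0$ such that every point of the open offset $\bigcup_{p\in\mathbf{M}}B_\delta(p)$ ($B_\delta(p)$ the open Euclidean ball of radius $\delta$) has a unique nearest point in $\mathbf{M}$. Class of manifolds: for $d<D$, $k\ge 3$, $R_{\min}>0$ and $\mathbf{L}=(L_\perp,L_3,\dots,L_k)$ (positive numbers), $\mathfrak{C}^k_{R_{\min},\mathbf{L}}$ is the set of $d$-dimensional compact connected submanifolds $\mathbf{M}$ of $\mathbf{R}^D$ such that: (i) $R(\mathbf{M})\ge R_{\min}$; (ii) for all $p\in\mathbf{M}$ there is a local one-to-one parametrization $\psi_p:B_{T_p\mathbf{M}}(0,r)\subseteq T_p\mathbf{M}\to\mathbf{M}$,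 $v\mapsto p+v+\mathbf{N}_p(v)$, for some $r\ge\frac1{4L_\perp}$, with $\mathbf{N}_p\in C^k(B_{T_p\mathbf{M}}(0,r),\mathbf{R}^D)$, $\mathbf{N}_p(0)=0$, $d_0\mathbf{N}_p=0$, and $\|d_v^2\mathbf{N}_p\|_{\mathrm{op}}\le L_\perp$ for all $\|v\|\le\frac1{4L_\perp}$; (iii) $\|d_v^i\mathbf{N}_p\|_{\mathrm{op}}\le L_i$ for all $3\le i\le k$ and $\|v\|\le\frac1{4L_\perp}$. Class of distributions: $\mathscr{P}^k_{R_{\min},\mathbf{L}}(f_{\min},f_{\max})$ is the set of probability distributions $P$ supported on some $\mathbf{M}\in\mathfrak{C}^k_{R_{\min},\mathbf{L}}$ that are absolutely continuous with respect to the volume measure $\mu_{\mathbf{M}}$, with density taking values $\mu_{\mathbf{M}}$-a.s. in $[f_{\min},f_{\max}]$. $(X_1,\dots,X_n)$ is an $n$-sample of independent random variables with common law $P$; $\mathbf{E}_{P^{\otimes n}}$ is expectation under its law; an estimator is a (measurable) real function of the sample. *)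

theory Defs
  imports "HOL-Probability.Probability"
begin

section \<open>Euclidean spaces of varying dimension\<close>

text \<open>
  The regularity parameters below must not depend on the ambient dimension \<open>D\<close>, so \<open>D\<close> is
  quantified inside the formula and cannot be a type. All the spaces \<open>R\<^sup>D\<close> are therefore
  realised inside one inner product space, that of the finitely supported real sequences, with
  \<open>R\<^sup>D\<close> consisting of the sequences that vanish from index \<open>D\<close> on. (The norm
  of \<open>poly_mapping\<close> in \<open>HOL-Analysis\<close> is the \<open>l\<^sup>1\<close> norm, hence the separate type.)
\<close>

typedef fseq = "{x :: nat \<Rightarrow> real. finite {i. x i \<noteq> 0}}"
  morphisms coord Abs_fseq
  by (rule exI[of _ "\<lambda>_. 0"]) simp

setup_lifting type_definition_fseq

lemma finite_coord [simp]: "finite {i. coord x i \<noteq> 0}"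
  using coord[of x] by simp

lemma fseq_eqI: "(\<And>i. coord x i = coord y i) \<Longrightarrow> x = y"
  by (metis coord_inject ext)

instantiation fseq :: real_vector
begin

lift_definition zero_fseq :: fseq is "\<lambda>_. 0" by simp

lift_definition plus_fseq :: "fseq \<Rightarrow> fseq \<Rightarrow> fseq" is "\<lambda>x y i. x i + y i"
  subgoal for x y by (rule finite_subset[of _ "{i. x i \<noteq> 0} \<union> {i. y i \<noteq> 0}"]) auto
  done

lift_definition minus_fseq :: "fseq \<Rightarrow> fseq \<Rightarrow> fseq" is "\<lambda>x y i. x i - y i"
  subgoal for x y by (rule finite_subset[of _ "{i. x i \<noteq> 0} \<union> {i. y i \<noteq> 0}"]) auto
  done

lift_definition uminus_fseq :: "fseq \<Rightarrow> fseq" is "\<lambda>x i. - x i" by simp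

lift_definition scaleR_fseq :: "real \<Rightarrow> fseq \<Rightarrow> fseq" is "\<lambda>a x i. a * x i"
  by (rule finite_subset[rotated]) auto

instance
  by standard (transfer; simp add: algebra_simps)+

end

lemmas coord_simps [simp] =
  zero_fseq.rep_eq plus_fseq.rep_eq minus_fseq.rep_eq uminus_fseq.rep_eq scaleR_fseq.rep_eq

instantiation fseq :: real_inner
begin

definition inner_fseq :: "fseq \<Rightarrow> fseq \<Rightarrow> real" where
  "inner_fseq x y = (\<Sum>i\<in>{i. coord x i \<noteq> 0}. coord x i * coord y i)"

definition norm_fseq :: "fseq \<Rightarrow> real" where
  "norm_fseq x = sqrt (inner x x)"

definition sgn_fseq :: "fseq \<Rightarrow> fseq" where
  "sgn_fseq x = x /\<^sub>R norm x"

definition dist_fseq :: "fseq \<Rightarrow> fseq \<Rightarrow> real" where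
  "dist_fseq x y = norm (x - y)"

definition uniformity_fseq :: "(fseq \<times> fseq) filter" where
  "uniformity_fseq = (INF e\<in>{0<..}. principal {(x, y). dist x y < e})"

definition open_fseq :: "fseq set \<Rightarrow> bool" where
  "open_fseq U \<longleftrightarrow> (\<forall>x\<in>U. \<forall>\<^sub>F (x', y) in uniformity. x' = x \<longrightarrow> y \<in> U)"

lemma inner_fseq_superset:
  assumes "finite A" "{i. coord x i \<noteq> 0} \<subseteq> A"
  shows "inner x y = (\<Sum>i\<in>A. coord x i * coord y i)"
  unfolding inner_fseq_def using assms by (intro sum.mono_neutral_left) auto

instance
proof
  fix x y z :: fseq and r :: real and U :: "fseq set"
  let ?S = "{i. coord x i \<noteq> 0}" and ?T = "{i. coord y i \<noteq> 0}"
  have fin: "finite (?S \<union> ?T)" by simp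
  show "dist x y = norm (x - y)" by (rule dist_fseq_def)
  show "sgn x = x /\<^sub>R norm x" by (rule sgn_fseq_def)
  show "uniformity = (INF e\<in>{0<..}. principal {(x, y :: fseq). dist x y < e})"
    by (rule uniformity_fseq_def)
  show "open U \<longleftrightarrow> (\<forall>x\<in>U. \<forall>\<^sub>F (x', y) in uniformity. x' = x \<longrightarrow> y \<in> U)"
    by (rule open_fseq_def)
  show "inner x y = inner y x"
    by (subst (1 2) inner_fseq_superset[OF fin]) (auto simp: mult.commute)
  have "inner (x + y) z = (\<Sum>i\<in>?S \<union> ?T. coord (x + y) i * coord z i)"
    by (rule inner_fseq_superset[OF fin]) auto
  also have "\<dots> = (\<Sum>i\<in>?S \<union> ?T. coord x i * coord z i) + (\<Sum>i\<in>?S \<union> ?T. coord y i * coord z i)"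
    by (simp add: distrib_right sum.distrib)
  also have "\<dots> = inner x z + inner y z"
    by (subst (1 2) inner_fseq_superset[OF fin]) auto
  finally show "inner (x + y) z = inner x z + inner y z" .
  have "inner (r *\<^sub>R x) y = (\<Sum>i\<in>?S. coord (r *\<^sub>R x) i * coord y i)"
    by (rule inner_fseq_superset) auto
  also have "\<dots> = r * inner x y"
    by (simp add: inner_fseq_def sum_distrib_left mult.assoc)
  finally show "inner (r *\<^sub>R x) y = r * inner x y" .
  show "0 \<le> inner x x"
    by (simp add: inner_fseq_def sum_nonneg)
  show "inner x x = 0 \<longleftrightarrow> x = 0"
  proof
    assume "inner x x = 0"
    then have "\<forall>i\<in>?S. coord x i * coord x i = 0"
      unfolding inner_fseq_def by (subst (asm) sum_nonneg_eq_0_iff) auto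
    then show "x = 0" by (intro fseq_eqI) auto
  qed (simp add: inner_fseq_def)
  show "norm x = sqrt (inner x x)" by (rule norm_fseq_def)
qed

end

definition Rn :: "nat \<Rightarrow> fseq set" where
  "Rn D = {x. \<forall>i\<ge>D. coord x i = 0}"

section \<open>Higher derivatives\<close>

text \<open>\<open>iter_deriv [h\<^sub>1, \<dots>, h\<^sub>i] f x\<close> is the \<open>i\<close>-th differential \<open>d\<^sub>x\<^sup>i f\<close>
  applied to \<open>(h\<^sub>1, \<dots>, h\<^sub>i)\<close>.\<close>

primrec iter_deriv ::
  "'a list \<Rightarrow> ('a::real_normed_vector \<Rightarrow> 'b::real_normed_vector) \<Rightarrow> 'a \<Rightarrow> 'b" where
  "iter_deriv [] f = f"
| "iter_deriv (h # hs) f = (\<lambda>x. frechet_derivative (iter_deriv hs f) (at x) h)"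

text \<open>Only used for open \<open>U\<close> and finite-dimensional domains, where differentiability and
  continuity of \<open>d\<^sup>i f\<close> can be tested on fixed arguments \<open>(h\<^sub>1, \<dots>, h\<^sub>i)\<close>.\<close>

definition Ck_on ::
  "nat \<Rightarrow> 'a set \<Rightarrow> ('a::euclidean_space \<Rightarrow> 'b::real_normed_vector) \<Rightarrow> bool" where
  "Ck_on k U f \<longleftrightarrow>
     (\<forall>hs. length hs < k \<longrightarrow> (\<forall>x\<in>U. iter_deriv hs f differentiable (at x))) \<and>
     (\<forall>hs. length hs \<le> k \<longrightarrow> continuous_on U (iter_deriv hs f))"

definition deriv_opnorm ::
  "nat \<Rightarrow> ('a::euclidean_space \<Rightarrow> 'b::real_normed_vector) \<Rightarrow> 'a \<Rightarrow> real" where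
  "deriv_opnorm i f x =
     (SUP hs\<in>{hs. length hs = i \<and> (\<forall>h\<in>set hs. norm h \<le> 1)}. norm (iter_deriv hs f x))"

section \<open>Submanifolds\<close>

text \<open>The dimension \<open>d\<close> is \<open>CARD('d)\<close>. In all that follows \<open>E\<close> is the ambient space, to be
  instantiated with \<open>Rn D\<close>.\<close>

definition local_param ::
  "nat \<Rightarrow> 'a::real_inner set \<Rightarrow> (real^'d::finite) set \<Rightarrow> (real^'d \<Rightarrow> 'a) \<Rightarrow> bool" where
  "local_param k M U \<phi> \<longleftrightarrow>
     open U \<and> Ck_on k U \<phi> \<and> (\<forall>u\<in>U. inj (frechet_derivative \<phi> (at u))) \<and>
     openin (top_of_set M) (\<phi> ` U) \<and> (\<exists>g. homeomorphism U (\<phi> ` U) \<phi> g)"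

definition submanifold :: "'d::finite itself \<Rightarrow> nat \<Rightarrow> 'a::real_inner set \<Rightarrow> bool" where
  "submanifold _ k M \<longleftrightarrow>
     (\<forall>p\<in>M. \<exists>(U :: (real^'d) set) \<phi>. local_param k M U \<phi> \<and> p \<in> \<phi> ` U)"

text \<open>Velocities at \<open>p\<close> of curves in \<open>M\<close>.\<close>

definition tangent_space :: "'a::real_inner set \<Rightarrow> 'a \<Rightarrow> 'a set" where
  "tangent_space M p =
     {v. \<exists>\<gamma> :: real \<Rightarrow> 'a. \<gamma> 0 = p \<and> range \<gamma> \<subseteq> M \<and> (\<gamma> has_vector_derivative v) (at 0)}"

text \<open>Extended-real valued, so that the supremum is meaningful for every \<open>M\<close>; it is finite for
  nonempty compact submanifolds of positive dimension.\<close>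

definition reach :: "'a::real_inner set \<Rightarrow> 'a set \<Rightarrow> ereal" where
  "reach E M = Sup {ereal \<delta> | \<delta>. 0 \<le> \<delta> \<and>
     (\<forall>x \<in> E \<inter> (\<Union>p\<in>M. ball p \<delta>). \<exists>!q. q \<in> M \<and> (\<forall>p\<in>M. dist x q \<le> dist x p))}"

text \<open>The map \<open>\<iota>\<close> is a linear isometry of \<open>R\<^sup>d\<close> onto \<open>T\<^sub>p M\<close>, through which the ball of
  \<open>T\<^sub>p M\<close> and the operator norms of differentials on it become those of \<open>R\<^sup>d\<close>. The ball is
  open; if its radius is exactly \<open>1 / (4 L\<^sub>\<bottom>)\<close>, the bounds are imposed on the open ball, where
  the differentials exist.\<close>

definition graph_param ::
  "nat \<Rightarrow> real \<Rightarrow> (nat \<Rightarrow> real) \<Rightarrow> 'a::real_inner set \<Rightarrow> 'a set \<Rightarrow> 'a \<Rightarrow>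
     (real^'d::finite \<Rightarrow> 'a) \<Rightarrow> real \<Rightarrow> (real^'d \<Rightarrow> 'a) \<Rightarrow> bool" where
  "graph_param k Lperp L E M p \<iota> r N \<longleftrightarrow>
     linear \<iota> \<and> (\<forall>v. norm (\<iota> v) = norm v) \<and> range \<iota> = tangent_space M p \<and>
     1 / (4 * Lperp) \<le> r \<and>
     inj_on (\<lambda>v. p + \<iota> v + N v) (ball 0 r) \<and>
     openin (top_of_set M) ((\<lambda>v. p + \<iota> v + N v) ` ball 0 r) \<and>
     N ` ball 0 r \<subseteq> E \<and> Ck_on k (ball 0 r) N \<and>
     N 0 = 0 \<and> (N has_derivative (\<lambda>_. 0)) (at 0) \<and>
     (\<forall>v\<in>ball 0 r. norm v \<le> 1 / (4 * Lperp) \<longrightarrow>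
        deriv_opnorm 2 N v \<le> Lperp \<and> (\<forall>i\<in>{3..k}. deriv_opnorm i N v \<le> L i))"

definition manifold_class ::
  "'d::finite itself \<Rightarrow> 'a::real_inner set \<Rightarrow> nat \<Rightarrow> real \<Rightarrow> real \<Rightarrow> (nat \<Rightarrow> real) \<Rightarrow> 'a set set"
where
  "manifold_class d E k Rmin Lperp L =
     {M. M \<subseteq> E \<and> compact M \<and> connected M \<and> submanifold d k M \<and> ereal Rmin \<le> reach E M \<and>
         (\<forall>p\<in>M. \<exists>(\<iota> :: real^'d \<Rightarrow> 'a) r N. graph_param k Lperp L E M p \<iota> r N)}"

section \<open>Volume measure, statistical model and minimax risk\<close>

definition borel_on :: "'a::topological_space set \<Rightarrow> 'a measure" where
  "borel_on E = restrict_space borel E"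

text \<open>Square root of the Gram determinant of \<open>d\<^sub>u \<phi>\<close>, i.e. the volume density in the chart.\<close>

definition jacobian :: "(real^'d::finite \<Rightarrow> 'a::real_inner) \<Rightarrow> real^'d \<Rightarrow> real" where
  "jacobian \<phi> u = sqrt (det ((\<chi> i j. frechet_derivative \<phi> (at u) (axis i 1) \<bullet>
                                     frechet_derivative \<phi> (at u) (axis j 1)) :: real^'d^'d))"

text \<open>\<open>\<mu>\<close> is the volume measure of \<open>M\<close>, seen as a measure on \<open>E\<close> concentrated on \<open>M\<close>. As \<open>M\<close> is
  covered by countably many charts, the chart formula determines \<open>\<mu>\<close>.\<close>

definition volume_measure ::
  "'d::finite itself \<Rightarrow> 'a::real_inner set \<Rightarrow> 'a set \<Rightarrow> 'a measure \<Rightarrow> bool" where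
  "volume_measure _ E M \<mu> \<longleftrightarrow>
     sets \<mu> = sets (borel_on E) \<and> emeasure \<mu> (E - M) = 0 \<and>
     (\<forall>(U :: (real^'d) set) \<phi> B. local_param 1 M U \<phi> \<and> B \<in> sets (borel_on E) \<and> B \<subseteq> \<phi> ` U \<longrightarrow>
        emeasure \<mu> B = (\<integral>\<^sup>+ u \<in> U \<inter> \<phi> -` B. ennreal (jacobian \<phi> u) \<partial>lborel))"

definition distribution_class ::
  "'d::finite itself \<Rightarrow> 'a::real_inner set \<Rightarrow> nat \<Rightarrow> real \<Rightarrow> real \<Rightarrow> (nat \<Rightarrow> real) \<Rightarrow> real \<Rightarrow> real \<Rightarrow>
     'a measure set"
where
  "distribution_class d E k Rmin Lperp L fmin fmax =
     {P. prob_space P \<and>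
         (\<exists>M\<in>manifold_class d E k Rmin Lperp L. \<exists>\<mu> f.
            volume_measure d E M \<mu> \<and> f \<in> borel_measurable (borel_on E) \<and>
            (AE x in \<mu>. fmin \<le> f x \<and> f x \<le> fmax) \<and>
            P = density \<mu> (\<lambda>x. ennreal (f x)))}"

definition measure_support :: "'a::topological_space set \<Rightarrow> 'a measure \<Rightarrow> 'a set" where
  "measure_support E P = {x\<in>E. \<forall>U. open U \<and> x \<in> U \<longrightarrow> 0 < emeasure P (U \<inter> E)}"

definition reach_risk ::
  "'a::real_inner set \<Rightarrow> nat \<Rightarrow> ((nat \<Rightarrow> 'a) \<Rightarrow> real) \<Rightarrow> 'a measure \<Rightarrow> ennreal" where
  "reach_risk E n Rhat P =
     (\<integral>\<^sup>+ X. e2ennreal \<bar>ereal (Rhat X) - reach E (measure_support E P)\<bar> \<partial>(\<Pi>\<^sub>M i\<in>{..<n}. P))"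

definition minimax_reach_risk :: "'a::real_inner set \<Rightarrow> nat \<Rightarrow> 'a measure set \<Rightarrow> ennreal" where
  "minimax_reach_risk E n \<P> =
     (INF Rhat \<in> borel_measurable (\<Pi>\<^sub>M i\<in>{..<n}. borel_on E). SUP P\<in>\<P>. reach_risk E n Rhat P)"

end

theory Submission
  imports Defs
begin

text \<open>
  Two manifolds that a sample of size \<open>n\<close> can hardly tell apart, but whose reaches differ by a
  multiple of \<open>n powr (- (k - 2) / d)\<close>, force every estimator to err by that order on one of them
  (Le Cam's two-point method, \<open>minimax_reach_risk_two_point\<close>).

  The first manifold is the unit sphere of a \<open>d + 1\<close>-dimensional subspace; its reach is \<open>1\<close>. The
  second one is this sphere with a dent at a pole \<open>e\<close>, the zero set of
  \<open>x \<bullet> x - 1 + \<beta> * \<gamma> ^ k * G ((x - e) / \<gamma>)\<close> for a fixed nonnegative \<open>G\<close> of class \<open>C\<^sup>k\<close>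
  that vanishes outside the unit ball. The dent has width \<open>\<gamma>\<close> and height of order \<open>\<gamma> ^ k\<close>, so
  derivatives of order at most \<open>k\<close> stay bounded as \<open>\<gamma>\<close> tends to \<open>0\<close> and all these
  manifolds belong to one regularity class. Curvature, however, is changed by the order
  \<open>\<gamma> ^ (k - 2)\<close>. To turn this into a statement on the reach, \<open>G\<close> is chosen such that
  \<open>G y \<le> y \<bullet> y\<close>, with equality if \<open>y \<bullet> y = 1 / 2\<close>. With \<open>b = \<beta> * \<gamma> ^ (k - 2)\<close> the inequality
  says that the dented sphere stays outside the open ball of radius \<open>1 / (1 + b)\<close> about
  \<open>b / (1 + b)\<close> times \<open>e\<close>, and the cases of equality say that it touches the boundary of this ball at
  several points. The centre of the ball then has several nearest points, and the reach is at most
  \<open>1 / (1 + b)\<close> (\<open>reach_dented_le\<close>).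

  The two manifolds coincide outside the ball of radius \<open>\<gamma>\<close> about \<open>e\<close>, which carries a volume of
  order \<open>\<gamma> ^ d\<close>. If \<open>\<gamma>\<close> is a small multiple of \<open>n powr (- 1 / d)\<close>, the uniform distributions on
  the two manifolds have a common part of mass at least \<open>1 - 1 / (2 * n)\<close>, and the laws of the samples
  have a common part of mass at least \<open>1 / 2\<close>.

  Membership in the class requires bounds that do not depend on \<open>\<gamma>\<close> nor on the base point of a
  chart. They come from a calculus of families of functions with uniformly bounded derivatives
  (\<open>Cb\<close>), which is stable under the rescaling that produces the dent (\<open>Cb_rescale\<close>) and under
  implicit functions (\<open>Cb_implicit_graph\<close>). The geometry only uses that the defining function has a
  Lipschitz gradient that is bounded below on the zero set; this yields graphs over tangent balls of a
  fixed radius and a lower bound on the reach (\<open>reach_ge\<close>). The volume measure is glued from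
  finitely many charts; it is well defined since the chart formulas agree on overlaps
  (\<open>chart_volume_eq\<close>), and for the same reason it is local (\<open>volume_measure_local\<close>).
\<close>

section \<open>Families of functions with uniformly bounded derivatives\<close>

text \<open>
  \<open>Cb k I U f\<close>: the functions \<open>f i\<close>, for \<open>i\<close> in \<open>I\<close>, are of class \<open>C\<^sup>k\<close> on \<open>U i\<close>, and their
  derivatives up to order \<open>k\<close> are bounded on \<open>U i\<close> by constants that do not depend on \<open>i\<close>. Working
  with families, rather than with explicit constants, makes uniform bounds compose like smoothness
  does. Only partial derivatives along the basis are iterated, so that the recursion stays within
  one index set.
\<close>

primrec Cb ::
  "nat \<Rightarrow> 'i set \<Rightarrow> ('i \<Rightarrow> 'a::euclidean_space set) \<Rightarrow> ('i \<Rightarrow> 'a \<Rightarrow> real) \<Rightarrow> bool" where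
  "Cb 0 I U f \<longleftrightarrow>
     (\<exists>B. \<forall>i\<in>I. \<forall>x\<in>U i. \<bar>f i x\<bar> \<le> B) \<and> (\<forall>i\<in>I. continuous_on (U i) (f i))"
| "Cb (Suc k) I U f \<longleftrightarrow>
     (\<exists>B. \<forall>i\<in>I. \<forall>x\<in>U i. \<bar>f i x\<bar> \<le> B) \<and> (\<forall>i\<in>I. \<forall>x\<in>U i. f i differentiable (at x)) \<and>
     (\<forall>b\<in>Basis. Cb k I U (\<lambda>i x. frechet_derivative (f i) (at x) b))"

lemma Cb_bounded: "Cb k I U f \<Longrightarrow> \<exists>B. \<forall>i\<in>I. \<forall>x\<in>U i. \<bar>f i x\<bar> \<le> B"
  by (cases k) auto

lemma Cb_continuous: "Cb k I U f \<Longrightarrow> i \<in> I \<Longrightarrow> continuous_on (U i) (f i)"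
  by (cases k) (simp_all add: continuous_at_imp_continuous_on differentiable_imp_continuous_within)

lemma Cb_differentiable: "Cb (Suc k) I U f \<Longrightarrow> i \<in> I \<Longrightarrow> x \<in> U i \<Longrightarrow> f i differentiable (at x)"
  by simp

lemma Cb_partial:
  "Cb (Suc k) I U f \<Longrightarrow> b \<in> Basis \<Longrightarrow> Cb k I U (\<lambda>i x. frechet_derivative (f i) (at x) b)"
  by simp

lemma Cb_Suc_imp: "Cb (Suc k) I U f \<Longrightarrow> Cb k I U f"
proof (induction k arbitrary: f)
  case 0
  then show ?case using Cb_bounded[OF 0] Cb_continuous[OF 0] by simp
next
  case (Suc k)
  have "\<forall>b\<in>Basis. Cb k I U (\<lambda>i x. frechet_derivative (f i) (at x) b)"
    using Suc.IH Cb_partial[OF Suc.prems] by blast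
  then show ?case using Suc.prems by simp
qed

lemma Cb_mono: "Cb k I U f \<Longrightarrow> m \<le> k \<Longrightarrow> Cb m I U f"
  by (induction k) (auto simp: le_Suc_eq simp del: Cb.simps dest: Cb_Suc_imp)

lemma frechet_derivative_cong_open:
  assumes "open S" "x \<in> S" "\<And>y. y \<in> S \<Longrightarrow> f y = g y"
  shows "frechet_derivative f (at x) = frechet_derivative g (at x)"
proof -
  have "(f has_derivative D) (at x) \<longleftrightarrow> (g has_derivative D) (at x)" for D
    using has_derivative_transform_within_open[of f D x UNIV S g]
      has_derivative_transform_within_open[of g D x UNIV S f] assms by auto
  then show ?thesis by (simp add: frechet_derivative_def)
qed

lemma differentiable_cong_open:
  assumes "open S" "x \<in> S" "\<And>y. y \<in> S \<Longrightarrow> f y = g y"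
  shows "f differentiable (at x) \<longleftrightarrow> g differentiable (at x)"
  unfolding differentiable_def
  using has_derivative_transform_within_open[of f _ x UNIV S g]
      has_derivative_transform_within_open[of g _ x UNIV S f] assms by auto

lemma Cb_cong:
  assumes "\<forall>i\<in>I. open (U i)" "\<And>i x. i \<in> I \<Longrightarrow> x \<in> U i \<Longrightarrow> f i x = g i x" "Cb k I U f"
  shows "Cb k I U g"
  using assms(2,3)
proof (induction k arbitrary: f g)
  case 0
  then have "\<forall>i\<in>I. continuous_on (U i) (g i)"
    by (metis Cb_continuous continuous_on_cong)
  then show ?case using 0 by simp
next
  case (Suc k)
  have "g i differentiable (at x)" if "i \<in> I" "x \<in> U i" for i x
    using differentiable_cong_open[of "U i" x "f i" "g i"] assms(1) Suc.prems that by auto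
  moreover have "Cb k I U (\<lambda>i x. frechet_derivative (g i) (at x) b)" if "b \<in> Basis" for b
  proof (rule Suc.IH)
    show "Cb k I U (\<lambda>i x. frechet_derivative (f i) (at x) b)"
      using Suc.prems that by simp
  next
    fix i x assume ix: "i \<in> I" "x \<in> U i"
    have "frechet_derivative (f i) (at x) = frechet_derivative (g i) (at x)"
      using ix assms(1) Suc.prems(1) by (intro frechet_derivative_cong_open[of "U i"]) auto
    then show "frechet_derivative (f i) (at x) b = frechet_derivative (g i) (at x) b" by simp
  qed
  ultimately show ?case using Suc.prems by simp
qed

text \<open>
  The recursion with a derivative that is known in closed form instead of
  \<open>frechet_derivative\<close>; all closure properties below are proved through it.
\<close>

lemma Cb_SucI:
  assumes op: "\<forall>i\<in>I. open (U i)"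
    and "\<exists>B. \<forall>i\<in>I. \<forall>x\<in>U i. \<bar>f i x\<bar> \<le> B"
    and der: "\<And>i x. i \<in> I \<Longrightarrow> x \<in> U i \<Longrightarrow> (f i has_derivative f' i x) (at x)"
    and "\<And>b. b \<in> Basis \<Longrightarrow> Cb k I U (\<lambda>i x. f' i x b)"
  shows "Cb (Suc k) I U f"
proof -
  have "Cb k I U (\<lambda>i x. frechet_derivative (f i) (at x) b)" if "b \<in> Basis" for b
    by (rule Cb_cong[OF op _ assms(4)[OF that]]) (use der frechet_derivative_at in metis)
  moreover have "f i differentiable (at x)" if "i \<in> I" "x \<in> U i" for i x
    using der[OF that] unfolding differentiable_def by blast
  ultimately show ?thesis using assms(2) by simp
qed

lemma Cb_der:
  "Cb (Suc k) I U f \<Longrightarrow> i \<in> I \<Longrightarrow> x \<in> U i \<Longrightarrow>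
     (f i has_derivative frechet_derivative (f i) (at x)) (at x)"
  by (simp add: frechet_derivative_works)

lemma Cb_const:
  assumes "\<And>i. i \<in> I \<Longrightarrow> \<bar>c i\<bar> \<le> B"
  shows "Cb k I U (\<lambda>i x. c i)"
  using assms
proof (induction k arbitrary: c B)
  case (Suc k)
  show ?case using Suc.prems Suc.IH[of "\<lambda>_. 0" 0] by auto
qed auto

lemma Cb_add:
  assumes "\<forall>i\<in>I. open (U i)" "Cb k I U f" "Cb k I U g"
  shows "Cb k I U (\<lambda>i x. f i x + g i x)"
  using assms(2,3)
proof (induction k arbitrary: f g)
  case 0
  obtain B where B: "\<forall>i\<in>I. \<forall>x\<in>U i. \<bar>f i x\<bar> \<le> B" using Cb_bounded[OF 0(1)] by blast
  obtain C where C: "\<forall>i\<in>I. \<forall>x\<in>U i. \<bar>g i x\<bar> \<le> C" using Cb_bounded[OF 0(2)] by blast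
  have "\<forall>i\<in>I. \<forall>x\<in>U i. \<bar>f i x + g i x\<bar> \<le> B + C" using B C by fastforce
  then show ?case using 0 by (auto intro!: continuous_on_add)
next
  case (Suc k)
  obtain B where B: "\<forall>i\<in>I. \<forall>x\<in>U i. \<bar>f i x\<bar> \<le> B" using Cb_bounded[OF Suc.prems(1)] by blast
  obtain C where C: "\<forall>i\<in>I. \<forall>x\<in>U i. \<bar>g i x\<bar> \<le> C" using Cb_bounded[OF Suc.prems(2)] by blast
  have BC: "\<forall>i\<in>I. \<forall>x\<in>U i. \<bar>f i x + g i x\<bar> \<le> B + C" using B C by fastforce
  show ?case
  proof (rule Cb_SucI[OF assms(1)])
    show "\<exists>B. \<forall>i\<in>I. \<forall>x\<in>U i. \<bar>f i x + g i x\<bar> \<le> B" using BC by blast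
    show "((\<lambda>x. f i x + g i x) has_derivative (\<lambda>b. frechet_derivative (f i) (at x) b
            + frechet_derivative (g i) (at x) b)) (at x)" if "i \<in> I" "x \<in> U i" for i x
      by (intro has_derivative_add Cb_der[OF Suc.prems(1) that] Cb_der[OF Suc.prems(2) that])
    show "Cb k I U (\<lambda>i x. frechet_derivative (f i) (at x) b + frechet_derivative (g i) (at x) b)"
      if "b \<in> Basis" for b
      by (intro Suc.IH Cb_partial[OF Suc.prems(1) that] Cb_partial[OF Suc.prems(2) that])
  qed
qed

lemma Cb_mult:
  assumes op: "\<forall>i\<in>I. open (U i)" "Cb k I U f" "Cb k I U g"
  shows "Cb k I U (\<lambda>i x. f i x * g i x)"
  using assms(2,3)
proof (induction k arbitrary: f g)
  case 0
  obtain B where B: "\<forall>i\<in>I. \<forall>x\<in>U i. \<bar>f i x\<bar> \<le> B" using Cb_bounded[OF 0(1)] by blast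
  obtain C where C: "\<forall>i\<in>I. \<forall>x\<in>U i. \<bar>g i x\<bar> \<le> C" using Cb_bounded[OF 0(2)] by blast
  have "\<forall>i\<in>I. \<forall>x\<in>U i. \<bar>f i x * g i x\<bar> \<le> \<bar>B\<bar> * \<bar>C\<bar>"
    unfolding abs_mult using B C by (intro ballI mult_mono) fastforce+
  then show ?case using 0 by (auto intro!: continuous_on_mult)
next
  case (Suc k)
  obtain B where B: "\<forall>i\<in>I. \<forall>x\<in>U i. \<bar>f i x\<bar> \<le> B" using Cb_bounded[OF Suc.prems(1)] by blast
  obtain C where C: "\<forall>i\<in>I. \<forall>x\<in>U i. \<bar>g i x\<bar> \<le> C" using Cb_bounded[OF Suc.prems(2)] by blast
  have BC: "\<forall>i\<in>I. \<forall>x\<in>U i. \<bar>f i x * g i x\<bar> \<le> \<bar>B\<bar> * \<bar>C\<bar>"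
    unfolding abs_mult using B C by (intro ballI mult_mono) fastforce+
  show ?case
  proof (rule Cb_SucI[OF assms(1)])
    show "\<exists>B. \<forall>i\<in>I. \<forall>x\<in>U i. \<bar>f i x * g i x\<bar> \<le> B" using BC by blast
    show "((\<lambda>x. f i x * g i x) has_derivative (\<lambda>b. f i x * frechet_derivative (g i) (at x) b
            + frechet_derivative (f i) (at x) b * g i x)) (at x)" if "i \<in> I" "x \<in> U i" for i x
      by (intro has_derivative_mult Cb_der[OF Suc.prems(1) that] Cb_der[OF Suc.prems(2) that])
    show "Cb k I U (\<lambda>i x. f i x * frechet_derivative (g i) (at x) b
            + frechet_derivative (f i) (at x) b * g i x)"
      if "b \<in> Basis" for b
      by (intro Suc.IH Cb_add op Cb_Suc_imp[OF Suc.prems(1)] Cb_Suc_imp[OF Suc.prems(2)]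
           Cb_partial[OF Suc.prems(1) that] Cb_partial[OF Suc.prems(2) that])
  qed
qed

lemma Cb_sum:
  assumes "\<forall>i\<in>I. open (U i)" "finite A" "\<And>a. a \<in> A \<Longrightarrow> Cb k I U (f a)"
  shows "Cb k I U (\<lambda>i x. \<Sum>a\<in>A. f a i x)"
  using assms(2,3)
proof (induction A rule: finite_induct)
  case empty
  then show ?case using Cb_const[of I "\<lambda>_. 0" 0] by simp
next
  case (insert a A)
  then show ?case using Cb_add[OF assms(1)] by simp
qed

lemma Cb_cmult:
  assumes "\<forall>i\<in>I. open (U i)" "Cb k I U f"
  shows "Cb k I U (\<lambda>i x. c * f i x)"
  by (intro Cb_mult assms Cb_const[of _ _ "\<bar>c\<bar>"]) auto

lemma Cb_minus:
  assumes "\<forall>i\<in>I. open (U i)" "Cb k I U f"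
  shows "Cb k I U (\<lambda>i x. - f i x)"
  using Cb_cmult[OF assms, of "-1"] by simp

lemma Cb_power:
  assumes "\<forall>i\<in>I. open (U i)" "Cb k I U f"
  shows "Cb k I U (\<lambda>i x. f i x ^ m)"
proof (induction m)
  case 0
  then show ?case using Cb_const[of I "\<lambda>_. 1" 1] by simp
next
  case (Suc m)
  then show ?case using Cb_mult[OF assms Suc.IH] by simp
qed

lemma Cb_inverse:
  assumes op: "\<forall>i\<in>I. open (U i)" and "Cb k I U f"
    and a: "0 < a" "\<And>i x. i \<in> I \<Longrightarrow> x \<in> U i \<Longrightarrow> a \<le> \<bar>f i x\<bar>"
  shows "Cb k I U (\<lambda>i x. inverse (f i x))"
  using assms(2)
proof (induction k)
  have nz: "f i x \<noteq> 0" if "i \<in> I" "x \<in> U i" for i x using a(2)[OF that] a(1) by auto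
  have bd: "\<forall>i\<in>I. \<forall>x\<in>U i. \<bar>inverse (f i x)\<bar> \<le> inverse a"
    using a by (auto simp: abs_inverse intro!: le_imp_inverse_le)
  { case 0
    then show ?case using bd nz by (auto intro!: continuous_on_inverse)
  next
    case (Suc k)
    show ?case
    proof (rule Cb_SucI[OF op])
      show "\<exists>B. \<forall>i\<in>I. \<forall>x\<in>U i. \<bar>inverse (f i x)\<bar> \<le> B" using bd by blast
      show "((\<lambda>x. inverse (f i x)) has_derivative
         (\<lambda>b. - (inverse (f i x) * frechet_derivative (f i) (at x) b * inverse (f i x)))) (at x)"
        if "i \<in> I" "x \<in> U i" for i x
        using Deriv.has_derivative_inverse[OF nz[OF that] Cb_der[OF Suc.prems that]] by simp
      show "Cb k I U (\<lambda>i x. - (inverse (f i x) * frechet_derivative (f i) (at x) b * inverse (f i x)))"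
        if "b \<in> Basis" for b
        using Suc.IH[OF Cb_Suc_imp[OF Suc.prems]] Cb_partial[OF Suc.prems that]
        by (intro Cb_minus Cb_mult op) auto
    qed }
qed

lemma Cb_inner:
  assumes op: "\<forall>i\<in>I. open (U i)" and "\<And>i x. i \<in> I \<Longrightarrow> x \<in> U i \<Longrightarrow> norm x \<le> B"
    and "\<And>i. i \<in> I \<Longrightarrow> norm (c i) \<le> C"
  shows "Cb k I U (\<lambda>i x. x \<bullet> c i)"
proof -
  have bd: "\<bar>x \<bullet> c i\<bar> \<le> \<bar>B\<bar> * \<bar>C\<bar>" if "i \<in> I" "x \<in> U i" for i x
  proof -
    have "\<bar>x \<bullet> c i\<bar> \<le> norm x * norm (c i)" by (rule Cauchy_Schwarz_ineq2)
    also have "\<dots> \<le> \<bar>B\<bar> * \<bar>C\<bar>" using assms(2)[OF that] assms(3)[OF that(1)] by (intro mult_mono) auto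
    finally show ?thesis .
  qed
  show ?thesis
  proof (cases k)
    case 0
    then show ?thesis using bd by (auto intro!: continuous_intros)
  next
    case (Suc m)
    show ?thesis unfolding Suc
    proof (rule Cb_SucI[OF op])
      show "\<exists>B. \<forall>i\<in>I. \<forall>x\<in>U i. \<bar>x \<bullet> c i\<bar> \<le> B" using bd by blast
      show "((\<lambda>x. x \<bullet> c i) has_derivative (\<lambda>h. h \<bullet> c i)) (at x)" for i x
        by (intro derivative_intros)
      show "Cb m I U (\<lambda>i x. b \<bullet> c i)" if "b \<in> Basis" for b
      proof (rule Cb_const[of _ _ C])
        fix i assume "i \<in> I"
        then show "\<bar>b \<bullet> c i\<bar> \<le> C"
          using Basis_le_norm[OF that, of "c i"] assms(3) by (force simp: inner_commute)
      qed
    qed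
  qed
qed

lemma Cb_compose:
  fixes f :: "'i \<Rightarrow> 'b::euclidean_space \<Rightarrow> real" and g :: "'i \<Rightarrow> 'a::euclidean_space \<Rightarrow> 'b"
  assumes opU: "\<forall>i\<in>I. open (U i)" and "Cb k I V f"
    and "\<And>b. b \<in> Basis \<Longrightarrow> Cb k I U (\<lambda>i x. g i x \<bullet> b)"
    and gV: "\<And>i x. i \<in> I \<Longrightarrow> x \<in> U i \<Longrightarrow> g i x \<in> V i"
  shows "Cb k I U (\<lambda>i x. f i (g i x))"
  using assms(2,3)
proof (induction k arbitrary: f)
  case 0
  have "continuous_on (U i) (\<lambda>x. f i (g i x))" if i: "i \<in> I" for i
  proof (rule continuous_on_compose2[of "V i" "f i" "U i" "g i"])
    show "continuous_on (V i) (f i)" using Cb_continuous[OF 0(1) i] .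
    show "continuous_on (U i) (g i)"
      unfolding continuous_on_componentwise[of "U i" "g i"]
      using Cb_continuous[OF 0(2) i] by blast
  qed (use gV i in auto)
  moreover have "\<exists>B. \<forall>i\<in>I. \<forall>x\<in>U i. \<bar>f i (g i x)\<bar> \<le> B"
    using Cb_bounded[OF 0(1)] gV by meson
  ultimately show ?case by simp
next
  case (Suc k)
  note f = Suc.prems(1)
  note g = Suc.prems(2)
  have g': "Cb k I U (\<lambda>i x. g i x \<bullet> b)" if "b \<in> Basis" for b
    using Cb_Suc_imp[OF g[OF that]] .
  show ?case
  proof (rule Cb_SucI[OF opU])
    show "\<exists>B. \<forall>i\<in>I. \<forall>x\<in>U i. \<bar>f i (g i x)\<bar> \<le> B" using Cb_bounded[OF f] gV by meson
    show "((\<lambda>x. f i (g i x)) has_derivative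
        (\<lambda>h. \<Sum>b\<in>Basis. frechet_derivative (\<lambda>x. g i x \<bullet> b) (at x) h *
                 frechet_derivative (f i) (at (g i x)) b)) (at x)" if ix: "i \<in> I" "x \<in> U i" for i x
    proof -
      let ?f' = "frechet_derivative (f i) (at (g i x))"
      have df: "(f i has_derivative ?f') (at (g i x))"
        using Cb_der[OF f ix(1) gV[OF ix]] .
      have dg: "(g i has_derivative
         (\<lambda>h. \<Sum>b\<in>Basis. frechet_derivative (\<lambda>x. g i x \<bullet> b) (at x) h *\<^sub>R b)) (at x)"
      proof (subst has_derivative_componentwise_within, intro ballI)
        fix b :: 'b assume b: "b \<in> Basis"
        have "(\<lambda>h. (\<Sum>b\<in>Basis. frechet_derivative (\<lambda>x. g i x \<bullet> b) (at x) h *\<^sub>R b) \<bullet> b)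
             = frechet_derivative (\<lambda>x. g i x \<bullet> b) (at x)"
          by (rule ext) (use b in simp)
        then show "((\<lambda>x. g i x \<bullet> b) has_derivative (\<lambda>h. (\<Sum>b\<in>Basis.
            frechet_derivative (\<lambda>x. g i x \<bullet> b) (at x) h *\<^sub>R b) \<bullet> b)) (at x)"
          using Cb_der[OF g[OF b] ix] by simp
      qed
      have lin: "linear ?f'" using df has_derivative_linear by blast
      have "(\<lambda>h. ?f' (\<Sum>b\<in>Basis. frechet_derivative (\<lambda>x. g i x \<bullet> b) (at x) h *\<^sub>R b))
          = (\<lambda>h. \<Sum>b\<in>Basis. frechet_derivative (\<lambda>x. g i x \<bullet> b) (at x) h * ?f' b)"
        by (simp add: linear_sum[OF lin] linear_cmul[OF lin])
      then show ?thesis using has_derivative_compose[OF dg df] by simp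
    qed
    show "Cb k I U (\<lambda>i x. \<Sum>c\<in>Basis. frechet_derivative (\<lambda>x. g i x \<bullet> c) (at x) b *
                 frechet_derivative (f i) (at (g i x)) c)" if b: "b \<in> Basis" for b
    proof (rule Cb_sum[OF opU finite_Basis])
      fix c :: 'b assume c: "c \<in> Basis"
      have "Cb k I U (\<lambda>i x. frechet_derivative (f i) (at (g i x)) c)"
        by (rule Suc.IH[OF Cb_partial[OF f c] g'])
      then show "Cb k I U (\<lambda>i x. frechet_derivative (\<lambda>x. g i x \<bullet> c) (at x) b *
                 frechet_derivative (f i) (at (g i x)) c)"
        by (rule Cb_mult[OF opU Cb_partial[OF g[OF c] b]])
    qed
  qed
qed

lemma Cb_reindex:
  assumes "Cb k I U f" "\<And>j. j \<in> J \<Longrightarrow> h j \<in> I"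
  shows "Cb k J (\<lambda>j. U (h j)) (\<lambda>j. f (h j))"
  using assms(1)
proof (induction k arbitrary: f)
  case 0
  have "\<exists>B. \<forall>j\<in>J. \<forall>x\<in>U (h j). \<bar>f (h j) x\<bar> \<le> B"
    using Cb_bounded[OF 0] assms(2) by meson
  then show ?case using 0 assms(2) by simp
next
  case (Suc k)
  have "Cb k J (\<lambda>j. U (h j)) (\<lambda>j x. frechet_derivative (f (h j)) (at x) b)" if "b \<in> Basis" for b
    using Suc.IH[OF Cb_partial[OF Suc.prems that]] .
  moreover have "\<exists>B. \<forall>j\<in>J. \<forall>x\<in>U (h j). \<bar>f (h j) x\<bar> \<le> B"
    using Cb_bounded[OF Suc.prems] assms(2) by meson
  ultimately show ?case using Suc.prems assms(2) by simp
qed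

lemma Cb_subset:
  assumes "Cb k I U f" "\<And>i. i \<in> I \<Longrightarrow> V i \<subseteq> U i"
  shows "Cb k I V f"
  using assms(1)
proof (induction k arbitrary: f)
  case 0
  have "\<exists>B. \<forall>i\<in>I. \<forall>x\<in>V i. \<bar>f i x\<bar> \<le> B"
    using Cb_bounded[OF 0] assms(2) by (meson subsetD)
  moreover have "continuous_on (V i) (f i)" if "i \<in> I" for i
    using continuous_on_subset[OF Cb_continuous[OF 0 that] assms(2)[OF that]] .
  ultimately show ?case by simp
next
  case (Suc k)
  have "\<exists>B. \<forall>i\<in>I. \<forall>x\<in>V i. \<bar>f i x\<bar> \<le> B"
    using Cb_bounded[OF Suc.prems] assms(2) by (meson subsetD)
  moreover have "Cb k I V (\<lambda>i x. frechet_derivative (f i) (at x) b)" if "b \<in> Basis" for b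
    using Suc.IH[OF Cb_partial[OF Suc.prems that]] .
  moreover have "f i differentiable (at x)" if "i \<in> I" "x \<in> V i" for i x
    using Cb_differentiable[OF Suc.prems that(1)] assms(2)[OF that(1)] that(2) by blast
  ultimately show ?case by simp
qed

lemma has_real_derivative_pos_power:
  "((\<lambda>z. max 0 z ^ Suc (Suc m)) has_real_derivative (real (Suc (Suc m)) * max 0 z ^ Suc m)) (at z)"
proof (cases "z = 0")
  case True
  \<comment> \<open>At \<open>0\<close> the difference quotient is itself the power with exponent \<open>m + 1\<close>.\<close>
  have lim: "((\<lambda>h::real. max 0 h ^ Suc m) \<longlongrightarrow> max 0 0 ^ Suc m) (at 0)"
    by (intro tendsto_intros)
  have "((\<lambda>h. (max 0 (0 + h) ^ Suc (Suc m) - max 0 0 ^ Suc (Suc m)) / h) \<longlongrightarrow> 0) (at (0::real))"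
  proof (rule Lim_transform_eventually)
    show "((\<lambda>h::real. max 0 h ^ Suc m) \<longlongrightarrow> 0) (at 0)" using lim by simp
    show "\<forall>\<^sub>F h in at (0::real). max 0 h ^ Suc m = (max 0 (0 + h) ^ Suc (Suc m) - max 0 0 ^ Suc (Suc m)) / h"
      unfolding eventually_at_filter by (rule always_eventually) (auto simp: max_def)
  qed
  then show ?thesis using True by (simp add: DERIV_def)
next
  case False
  show ?thesis
  proof (cases "z > 0")
    case True
    have "((\<lambda>z. z ^ Suc (Suc m)) has_real_derivative (real (Suc (Suc m)) * max 0 z ^ Suc m)) (at z)"
      using DERIV_pow[of "Suc (Suc m)" z] True by (simp add: max_def)
    then show ?thesis
      by (rule has_field_derivative_transform_within_open[where S="{0<..}"]) (use True in auto)
  next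
    case z: False
    have "((\<lambda>z::real. 0) has_real_derivative (real (Suc (Suc m)) * max 0 z ^ Suc m)) (at z)"
      using z False by (auto intro!: derivative_eq_intros)
    then show ?thesis
      by (rule has_field_derivative_transform_within_open[where S="{..<0}"]) (use z False in auto)
  qed
qed

text \<open>
  The positive part of a function is not smooth where the function vanishes, but its
  power \<open>m + 1\<close> has \<open>m\<close> continuous derivatives: each differentiation lowers the exponent by one and
  leaves a power of the same kind.
\<close>

lemma Cb_pos_power:
  assumes op: "\<forall>i\<in>I. open (U i)" and "Cb k I U f"
  shows "Cb k I U (\<lambda>i x. max 0 (f i x) ^ Suc (k + m))"
  using assms(2)
proof (induction k)
  obtain B where B: "\<forall>i\<in>I. \<forall>x\<in>U i. \<bar>f i x\<bar> \<le> B" using Cb_bounded[OF assms(2)] by blast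
  have bd: "\<exists>C. \<forall>i\<in>I. \<forall>x\<in>U i. \<bar>max 0 (f i x) ^ n\<bar> \<le> C" for n
  proof (intro exI ballI)
    fix i x assume "i \<in> I" "x \<in> U i"
    then have "max 0 (f i x) \<le> \<bar>B\<bar>" using B by force
    then show "\<bar>max 0 (f i x) ^ n\<bar> \<le> \<bar>B\<bar> ^ n" by (simp add: power_mono)
  qed
  { case 0
    then show ?case using bd[of "Suc m"] by (auto intro!: continuous_intros)
  next
    case (Suc k)
    show ?case
    proof (rule Cb_SucI[OF op bd])
      show "((\<lambda>x. max 0 (f i x) ^ Suc (Suc k + m)) has_derivative (\<lambda>h.
          frechet_derivative (f i) (at x) h * (real (Suc (Suc (k + m))) * max 0 (f i x) ^ Suc (k + m)))) (at x)"
        if ix: "i \<in> I" "x \<in> U i" for i x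
      proof -
        have "((\<lambda>z. max 0 z ^ Suc (Suc k + m)) has_derivative
            (\<lambda>h. h * (real (Suc (Suc (k + m))) * max 0 (f i x) ^ Suc (k + m)))) (at (f i x))"
          using has_real_derivative_pos_power[of "k + m" "f i x"]
          unfolding has_field_derivative_def add_Suc by (subst mult.commute[of _ "real _ * _"])
        from has_derivative_compose[OF Cb_der[OF Suc.prems ix] this] show ?thesis .
      qed
      show "Cb k I U (\<lambda>i x. frechet_derivative (f i) (at x) b *
          (real (Suc (Suc (k + m))) * max 0 (f i x) ^ Suc (k + m)))" if "b \<in> Basis" for b
        by (intro Cb_mult Cb_cmult op Suc.IH Cb_partial[OF Suc.prems that] Cb_Suc_imp[OF Suc.prems])
    qed }
qed

text \<open>
  A function that vanishes outside the unit ball has vanishing derivatives there, so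
  bounds on a larger ball are global bounds.
\<close>

lemma Cb_extend_zero:
  assumes "Cb k I (\<lambda>_. ball 0 2) f" "\<And>i x. i \<in> I \<Longrightarrow> norm x > 1 \<Longrightarrow> f i x = 0"
  shows "Cb k I (\<lambda>_. UNIV) f"
  using assms
proof (induction k arbitrary: f)
  case 0
  have "continuous_on UNIV (f i)" if i: "i \<in> I" for i
  proof -
    have "continuous_on (ball 0 2) (f i)" using Cb_continuous[OF 0(1) i] .
    moreover have "continuous_on (- cball 0 1) (f i)"
      using continuous_on_const[of "- cball 0 1" 0]
      by (rule continuous_on_cong[THEN iffD1, rotated -1]) (use 0(2)[OF i] in auto)
    ultimately have "continuous_on (ball 0 2 \<union> - cball 0 1) (f i)"
      by (intro continuous_on_open_Un) (auto simp: open_Compl)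
    moreover have "ball 0 2 \<union> - cball 0 1 = (UNIV :: 'b set)" by auto
    ultimately show ?thesis by simp
  qed
  moreover obtain B where "\<forall>i\<in>I. \<forall>x\<in>ball 0 2. \<bar>f i x\<bar> \<le> B" using 0 by auto
  then have "\<bar>f i x\<bar> \<le> max 0 B" if "i \<in> I" for i x
    using 0(2)[OF that, of x] that by (cases "norm x > 1") (auto simp: le_max_iff_disj)
  ultimately show ?case by auto
next
  case (Suc k)
  have der0: "(f i has_derivative (\<lambda>_. 0)) (at x)" if "i \<in> I" "norm x > 1" for i x
  proof -
    have "((\<lambda>_. 0) has_derivative (\<lambda>_. 0)) (at x)" by simp
    then show ?thesis
      by (rule has_derivative_transform_within_open[where s="- cball 0 1"])
        (use that Suc.prems(2) in \<open>auto simp: open_Compl\<close>)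
  qed
  obtain B where "\<forall>i\<in>I. \<forall>x\<in>ball 0 2. \<bar>f i x\<bar> \<le> B" using Cb_bounded[OF Suc.prems(1)] by auto
  then have "\<bar>f i x\<bar> \<le> max 0 B" if "i \<in> I" for i x
    using Suc.prems(2)[OF that, of x] that by (cases "norm x > 1") (auto simp: le_max_iff_disj)
  moreover have "f i differentiable (at x)" if "i \<in> I" for i x
  proof (cases "norm x > 1")
    case True
    then show ?thesis using der0[OF that] unfolding differentiable_def by blast
  next
    case False
    then show ?thesis using Cb_differentiable[OF Suc.prems(1) that] by auto
  qed
  moreover have "Cb k I (\<lambda>_. UNIV) (\<lambda>i x. frechet_derivative (f i) (at x) b)" if "b \<in> Basis" for b
  proof (rule Suc.IH[OF Cb_partial[OF Suc.prems(1) that]])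
    fix i x assume "i \<in> I" "1 < norm (x::'b)"
    then show "frechet_derivative (f i) (at x) b = 0"
      using frechet_derivative_at[OF der0] by metis
  qed
  ultimately show ?case by auto
qed

text \<open>
  Shrinking the width of a function by the factor \<open>g i\<close> multiplies each derivative of
  order \<open>j\<close> by \<open>g i ^ (- j)\<close>; the prefactor \<open>g i ^ k\<close> compensates this up to order \<open>k\<close>. In the
  induction, one differentiation consumes one factor \<open>g i\<close>.
\<close>

lemma Cb_rescale:
  fixes G :: "'a::euclidean_space \<Rightarrow> real"
  assumes "Cb k {()} (\<lambda>_. UNIV) (\<lambda>_. G)"
    and g: "\<And>i. i \<in> I \<Longrightarrow> 0 < g i \<and> g i \<le> 1"
  shows "Cb k I (\<lambda>_. UNIV) (\<lambda>i x. g i ^ k * G ((x - e) /\<^sub>R g i))"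
  using assms(1)
proof (induction k arbitrary: G)
  case 0
  have "continuous_on UNIV G" using Cb_continuous[OF 0] by simp
  then have "continuous_on UNIV (\<lambda>x. G ((x - e) /\<^sub>R g i))" for i
    by (rule continuous_on_compose2) (auto intro!: continuous_intros)
  then show ?case using Cb_bounded[OF 0] by auto
next
  case (Suc k)
  obtain B where B: "\<And>x. \<bar>G x\<bar> \<le> B" using Cb_bounded[OF Suc.prems] by auto
  show ?case
  proof (rule Cb_SucI)
    show "\<exists>B. \<forall>i\<in>I. \<forall>x\<in>UNIV. \<bar>g i ^ Suc k * G ((x - e) /\<^sub>R g i)\<bar> \<le> B"
    proof (intro exI ballI)
      fix i x assume "i \<in> I"
      then have "\<bar>g i ^ Suc k\<bar> \<le> 1" using g[of i] by (simp add: power_le_one abs_mult mult_le_one)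
      then show "\<bar>g i ^ Suc k * G ((x - e) /\<^sub>R g i)\<bar> \<le> 1 * B"
        unfolding abs_mult by (intro mult_mono B) auto
    qed
    show "((\<lambda>x. g i ^ Suc k * G ((x - e) /\<^sub>R g i)) has_derivative
       (\<lambda>h. g i ^ k * frechet_derivative G (at ((x - e) /\<^sub>R g i)) h)) (at x)" if i: "i \<in> I" for i x
    proof -
      let ?D = "frechet_derivative G (at ((x - e) /\<^sub>R g i))"
      have D: "(G has_derivative ?D) (at ((x - e) /\<^sub>R g i))"
        using Cb_der[OF Suc.prems] by simp
      have lin: "linear ?D" using D has_derivative_linear by blast
      have "((\<lambda>x. (x - e) /\<^sub>R g i) has_derivative (\<lambda>h. h /\<^sub>R g i)) (at x)"
        by (auto intro!: derivative_eq_intros)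
      from has_derivative_mult_right[OF has_derivative_compose[OF this D], of "g i ^ Suc k"]
      have "((\<lambda>x. g i ^ Suc k * G ((x - e) /\<^sub>R g i)) has_derivative (\<lambda>h. g i ^ Suc k * ?D (h /\<^sub>R g i))) (at x)" .
      moreover have "(\<lambda>h. g i ^ Suc k * ?D (h /\<^sub>R g i)) = (\<lambda>h. g i ^ k * ?D h)"
        using g[OF i] by (auto simp: linear_cmul[OF lin])
      ultimately show ?thesis by simp
    qed
    show "Cb k I (\<lambda>_. UNIV) (\<lambda>i x. g i ^ k * frechet_derivative G (at ((x - e) /\<^sub>R g i)) b)"
      if "b \<in> Basis" for b
      by (rule Suc.IH) (use Cb_partial[OF Suc.prems that] in simp)
  qed auto
qed

text \<open>
  Passage from partial derivatives to iterated differentials in arbitrary directions. The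
  list of directions becomes part of the index, so the bounds are automatically uniform over all
  directions of norm at most \<open>C\<close>; this is what an operator norm needs.
\<close>

lemma Cb_iter_deriv:
  fixes f :: "'i \<Rightarrow> 'a::euclidean_space \<Rightarrow> real"
  assumes op: "\<forall>i\<in>I. open (U i)" and f: "Cb k I U f" and "j \<le> k"
  shows "Cb (k - j) (I \<times> {hs. length hs = j \<and> (\<forall>h\<in>set hs. norm h \<le> C)}) (\<lambda>p. U (fst p))
     (\<lambda>p. iter_deriv (snd p) (f (fst p)))"
  using \<open>j \<le> k\<close>
proof (induction j)
  case 0
  show ?case
  proof -
    have "Cb k (I \<times> {hs. length hs = 0 \<and> (\<forall>h\<in>set hs. norm h \<le> C)}) (\<lambda>p. U (fst p)) (\<lambda>p. f (fst p))"
      by (rule Cb_reindex[OF f, of _ fst]) auto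
    then show ?thesis unfolding diff_zero
      by (rule Cb_cong[rotated -1]) (use op in auto)
  qed
next
  case (Suc j)
  let ?J = "I \<times> {hs::'a list. length hs = Suc j \<and> (\<forall>h\<in>set hs. norm h \<le> C)}"
  have kj: "k - j = Suc (k - Suc j)" using Suc.prems by auto
  have "Cb (k - j) ?J (\<lambda>p. U (fst (fst p, tl (snd p)))) (\<lambda>p. iter_deriv (snd (fst p, tl (snd p))) (f (fst (fst p, tl (snd p)))))"
    by (rule Cb_reindex[OF Suc.IH, where h = "\<lambda>p. (fst p, tl (snd p))"])
      (use Suc.prems in \<open>auto dest: list.set_sel(2)[rotated]\<close>)
  then have *: "Cb (Suc (k - Suc j)) ?J (\<lambda>p. U (fst p)) (\<lambda>p. iter_deriv (tl (snd p)) (f (fst p)))"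
    unfolding kj by simp
  have opJ: "\<forall>p\<in>?J. open (U (fst p))" using op by auto
  show ?case
  proof (rule Cb_cong[OF opJ])
    show "Cb (k - Suc j) ?J (\<lambda>p. U (fst p)) (\<lambda>p x. \<Sum>b\<in>Basis. (hd (snd p) \<bullet> b) *
        frechet_derivative (iter_deriv (tl (snd p)) (f (fst p))) (at x) b)"
    proof (intro Cb_sum Cb_mult opJ Cb_partial[OF *] finite_Basis)
      fix b :: 'a assume b: "b \<in> Basis"
      show "Cb (k - Suc j) ?J (\<lambda>p. U (fst p)) (\<lambda>p x. hd (snd p) \<bullet> b)"
      proof (rule Cb_const)
        fix p assume p: "p \<in> ?J"
        then have "norm (hd (snd p)) \<le> C" by (cases "snd p") auto
        then show "\<bar>hd (snd p) \<bullet> b\<bar> \<le> C" using Basis_le_norm[OF b] order_trans by blast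
      qed
    qed
  next
    fix p x assume p: "p \<in> ?J" and x: "x \<in> U (fst p)"
    let ?g = "iter_deriv (tl (snd p)) (f (fst p))"
    have lin: "linear (frechet_derivative ?g (at x))"
      using Cb_der[OF * p x] has_derivative_linear by blast
    obtain h hs where hs: "snd p = h # hs" using p by (cases "snd p") auto
    have "frechet_derivative ?g (at x) h = frechet_derivative ?g (at x) (\<Sum>b\<in>Basis. (h \<bullet> b) *\<^sub>R b)"
      by (simp add: euclidean_representation)
    also have "\<dots> = (\<Sum>b\<in>Basis. (h \<bullet> b) * frechet_derivative ?g (at x) b)"
      by (simp add: linear_sum[OF lin] linear_cmul[OF lin])
    finally show "(\<Sum>b\<in>Basis. (hd (snd p) \<bullet> b) * frechet_derivative ?g (at x) b)
       = iter_deriv (snd p) (f (fst p)) x" by (simp add: hs)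
  qed
qed

lemma Cb_iter_deriv_bound:
  fixes f :: "'i \<Rightarrow> 'a::euclidean_space \<Rightarrow> real"
  assumes op: "\<forall>i\<in>I. open (U i)" and f: "Cb k I U f"
  shows "\<exists>B>0. \<forall>i\<in>I. \<forall>x\<in>U i. \<forall>hs. length hs \<le> k \<and> (\<forall>h\<in>set hs. norm h \<le> 1) \<longrightarrow>
    \<bar>iter_deriv hs (f i) x\<bar> \<le> B"
proof -
  have "\<forall>j\<le>k. \<exists>B. \<forall>i\<in>I. \<forall>x\<in>U i. \<forall>hs::'a list. length hs = j \<and> (\<forall>h\<in>set hs. norm h \<le> 1) \<longrightarrow>
    \<bar>iter_deriv hs (f i) x\<bar> \<le> B"
    using Cb_bounded[OF Cb_iter_deriv[OF op f, of _ 1]] by fastforce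
  then obtain B where B: "\<And>j i x hs. j \<le> k \<Longrightarrow> i \<in> I \<Longrightarrow> x \<in> U i \<Longrightarrow>
      length hs = j \<Longrightarrow> (\<forall>h\<in>set hs. norm h \<le> 1) \<Longrightarrow> \<bar>iter_deriv hs (f i) x\<bar> \<le> B j" by metis
  show ?thesis
  proof (intro exI[of _ "1 + (\<Sum>j\<le>k. \<bar>B j\<bar>)"] conjI ballI allI impI)
    show "0 < 1 + (\<Sum>j\<le>k. \<bar>B j\<bar>)" by (smt (verit) sum_nonneg abs_ge_zero)
    fix i x and hs :: "'a list"
    assume a: "i \<in> I" "x \<in> U i" "length hs \<le> k \<and> (\<forall>h\<in>set hs. norm h \<le> 1)"
    then have "\<bar>iter_deriv hs (f i) x\<bar> \<le> \<bar>B (length hs)\<bar>" using B[of "length hs" i x hs] by auto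
    also have "\<dots> \<le> (\<Sum>j\<le>k. \<bar>B j\<bar>)" by (rule member_le_sum) (use a in auto)
    finally show "\<bar>iter_deriv hs (f i) x\<bar> \<le> 1 + (\<Sum>j\<le>k. \<bar>B j\<bar>)" by simp
  qed
qed

lemma Cb_imp_Ck_on:
  fixes f :: "'i \<Rightarrow> 'a::euclidean_space \<Rightarrow> real"
  assumes op: "\<forall>i\<in>I. open (U i)" and f: "Cb k I U f" and i: "i \<in> I"
  shows "Ck_on k (U i) (f i)"
proof -
  have *: "Cb (k - length hs) (I \<times> {hs'. length hs' = length hs \<and> (\<forall>h\<in>set hs'. norm h \<le> Max (insert 0 (norm ` set hs)))})
      (\<lambda>p. U (fst p)) (\<lambda>p. iter_deriv (snd p) (f (fst p)))" if "length hs \<le> k" for hs :: "'a list"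
    by (rule Cb_iter_deriv[OF op f that])
  have mem: "(i, hs) \<in> I \<times> {hs'::'a list. length hs' = length hs \<and> (\<forall>h\<in>set hs'. norm h \<le> Max (insert 0 (norm ` set hs)))}" for hs
    using i by auto
  show ?thesis unfolding Ck_on_def
  proof (intro conjI allI impI ballI)
    fix hs :: "'a list" and x assume hs: "length hs < k" and x: "x \<in> U i"
    then have "k - length hs = Suc (k - Suc (length hs))" by auto
    with *[of hs] hs have "Cb (Suc (k - Suc (length hs))) (I \<times> {hs'. length hs' = length hs \<and> (\<forall>h\<in>set hs'. norm h \<le> Max (insert 0 (norm ` set hs)))})
      (\<lambda>p. U (fst p)) (\<lambda>p. iter_deriv (snd p) (f (fst p)))" by simp
    from Cb_differentiable[OF this mem] x show "iter_deriv hs (f i) differentiable (at x)" by simp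
  next
    fix hs :: "'a list" assume hs: "length hs \<le> k"
    show "continuous_on (U i) (iter_deriv hs (f i))"
      using Cb_continuous[OF *[OF hs] mem] by simp
  qed
qed

lemma iter_deriv_cong_open:
  assumes "open U" "\<And>x. x \<in> U \<Longrightarrow> f x = g x" "x \<in> U"
  shows "iter_deriv hs f x = iter_deriv hs g x"
  using assms(3)
proof (induction hs arbitrary: x)
  case Nil then show ?case using assms by simp
next
  case (Cons h hs)
  have "frechet_derivative (iter_deriv hs f) (at x) = frechet_derivative (iter_deriv hs g) (at x)"
    by (rule frechet_derivative_cong_open[OF assms(1) Cons.prems(1)]) (rule Cons.IH)
  then show ?case by simp
qed

lemma Ck_on_mono: "Ck_on k U f \<Longrightarrow> m \<le> k \<Longrightarrow> Ck_on m U f"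
  unfolding Ck_on_def by auto

lemma Ck_on_subset: "Ck_on k U f \<Longrightarrow> V \<subseteq> U \<Longrightarrow> Ck_on k V f"
  unfolding Ck_on_def by (meson continuous_on_subset subsetD)

text \<open>
  Charts and the functions \<open>N\<close> of the graph parametrizations are linear images
  of a scalar function plus an affine map, so their differentials reduce to those of scalars.
\<close>

lemma iter_deriv_linear_combination:
  fixes f :: "'a::euclidean_space \<Rightarrow> 'c::real_normed_vector" and g :: "'a \<Rightarrow> 'd::real_normed_vector"
  assumes op: "open U" and f: "Ck_on k U f" and g: "Ck_on k U g"
    and A: "bounded_linear A" and B: "bounded_linear B"
    and "length hs \<le> k" "x \<in> U"
  shows "iter_deriv hs (\<lambda>x. A (f x) + B (g x)) x = A (iter_deriv hs f x) + B (iter_deriv hs g x)"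
  using assms(6,7)
proof (induction hs arbitrary: x)
  case (Cons h hs)
  have df: "(iter_deriv hs f has_derivative frechet_derivative (iter_deriv hs f) (at x)) (at x)"
    using f Cons.prems unfolding Ck_on_def frechet_derivative_works by auto
  have dg: "(iter_deriv hs g has_derivative frechet_derivative (iter_deriv hs g) (at x)) (at x)"
    using g Cons.prems unfolding Ck_on_def frechet_derivative_works by auto
  have "((\<lambda>x. A (iter_deriv hs f x) + B (iter_deriv hs g x)) has_derivative
     (\<lambda>h. A (frechet_derivative (iter_deriv hs f) (at x) h) + B (frechet_derivative (iter_deriv hs g) (at x) h))) (at x)"
    by (intro has_derivative_add bounded_linear.has_derivative[OF A] bounded_linear.has_derivative[OF B] df dg)
  then have "frechet_derivative (\<lambda>x. A (iter_deriv hs f x) + B (iter_deriv hs g x)) (at x)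
     = (\<lambda>h. A (frechet_derivative (iter_deriv hs f) (at x) h) + B (frechet_derivative (iter_deriv hs g) (at x) h))"
    using frechet_derivative_at by metis
  moreover have "frechet_derivative (iter_deriv hs (\<lambda>x. A (f x) + B (g x))) (at x)
    = frechet_derivative (\<lambda>x. A (iter_deriv hs f x) + B (iter_deriv hs g x)) (at x)"
    using Cons by (intro frechet_derivative_cong_open[OF op]) auto
  ultimately show ?case by simp
qed auto

lemma Ck_on_linear_combination:
  fixes f :: "'a::euclidean_space \<Rightarrow> 'c::real_normed_vector" and g :: "'a \<Rightarrow> 'd::real_normed_vector"
    and A :: "'c \<Rightarrow> 'e::real_normed_vector"
  assumes op: "open U" and f: "Ck_on k U f" and g: "Ck_on k U g"
    and A: "bounded_linear A" and B: "bounded_linear B"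
  shows "Ck_on k U (\<lambda>x. A (f x) + B (g x))"
  unfolding Ck_on_def
proof (intro conjI allI impI ballI)
  fix hs :: "'a list" and x assume hs: "length hs < k" and x: "x \<in> U"
  then have "(iter_deriv hs f has_derivative frechet_derivative (iter_deriv hs f) (at x)) (at x)"
    "(iter_deriv hs g has_derivative frechet_derivative (iter_deriv hs g) (at x)) (at x)"
    using f g unfolding Ck_on_def frechet_derivative_works by auto
  from has_derivative_add[OF bounded_linear.has_derivative[OF A this(1)] bounded_linear.has_derivative[OF B this(2)]]
  have "(\<lambda>x. A (iter_deriv hs f x) + B (iter_deriv hs g x)) differentiable (at x)"
    unfolding differentiable_def by blast
  moreover have "(\<lambda>x. A (iter_deriv hs f x) + B (iter_deriv hs g x)) differentiable (at x)
     \<longleftrightarrow> iter_deriv hs (\<lambda>x. A (f x) + B (g x)) differentiable (at x)"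
    using iter_deriv_linear_combination[OF op f g A B] hs
    by (intro differentiable_cong_open[OF op x]) simp
  ultimately show "iter_deriv hs (\<lambda>x. A (f x) + B (g x)) differentiable (at x)" by simp
next
  fix hs :: "'a list" assume hs: "length hs \<le> k"
  have "continuous_on U (\<lambda>x. A (iter_deriv hs f x) + B (iter_deriv hs g x))"
    using f g hs unfolding Ck_on_def
    by (intro continuous_on_add bounded_linear.continuous_on[OF A] bounded_linear.continuous_on[OF B]) auto
  then show "continuous_on U (iter_deriv hs (\<lambda>x. A (f x) + B (g x)))"
    by (rule continuous_on_eq) (rule iter_deriv_linear_combination[OF op f g A B hs, symmetric])
qed

lemma Ck_on_const: "Ck_on k U (\<lambda>_::'a::euclidean_space. c)"
proof -
  have "\<exists>c'. iter_deriv hs (\<lambda>_. c) = (\<lambda>_. c')" for hs :: "'a list"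
    by (induction hs) auto
  then have "iter_deriv hs (\<lambda>_. c) differentiable (at x)" "continuous_on U (iter_deriv hs (\<lambda>_. c))"
    for hs :: "'a list" and x
    by (metis differentiable_const, metis continuous_on_const)
  then show ?thesis unfolding Ck_on_def by blast
qed

lemma Ck_on_id: "Ck_on k U (\<lambda>x::'a::euclidean_space. x)"
proof -
  have *: "iter_deriv hs (\<lambda>x. x) = (\<lambda>x. x) \<or> (\<exists>c. iter_deriv hs (\<lambda>x. x) = (\<lambda>_. c))" for hs :: "'a list"
  proof (induction hs)
    case (Cons h hs)
    then show ?case
    proof
      assume "iter_deriv hs (\<lambda>x. x) = (\<lambda>x. x)"
      then show ?thesis by auto
    qed auto
  qed auto
  have "iter_deriv hs (\<lambda>x. x) differentiable (at x)" "continuous_on U (iter_deriv hs (\<lambda>x. x))"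
    for hs :: "'a list" and x
    using *[of hs] by auto
  then show ?thesis unfolding Ck_on_def by blast
qed

section \<open>Change of variables in the Lebesgue integral\<close>

text \<open>
  A copy of the index set \<open>{..<CARD('d)}\<close> that depends on the type \<open>'d\<close> and is well-ordered.
  The change of variables theorem on \<open>real^'m\<close> assumes a well-ordered index type \<open>'m\<close>; relabelling
  coordinates by \<open>'d widx\<close> makes it available for every finite \<open>'d\<close>.
\<close>

typedef ('d::finite) widx = "{..<CARD('d)} :: nat set"
  by (rule exI[of _ 0]) simp

instantiation widx :: (finite) wellorder
begin
definition less_eq_widx :: "'a widx \<Rightarrow> 'a widx \<Rightarrow> bool" where
  "less_eq_widx x y \<longleftrightarrow> Rep_widx x \<le> Rep_widx y"
definition less_widx :: "'a widx \<Rightarrow> 'a widx \<Rightarrow> bool" where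
  "less_widx x y \<longleftrightarrow> Rep_widx x < Rep_widx y"
instance
proof
  fix P :: "'a widx \<Rightarrow> bool" and a
  assume *: "\<And>x. (\<And>y. y < x \<Longrightarrow> P y) \<Longrightarrow> P x"
  show "P a"
    by (induction a rule: measure_induct[of Rep_widx]) (use * in \<open>auto simp: less_widx_def\<close>)
qed (auto simp: less_eq_widx_def less_widx_def Rep_widx_inject)
end

instance widx :: (finite) finite
proof
  have "UNIV = (Abs_widx ` {..<CARD('a)} :: 'a widx set)"
    by (metis type_definition.Abs_image type_definition_widx)
  then show "finite (UNIV :: 'a widx set)" by (rule ssubst) simp
qed

lemma bij_widx_exists: "\<exists>\<sigma> :: 'd::finite widx \<Rightarrow> 'd. bij \<sigma>"
proof -
  have "CARD('d widx) = CARD('d)"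
    using type_definition.card[OF type_definition_widx] by simp
  then show ?thesis using bij_betw_iff_card[of "UNIV :: 'd widx set" "UNIV :: 'd set"] by auto
qed

text \<open>
  Relabelling conjugates the permutations in the Leibniz formula, which preserves their
  signs.
\<close>

lemma det_reindex:
  fixes A :: "real^'n::finite^'n" and \<sigma> :: "'m::finite \<Rightarrow> 'n"
  assumes "bij \<sigma>"
  shows "det (\<chi> i j. A $ \<sigma> i $ \<sigma> j) = det A"
proof -
  let ?P = "\<lambda>p. map_permutation UNIV \<sigma> p"
  have inj: "inj_on \<sigma> UNIV" using assms by (simp add: bij_def)
  have app: "?P p (\<sigma> i) = \<sigma> (p i)" for p i
    using map_permutation_apply[OF inj, of i] by simp
  have bij: "bij_betw ?P {p. p permutes UNIV} {p. p permutes UNIV}"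
  proof (rule bij_betwI[where g = "map_permutation UNIV (inv \<sigma>)"])
    show "map_permutation UNIV (inv \<sigma>) \<in> {p. p permutes UNIV} \<rightarrow> {p. p permutes UNIV}"
      using map_permutation_permutes[OF bij_imp_bij_inv[OF assms]] by auto
    show "?P \<in> {p. p permutes UNIV} \<rightarrow> {p. p permutes UNIV}"
      using map_permutation_permutes[OF assms] by auto
    show "map_permutation UNIV (inv \<sigma>) (?P p) = p" if "p \<in> {p. p permutes UNIV}" for p
      by (rule map_permutation_compose_inv[OF assms]) (use that assms in \<open>auto simp: bij_is_inj\<close>)
    show "?P (map_permutation UNIV (inv \<sigma>) q) = q" if "q \<in> {p. p permutes UNIV}" for q
      by (rule map_permutation_compose_inv[OF bij_imp_bij_inv[OF assms]])
        (use that assms in \<open>auto simp: bij_is_surj surj_f_inv_f\<close>)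
  qed
  have "det A = (\<Sum>p | p permutes UNIV. of_int (sign (?P p)) * (\<Prod>i\<in>UNIV. A $ i $ ?P p i))"
    unfolding det_def by (rule sum.reindex_bij_betw[OF bij, symmetric])
  also have "\<dots> = (\<Sum>p | p permutes UNIV. of_int (sign p) * (\<Prod>i\<in>UNIV. A $ \<sigma> i $ \<sigma> (p i)))"
  proof (rule sum.cong[OF refl], goal_cases)
    case (1 p)
    have "(\<Prod>i\<in>UNIV. A $ i $ ?P p i) = (\<Prod>i\<in>UNIV. A $ \<sigma> i $ ?P p (\<sigma> i))"
      using prod.reindex_bij_betw[of \<sigma> UNIV UNIV "\<lambda>i. A $ i $ ?P p i"] assms by simp
    moreover have "sign (?P p) = sign p" using 1 sign_map_permutation[OF inj] by simp
    ultimately show ?case by (simp add: app)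
  qed
  finally show ?thesis by (simp add: det_def)
qed

lemma Basis_vec_real: "(Basis :: (real^'n::finite) set) = range (\<lambda>i. axis i 1)"
  by (auto simp: Basis_vec_def)

lemma prod_Basis_vec: "(\<Prod>b\<in>Basis. (x :: real^'n::finite) \<bullet> b) = (\<Prod>i\<in>UNIV. x $ i)"
  unfolding Basis_vec_real
  by (subst prod.reindex) (auto simp: inj_on_def axis_eq_axis cart_eq_inner_axis)

lemma distr_lborel_reindex:
  fixes \<sigma> :: "'m::finite \<Rightarrow> 'n::finite"
  assumes "bij \<sigma>"
  shows "distr lborel borel (\<lambda>x :: real^'n. \<chi> i. x $ \<sigma> i) = (lborel :: (real^'m) measure)"
proof (rule lborel_eqI[symmetric])
  let ?r = "\<lambda>x :: real^'n. (\<chi> i. x $ \<sigma> i) :: real^'m"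
  have meas: "?r \<in> borel_measurable lborel"
    by (auto intro!: borel_measurable_continuous_onI continuous_intros)
  fix l u :: "real^'m" assume lu: "\<And>b. b \<in> Basis \<Longrightarrow> l \<bullet> b \<le> u \<bullet> b"
  let ?q = "\<lambda>x :: real^'m. (\<chi> i. x $ inv \<sigma> i) :: real^'n"
  have i1: "inv \<sigma> (\<sigma> i) = i" for i using assms by (simp add: bij_is_inj)
  have i2: "\<sigma> (inv \<sigma> i) = i" for i using assms by (simp add: bij_is_surj surj_f_inv_f)
  have "?r -` box l u = box (?q l) (?q u)"
  proof (intro set_eqI)
    fix x :: "real^'n"
    have "(\<forall>i. l $ i < x $ \<sigma> i \<and> x $ \<sigma> i < u $ i) \<longleftrightarrow> (\<forall>i. l $ inv \<sigma> i < x $ i \<and> x $ i < u $ inv \<sigma> i)"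
      (is "?L \<longleftrightarrow> ?R")
    proof
      assume L: ?L
      show ?R
      proof
        fix i show "l $ inv \<sigma> i < x $ i \<and> x $ i < u $ inv \<sigma> i" using L[rule_format, of "inv \<sigma> i"] by (simp add: i2)
      qed
    next
      assume R: ?R
      show ?L
      proof
        fix i show "l $ i < x $ \<sigma> i \<and> x $ \<sigma> i < u $ i" using R[rule_format, of "\<sigma> i"] by (simp add: i1)
      qed
    qed
    then show "x \<in> ?r -` box l u \<longleftrightarrow> x \<in> box (?q l) (?q u)" by (simp add: mem_box_cart)
  qed
  then have "emeasure (distr lborel borel ?r) (box l u) = emeasure lborel (box (?q l) (?q u))"
    using meas by (subst emeasure_distr) auto
  also have "\<dots> = ennreal (\<Prod>b\<in>Basis. (?q u - ?q l) \<bullet> b)"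
  proof (rule emeasure_lborel_box)
    fix b :: "real^'n" assume "b \<in> Basis"
    then obtain i where b: "b = axis i 1" by (auto simp: Basis_vec_real)
    show "?q l \<bullet> b \<le> ?q u \<bullet> b"
      using lu[of "axis (inv \<sigma> i) 1"] unfolding b
      by (simp add: Basis_vec_real cart_eq_inner_axis[symmetric])
  qed
  also have "(\<Prod>b\<in>Basis. (?q u - ?q l) \<bullet> b) = (\<Prod>i\<in>UNIV. (u - l) $ inv \<sigma> i)"
    unfolding prod_Basis_vec by simp
  also have "\<dots> = (\<Prod>i\<in>UNIV. (u - l) $ i)"
    using prod.reindex_bij_betw[of "inv \<sigma>" UNIV UNIV "\<lambda>i. (u - l) $ i"] assms
    by (simp add: bij_imp_bij_inv)
  finally show "emeasure (distr lborel borel ?r) (box l u) = ennreal (\<Prod>b\<in>Basis. (u - l) \<bullet> b)"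
    unfolding prod_Basis_vec .
qed simp

text \<open>
  Dictionary between the nonnegative integral and the gauge integral,
  in which the change of variables theorem is phrased.
\<close>

lemma set_nn_integral_eq_iff_absolutely_integrable:
  fixes f :: "'a::euclidean_space \<Rightarrow> real"
  assumes m: "(\<lambda>x. indicator S x * f x) \<in> borel_measurable borel" and nn: "\<And>x. x \<in> S \<Longrightarrow> 0 \<le> f x"
    and b: "0 \<le> b"
  shows "(\<integral>\<^sup>+x. ennreal (indicator S x * f x) \<partial>lborel) = ennreal b \<longleftrightarrow>
     f absolutely_integrable_on S \<and> integral S f = b"
proof -
  have m': "(\<lambda>x. indicator S x * f x) \<in> borel_measurable lebesgue"
    using m by (simp add: measurable_completion)
  have eq: "(\<integral>\<^sup>+x. ennreal (indicator S x * f x) \<partial>lborel) = (\<integral>\<^sup>+x. ennreal (indicator S x * f x) \<partial>lebesgue)"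
    by (simp add: nn_integral_completion)
  have nn': "0 \<le> indicator S x * f x" for x using nn by (auto simp: indicator_def)
  show ?thesis
  proof
    assume a: "(\<integral>\<^sup>+x. ennreal (indicator S x * f x) \<partial>lborel) = ennreal b"
    have int: "integrable lebesgue (\<lambda>x. indicator S x * f x)"
      by (rule integrableI_nonneg[OF m']) (use nn' a eq in auto)
    then have si: "f absolutely_integrable_on S"
      unfolding set_integrable_def by simp
    have "ennreal (integral\<^sup>L lebesgue (\<lambda>x. indicator S x * f x)) = ennreal b"
      using nn_integral_eq_integral[OF int] nn' a eq by simp
    moreover have "0 \<le> integral\<^sup>L lebesgue (\<lambda>x. indicator S x * f x)"
      using nn' by (intro integral_nonneg_AE) auto
    ultimately have "integral\<^sup>L lebesgue (\<lambda>x. indicator S x * f x) = b" using b by simp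
    then show "f absolutely_integrable_on S \<and> integral S f = b"
      using si set_lebesgue_integral_eq_integral(2)[OF si] unfolding set_lebesgue_integral_def by simp
  next
    assume a: "f absolutely_integrable_on S \<and> integral S f = b"
    then have int: "integrable lebesgue (\<lambda>x. indicator S x * f x)"
      unfolding set_integrable_def by simp
    have "integral\<^sup>L lebesgue (\<lambda>x. indicator S x * f x) = b"
      using a set_lebesgue_integral_eq_integral(2)[of S f] unfolding set_lebesgue_integral_def by simp
    then show "(\<integral>\<^sup>+x. ennreal (indicator S x * f x) \<partial>lborel) = ennreal b"
      using nn_integral_eq_integral[OF int] nn' eq by simp
  qed
qed

text \<open>
  The theorem on absolute integrability determines every finite value of either
  side; hence also the value \<open>\<infinity>\<close>.
\<close>

lemma nn_integral_change_of_variables_wellorder: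
  fixes g :: "real^'m::{finite,wellorder} \<Rightarrow> real^'m::_" and f :: "real^'m::_ \<Rightarrow> real"
  assumes S: "S \<in> sets borel"
    and der: "\<And>x. x \<in> S \<Longrightarrow> (g has_derivative g' x) (at x within S)"
    and inj: "inj_on g S"
    and m1: "(\<lambda>x. indicator S x * (\<bar>det (matrix (g' x))\<bar> * f (g x))) \<in> borel_measurable borel"
    and m2: "(\<lambda>y. indicator (g ` S) y * f y) \<in> borel_measurable borel"
    and nn: "\<And>y. y \<in> g ` S \<Longrightarrow> 0 \<le> f y"
  shows "(\<integral>\<^sup>+x. ennreal (indicator S x * (\<bar>det (matrix (g' x))\<bar> * f (g x))) \<partial>lborel)
       = (\<integral>\<^sup>+y. ennreal (indicator (g ` S) y * f y) \<partial>lborel)" (is "?L = ?R")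
proof -
  have S': "S \<in> sets lebesgue" using S by simp
  let ?f = "\<lambda>y. vec (f y) :: real^1"
  have key: "(\<lambda>x. \<bar>det (matrix (g' x))\<bar> * f (g x)) absolutely_integrable_on S \<and>
           integral S (\<lambda>x. \<bar>det (matrix (g' x))\<bar> * f (g x)) = b
     \<longleftrightarrow> f absolutely_integrable_on (g ` S) \<and> integral (g ` S) f = b" for b
    using has_absolute_integral_change_of_variables[OF S' der inj, of ?f "vec b"]
    unfolding absolutely_integrable_on_1_iff integral_on_1_eq by simp
  have iff: "?L = ennreal b \<longleftrightarrow> ?R = ennreal b" if "0 \<le> b" for b
    using set_nn_integral_eq_iff_absolutely_integrable[OF m1 _ that]
      set_nn_integral_eq_iff_absolutely_integrable[OF m2 nn that] nn key[of b] by simp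
  show ?thesis
  proof (cases ?L rule: ennreal_cases)
    case (real b)
    then show ?thesis using iff[of b] by simp
  next
    case top
    then show ?thesis using iff by (cases ?R rule: ennreal_cases) auto
  qed
qed

lemma nn_integral_change_of_variables:
  fixes g :: "real^'d::finite \<Rightarrow> real^'d" and f :: "real^'d \<Rightarrow> real"
  assumes S: "S \<in> sets borel"
    and der: "\<And>x. x \<in> S \<Longrightarrow> (g has_derivative g' x) (at x within S)"
    and inj: "inj_on g S"
    and m1: "(\<lambda>x. indicator S x * (\<bar>det (matrix (g' x))\<bar> * f (g x))) \<in> borel_measurable borel"
    and m2: "(\<lambda>y. indicator (g ` S) y * f y) \<in> borel_measurable borel"
    and nn: "\<And>y. y \<in> g ` S \<Longrightarrow> 0 \<le> f y"
  shows "(\<integral>\<^sup>+x. ennreal (indicator S x * (\<bar>det (matrix (g' x))\<bar> * f (g x))) \<partial>lborel)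
       = (\<integral>\<^sup>+y. ennreal (indicator (g ` S) y * f y) \<partial>lborel)"
proof -
  obtain \<sigma> :: "'d widx \<Rightarrow> 'd" where \<sigma>: "bij \<sigma>" using bij_widx_exists by blast
  define r :: "real^'d \<Rightarrow> real^'d widx" where "r = (\<lambda>x. \<chi> i. x $ \<sigma> i)"
  define q :: "real^'d widx \<Rightarrow> real^'d" where "q = (\<lambda>x. \<chi> i. x $ inv \<sigma> i)"
  have i1: "inv \<sigma> (\<sigma> i) = i" for i using \<sigma> by (simp add: bij_is_inj)
  have i2: "\<sigma> (inv \<sigma> i) = i" for i using \<sigma> by (simp add: bij_is_surj surj_f_inv_f)
  have rq [simp]: "r (q x) = x" for x by (simp add: r_def q_def vec_eq_iff i1)
  have qr [simp]: "q (r x) = x" for x by (simp add: r_def q_def vec_eq_iff i2)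
  have linr: "bounded_linear r" unfolding r_def
    by (simp add: linear_conv_bounded_linear[symmetric] linear_iff vec_eq_iff)
  have linq: "bounded_linear q" unfolding q_def
    by (simp add: linear_conv_bounded_linear[symmetric] linear_iff vec_eq_iff)
  have mq: "q \<in> borel_measurable borel"
    by (intro borel_measurable_continuous_onI linear_continuous_on linq)
  have mr: "r \<in> borel_measurable borel"
    by (intro borel_measurable_continuous_onI linear_continuous_on linr)
  have transfer: "(\<integral>\<^sup>+x. h (q x) \<partial>lborel) = (\<integral>\<^sup>+x. h x \<partial>lborel)"
    if "h \<in> borel_measurable borel" for h :: "real^'d \<Rightarrow> ennreal"
  proof -
    have "(\<integral>\<^sup>+x. h x \<partial>lborel) = (\<integral>\<^sup>+x. h (q (r x)) \<partial>lborel)" by simp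
    also have "\<dots> = (\<integral>\<^sup>+x. h (q x) \<partial>distr lborel borel r)"
      using mr mq that by (subst nn_integral_distr) simp_all
    also have "distr lborel borel r = lborel" unfolding r_def by (rule distr_lborel_reindex[OF \<sigma>])
    finally show ?thesis by simp
  qed
  let ?g = "\<lambda>x. r (g (q x))" and ?g' = "\<lambda>x h. r (g' (q x) (q h))" and ?S = "q -` S"
  have detr: "det (matrix (\<lambda>h. r (A (q h)))) = det (matrix A)" if "linear A" for A :: "real^'d \<Rightarrow> real^'d"
  proof -
    have "inv \<sigma> i = j \<longleftrightarrow> i = \<sigma> j" for i j using i1 i2 by auto
    then have "q (axis j 1) = axis (\<sigma> j) 1" for j
      unfolding q_def axis_def by (simp add: vec_eq_iff)
    then have "matrix (\<lambda>h. r (A (q h))) = (\<chi> i j. matrix A $ \<sigma> i $ \<sigma> j)"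
      by (simp add: matrix_def r_def)
    then show ?thesis using det_reindex[OF \<sigma>, of "matrix A"] by simp
  qed
  have gim: "?g ` ?S = q -` (g ` S)"
  proof (intro set_eqI iffI)
    fix y assume "y \<in> q -` (g ` S)"
    then obtain x where x: "x \<in> S" "q y = g x" by auto
    then have "y = ?g (r x)" by (metis qr rq)
    moreover have "r x \<in> ?S" using x by simp
    ultimately show "y \<in> ?g ` ?S" by (rule image_eqI)
  qed auto
  have det': "det (matrix (?g' x)) = det (matrix (g' (q x)))" if "x \<in> ?S" for x
    using der[of "q x"] that has_derivative_linear by (intro detr) auto
  have "(\<integral>\<^sup>+x. ennreal (indicator ?S x * (\<bar>det (matrix (?g' x))\<bar> * f (q (?g x)))) \<partial>lborel)
       = (\<integral>\<^sup>+y. ennreal (indicator (?g ` ?S) y * f (q y)) \<partial>lborel)"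
  proof (rule nn_integral_change_of_variables_wellorder)
    show "?S \<in> sets borel" using mq S by (simp add: measurable_sets_borel)
    show "(?g has_derivative ?g' x) (at x within ?S)" if "x \<in> ?S" for x
    proof -
      have "(q has_derivative q) (at x within ?S)" using linq by (rule bounded_linear_imp_has_derivative)
      moreover have "(g has_derivative g' (q x)) (at (q x) within q ` ?S)"
        by (rule has_derivative_subset[OF der]) (use that in auto)
      ultimately have "((\<lambda>x. g (q x)) has_derivative (\<lambda>h. g' (q x) (q h))) (at x within ?S)"
        by (rule has_derivative_in_compose)
      then show ?thesis by (rule bounded_linear.has_derivative[OF linr])
    qed
    show "inj_on ?g ?S"
    proof (rule inj_onI)
      fix x y assume xy: "x \<in> ?S" "y \<in> ?S" "?g x = ?g y"
      then have "g (q x) = g (q y)" using qr by metis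
      then have "q x = q y" using inj xy by (auto dest: inj_onD)
      then show "x = y" using rq by metis
    qed
    have "(\<lambda>x. indicator ?S x * (\<bar>det (matrix (?g' x))\<bar> * f (q (?g x))))
      = (\<lambda>x. (\<lambda>x. indicator S x * (\<bar>det (matrix (g' x))\<bar> * f (g x))) (q x))"
      using det' by (auto simp: indicator_def)
    also have "\<dots> \<in> borel_measurable borel" by (rule measurable_compose[OF mq m1])
    finally show "(\<lambda>x. indicator ?S x * (\<bar>det (matrix (?g' x))\<bar> * f (q (?g x)))) \<in> borel_measurable borel" .
    have "(\<lambda>y. indicator (?g ` ?S) y * f (q y)) = (\<lambda>y. (\<lambda>y. indicator (g ` S) y * f y) (q y))"
      unfolding gim by (auto simp: indicator_def)
    also have "\<dots> \<in> borel_measurable borel" by (rule measurable_compose[OF mq m2])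
    finally show "(\<lambda>y. indicator (?g ` ?S) y * f (q y)) \<in> borel_measurable borel" .
    show "0 \<le> f (q y)" if "y \<in> ?g ` ?S" for y using nn that by auto
  qed
  moreover have "(\<integral>\<^sup>+x. ennreal (indicator ?S x * (\<bar>det (matrix (?g' x))\<bar> * f (q (?g x)))) \<partial>lborel)
    = (\<integral>\<^sup>+x. ennreal (indicator S x * (\<bar>det (matrix (g' x))\<bar> * f (g x))) \<partial>lborel)"
  proof -
    have "(\<integral>\<^sup>+x. ennreal (indicator ?S x * (\<bar>det (matrix (?g' x))\<bar> * f (q (?g x)))) \<partial>lborel)
      = (\<integral>\<^sup>+x. (\<lambda>x. ennreal (indicator S x * (\<bar>det (matrix (g' x))\<bar> * f (g x)))) (q x) \<partial>lborel)"
      by (rule nn_integral_cong) (use det' in \<open>auto simp: indicator_def\<close>)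
    also have "\<dots> = (\<integral>\<^sup>+x. ennreal (indicator S x * (\<bar>det (matrix (g' x))\<bar> * f (g x))) \<partial>lborel)"
      by (rule transfer) (use m1 in simp)
    finally show ?thesis .
  qed
  moreover have "(\<integral>\<^sup>+y. ennreal (indicator (?g ` ?S) y * f (q y)) \<partial>lborel)
     = (\<integral>\<^sup>+y. ennreal (indicator (g ` S) y * f y) \<partial>lborel)"
  proof -
    have "(\<integral>\<^sup>+y. ennreal (indicator (?g ` ?S) y * f (q y)) \<partial>lborel)
       = (\<integral>\<^sup>+y. (\<lambda>y. ennreal (indicator (g ` S) y * f y)) (q y) \<partial>lborel)"
      unfolding gim by (rule nn_integral_cong) (auto simp: indicator_def)
    also have "\<dots> = (\<integral>\<^sup>+y. ennreal (indicator (g ` S) y * f y) \<partial>lborel)"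
      by (rule transfer) (use m2 in simp)
    finally show ?thesis .
  qed
  ultimately show ?thesis by simp
qed

section \<open>Charts, Gram determinants and transition maps\<close>

text \<open>
  In an infinite-dimensional codomain a linear left inverse need not be bounded. The
  inverse of the Gram map \<open>A\<^sup>* A\<close> composed with the adjoint \<open>A\<^sup>*\<close> is a bounded one.
\<close>

lemma bounded_left_inverse:
  fixes A :: "'a::euclidean_space \<Rightarrow> 'b::real_inner"
  assumes "linear A" "inj A"
  obtains L where "bounded_linear L" "\<And>h. L (A h) = h"
proof -
  define At where "At = (\<lambda>y. \<Sum>b\<in>Basis. (A b \<bullet> y) *\<^sub>R b)"
  have bl: "bounded_linear At" unfolding At_def
    by (intro bounded_linear_sum bounded_linear_scaleR_left[THEN bounded_linear_compose] bounded_linear_inner_right)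
  have ip: "h \<bullet> At y = A h \<bullet> y" for h y
  proof -
    have "h \<bullet> At y = (\<Sum>b\<in>Basis. (A b \<bullet> y) * (h \<bullet> b))" by (simp add: At_def inner_sum_right)
    also have "\<dots> = (\<Sum>b\<in>Basis. (h \<bullet> b) *\<^sub>R A b) \<bullet> y"
      by (simp add: inner_sum_left mult.commute)
    also have "(\<Sum>b\<in>Basis. (h \<bullet> b) *\<^sub>R A b) = A (\<Sum>b\<in>Basis. (h \<bullet> b) *\<^sub>R b)"
      by (simp add: linear_sum[OF assms(1)] linear_cmul[OF assms(1)])
    finally show ?thesis by (simp add: euclidean_representation)
  qed
  have lin: "linear (\<lambda>h. At (A h))"
    using linear_compose[OF assms(1) bounded_linear.linear[OF bl]] by (simp add: o_def)
  moreover have "inj (\<lambda>h. At (A h))"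
  proof (subst linear_injective_0[OF lin], intro allI impI)
    fix h assume "At (A h) = 0"
    then have "A h = 0" using ip[of h "A h"] by simp
    then show "h = 0" using assms linear_injective_0 by blast
  qed
  ultimately obtain g where g: "linear g" "g \<circ> (\<lambda>h. At (A h)) = id"
    using linear_injective_left_inverse by blast
  show ?thesis
  proof
    show "bounded_linear (\<lambda>y. g (At y))"
      by (rule bounded_linear_compose[OF _ bl]) (rule linear_conv_bounded_linear[THEN iffD1, OF g(1)])
    show "g (At (A h)) = h" for h using fun_cong[OF g(2), of h] by simp
  qed
qed

text \<open>
  A continuous lift \<open>\<tau>\<close> of a differentiable map \<open>\<phi>\<close> through an immersion \<open>\<psi>\<close> is
  differentiable, without any inverse function theorem: near \<open>\<tau> u\<close> the immersion expands distances
  at least linearly, so \<open>\<tau>\<close> is Lipschitz at \<open>u\<close>; then the remainder of \<open>\<psi>\<close> is negligible with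
  respect to the displacement of \<open>u\<close>, and a bounded left inverse of \<open>A\<close> recovers the derivative.
  This covers both transition maps between charts and implicit functions.
\<close>

lemma has_derivative_lift_through_immersion:
  fixes \<phi> :: "'a::euclidean_space \<Rightarrow> 'b::real_inner" and \<psi> :: "'c::euclidean_space \<Rightarrow> 'b"
  assumes \<phi>: "(\<phi> has_derivative D) (at u)" and \<psi>: "(\<psi> has_derivative A) (at (\<tau> u))"
    and inj: "inj A" and cont: "isCont \<tau> u"
    and S: "open S" "u \<in> S" and eq: "\<And>x. x \<in> S \<Longrightarrow> \<psi> (\<tau> x) = \<phi> x"
  obtains T where "(\<tau> has_derivative T) (at u)" "\<And>h. D h = A (T h)"
proof -
  have linA: "linear A" using \<psi> has_derivative_linear by blast
  obtain L where L: "bounded_linear L" "\<And>h. L (A h) = h"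
    using bounded_left_inverse[OF linA inj] by blast
  obtain K where K: "K > 0" "\<And>y. norm (L y) \<le> norm y * K"
    using bounded_linear.pos_bounded[OF L(1)] by blast
  have bD: "bounded_linear D" using \<phi> has_derivative_bounded_linear by blast
  obtain M where M: "M > 0" "\<And>h. norm (D h) \<le> norm h * M"
    using bounded_linear.pos_bounded[OF bD] by blast
  have A0: "\<exists>d>0. \<forall>w. norm (w - \<tau> u) < d \<longrightarrow> norm (\<psi> w - \<psi> (\<tau> u) - A (w - \<tau> u)) \<le> e * norm (w - \<tau> u)"
    if "e > 0" for e using \<psi> that unfolding has_derivative_at_alt by blast
  have D0: "\<exists>d>0. \<forall>x. norm (x - u) < d \<longrightarrow> norm (\<phi> x - \<phi> u - D (x - u)) \<le> e * norm (x - u)"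
    if "e > 0" for e using \<phi> that unfolding has_derivative_at_alt by blast
  obtain r where r: "r > 0" "ball u r \<subseteq> S" using S open_contains_ball by blast
  have near: "\<exists>d>0. d \<le> r \<and> (\<forall>x. norm (x - u) < d \<longrightarrow>
      norm (\<psi> (\<tau> x) - \<psi> (\<tau> u) - A (\<tau> x - \<tau> u)) \<le> e * norm (\<tau> x - \<tau> u))" if e: "e > 0" for e
  proof -
    obtain d where d: "d > 0" "\<And>w. norm (w - \<tau> u) < d \<Longrightarrow> norm (\<psi> w - \<psi> (\<tau> u) - A (w - \<tau> u)) \<le> e * norm (w - \<tau> u)"
      using A0[OF e] by blast
    obtain d' where "d' > 0" "\<And>x. norm (x - u) < d' \<Longrightarrow> norm (\<tau> x - \<tau> u) < d"
      using cont d(1) unfolding continuous_at_eps_delta dist_norm by meson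
    then show ?thesis using d r by (intro exI[of _ "min r d'"]) auto
  qed
  have id: "\<tau> x - \<tau> u = L (\<phi> x - \<phi> u) - L (\<psi> (\<tau> x) - \<psi> (\<tau> u) - A (\<tau> x - \<tau> u))" if "norm (x - u) < r" for x
  proof -
    have "x \<in> S" using that r by (auto simp: dist_norm norm_minus_commute)
    then have "\<phi> x - \<phi> u = \<psi> (\<tau> x) - \<psi> (\<tau> u)" using eq S by simp
    then show ?thesis by (simp add: linear_diff[OF bounded_linear.linear[OF L(1)]] L(2))
  qed
  \<comment> \<open>First step: \<open>\<tau>\<close> is Lipschitz at \<open>u\<close>; half of the displacement absorbs the remainder of \<open>\<psi>\<close>.\<close>
  have "\<exists>d>0. d \<le> r \<and> (\<forall>x. norm (x - u) < d \<longrightarrow> norm (\<tau> x - \<tau> u) \<le> 2 * K * (M + 1) * norm (x - u))"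
  proof -
    obtain d1 where d1: "d1 > 0" "d1 \<le> r" "\<And>x. norm (x - u) < d1 \<Longrightarrow>
       norm (\<psi> (\<tau> x) - \<psi> (\<tau> u) - A (\<tau> x - \<tau> u)) \<le> 1 / (2 * K) * norm (\<tau> x - \<tau> u)"
      using near[of "1 / (2 * K)"] K(1) by auto
    obtain d2 where d2: "d2 > 0" "\<And>x. norm (x - u) < d2 \<Longrightarrow> norm (\<phi> x - \<phi> u - D (x - u)) \<le> 1 * norm (x - u)"
      using D0[of 1] by auto
    show ?thesis
    proof (intro exI[of _ "min d1 d2"] conjI allI impI)
      fix x assume x: "norm (x - u) < min d1 d2"
      have "norm (\<tau> x - \<tau> u) \<le> norm (L (\<phi> x - \<phi> u)) + norm (L (\<psi> (\<tau> x) - \<psi> (\<tau> u) - A (\<tau> x - \<tau> u)))"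
        by (subst id) (use x d1(2) in \<open>auto intro: norm_triangle_ineq4\<close>)
      also have "\<dots> \<le> norm (\<phi> x - \<phi> u) * K + (1 / (2 * K) * norm (\<tau> x - \<tau> u)) * K"
        using K d1(3)[of x] x by (intro add_mono order_trans[OF K(2)] mult_right_mono) auto
      also have "\<dots> = norm (\<phi> x - \<phi> u) * K + norm (\<tau> x - \<tau> u) / 2" using K(1) by simp
      finally have 1: "norm (\<tau> x - \<tau> u) \<le> 2 * K * norm (\<phi> x - \<phi> u)" by (simp add: mult_ac)
      have "norm (\<phi> x - \<phi> u) \<le> norm (\<phi> x - \<phi> u - D (x - u)) + norm (D (x - u))"
        by (metis diff_add_cancel norm_triangle_ineq)
      also have "\<dots> \<le> 1 * norm (x - u) + norm (x - u) * M"
        using d2(2)[of x] x M(2)[of "x - u"] by (intro add_mono) auto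
      finally have "norm (\<phi> x - \<phi> u) \<le> (M + 1) * norm (x - u)" by (simp add: algebra_simps)
      from mult_left_mono[OF this, of "2 * K"] K(1) order_trans[OF 1]
      show "norm (\<tau> x - \<tau> u) \<le> 2 * K * (M + 1) * norm (x - u)" by (simp add: mult.assoc)
    qed (use d1 d2 in auto)
  qed
  then obtain d0 where d0: "d0 > 0" "d0 \<le> r"
    "\<And>x. norm (x - u) < d0 \<Longrightarrow> norm (\<tau> x - \<tau> u) \<le> 2 * K * (M + 1) * norm (x - u)" by blast
  \<comment> \<open>Second step: with this bound both remainders are small compared with \<open>x - u\<close>.\<close>
  define C where "C = 2 * K * (M + 1)"
  have C: "C > 0" using K M by (simp add: C_def)
  have der: "(\<tau> has_derivative (\<lambda>h. L (D h))) (at u)"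
    unfolding has_derivative_at_alt
  proof (intro conjI allI impI)
    show "bounded_linear (\<lambda>h. L (D h))" by (rule bounded_linear_compose[OF L(1) bD])
    fix e :: real assume e: "e > 0"
    obtain d1 where d1: "d1 > 0" "d1 \<le> r" "\<And>x. norm (x - u) < d1 \<Longrightarrow>
       norm (\<psi> (\<tau> x) - \<psi> (\<tau> u) - A (\<tau> x - \<tau> u)) \<le> e / (2 * K * C) * norm (\<tau> x - \<tau> u)"
      using near[of "e / (2 * K * C)"] K(1) C e by auto
    obtain d2 where d2: "d2 > 0" "\<And>x. norm (x - u) < d2 \<Longrightarrow> norm (\<phi> x - \<phi> u - D (x - u)) \<le> e / (2 * K) * norm (x - u)"
      using D0[of "e / (2 * K)"] e K(1) by auto
    show "\<exists>d>0. \<forall>x. norm (x - u) < d \<longrightarrow> norm (\<tau> x - \<tau> u - L (D (x - u))) \<le> e * norm (x - u)"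
    proof (intro exI[of _ "min d0 (min d1 d2)"] conjI allI impI)
      fix x assume x: "norm (x - u) < min d0 (min d1 d2)"
      have "\<tau> x - \<tau> u - L (D (x - u)) = L (\<phi> x - \<phi> u - D (x - u)) - L (\<psi> (\<tau> x) - \<psi> (\<tau> u) - A (\<tau> x - \<tau> u))"
      proof -
        have "\<tau> x - \<tau> u - L (D (x - u)) = L (\<phi> x - \<phi> u) - L (\<psi> (\<tau> x) - \<psi> (\<tau> u) - A (\<tau> x - \<tau> u)) - L (D (x - u))"
          by (rule arg_cong[OF id, of _ "\<lambda>z. z - L (D (x - u))"]) (use x d0 in auto)
        also have "\<dots> = L (\<phi> x - \<phi> u - D (x - u)) - L (\<psi> (\<tau> x) - \<psi> (\<tau> u) - A (\<tau> x - \<tau> u))"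
          unfolding linear_diff[OF bounded_linear.linear[OF L(1)], of "\<phi> x - \<phi> u" "D (x - u)"] by simp
        finally show ?thesis .
      qed
      then have "norm (\<tau> x - \<tau> u - L (D (x - u))) \<le> norm (L (\<phi> x - \<phi> u - D (x - u))) + norm (L (\<psi> (\<tau> x) - \<psi> (\<tau> u) - A (\<tau> x - \<tau> u)))"
        by (simp only: norm_triangle_ineq4)
      also have "\<dots> \<le> (e / (2 * K) * norm (x - u)) * K + (e / (2 * K * C) * (C * norm (x - u))) * K"
      proof (intro add_mono order_trans[OF K(2)] mult_right_mono)
        show "norm (\<phi> x - \<phi> u - D (x - u)) \<le> e / (2 * K) * norm (x - u)" using d2(2)[of x] x by auto
        have "norm (\<psi> (\<tau> x) - \<psi> (\<tau> u) - A (\<tau> x - \<tau> u)) \<le> e / (2 * K * C) * norm (\<tau> x - \<tau> u)"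
          using d1(3)[of x] x by auto
        also have "\<dots> \<le> e / (2 * K * C) * (C * norm (x - u))"
          using d0(3)[of x] x e K(1) C unfolding C_def[symmetric] by (intro mult_left_mono) auto
        finally show "norm (\<psi> (\<tau> x) - \<psi> (\<tau> u) - A (\<tau> x - \<tau> u)) \<le> e / (2 * K * C) * (C * norm (x - u))" .
      qed (use K in auto)
      also have "\<dots> = e * norm (x - u)" using K(1) C by (simp add: field_simps)
      finally show "norm (\<tau> x - \<tau> u - L (D (x - u))) \<le> e * norm (x - u)" .
    qed (use d0 d1 d2 in auto)
  qed
  have "((\<lambda>x. \<psi> (\<tau> x)) has_derivative (\<lambda>h. A (L (D h)))) (at u)"
    by (rule has_derivative_compose[OF der \<psi>])
  then have "(\<phi> has_derivative (\<lambda>h. A (L (D h)))) (at u)"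
    by (rule has_derivative_transform_within_open[OF _ S]) (use eq in auto)
  from has_derivative_unique[OF \<phi> this] have "D h = A (L (D h))" for h by (rule fun_cong)
  then show ?thesis by (rule that[OF der])
qed

definition gram :: "(real^'d::finite \<Rightarrow> 'a::real_inner) \<Rightarrow> real^'d^'d" where
  "gram A = (\<chi> i j. A (axis i 1) \<bullet> A (axis j 1))"

lemma jacobian_gram: "jacobian \<phi> u = sqrt (det (gram (frechet_derivative \<phi> (at u))))"
  by (simp add: jacobian_def gram_def)

lemma gram_compose:
  fixes A :: "real^'d::finite \<Rightarrow> 'a::real_inner" and T :: "real^'d \<Rightarrow> real^'d"
  assumes A: "linear A"
  shows "gram (\<lambda>h. A (T h)) = transpose (matrix T) ** gram A ** matrix T"
proof -
  have rep: "A (T (axis i 1)) = (\<Sum>k\<in>UNIV. matrix T $ k $ i *\<^sub>R A (axis k 1))" for i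
  proof -
    have "T (axis i 1) = (\<Sum>k\<in>UNIV. T (axis i 1) $ k *s axis k 1)" by (simp add: basis_expansion)
    then have "A (T (axis i 1)) = A (\<Sum>k\<in>UNIV. T (axis i 1) $ k *\<^sub>R axis k 1)"
      by (simp add: scalar_mult_eq_scaleR)
    then show ?thesis by (simp add: linear_sum[OF A] linear_cmul[OF A] matrix_def)
  qed
  show ?thesis
    unfolding gram_def rep
    by (simp add: vec_eq_iff matrix_matrix_mult_def transpose_def inner_sum_left inner_sum_right
        sum_distrib_right sum_distrib_left mult.assoc mult.commute mult.left_commute)
qed

lemma gram_quadratic:
  fixes A :: "real^'d::finite \<Rightarrow> 'a::real_inner"
  assumes A: "linear A"
  shows "x \<bullet> (gram A *v x) = (norm (A x))\<^sup>2"
proof -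
  have "A x = A (\<Sum>i\<in>UNIV. x $ i *\<^sub>R axis i 1)"
    using basis_expansion[of x] by (simp add: scalar_mult_eq_scaleR)
  then have rep: "A x = (\<Sum>i\<in>UNIV. x $ i *\<^sub>R A (axis i 1))"
    by (simp add: linear_sum[OF A] linear_cmul[OF A])
  show ?thesis
    unfolding power2_norm_eq_inner rep
    by (simp add: inner_vec_def matrix_vector_mult_def gram_def inner_sum_left inner_sum_right
       sum_distrib_left mult_ac inner_commute)
qed

text \<open>
  On the segment from the identity to the Gram matrix all matrices are positive definite,
  hence invertible; the determinant is continuous there and starts at \<open>1\<close>, so it stays positive.
\<close>

lemma det_gram_pos:
  fixes A :: "real^'d::finite \<Rightarrow> 'a::real_inner"
  assumes A: "linear A" "inj A"
  shows "0 < det (gram A)"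
proof (rule ccontr)
  assume neg: "\<not> 0 < det (gram A)"
  define G where "G = (\<lambda>t::real. (1 - t) *\<^sub>R (mat 1 :: real^'d^'d) + t *\<^sub>R gram A)"
  have cont: "continuous_on {0..1} (\<lambda>t. det (G t))"
    unfolding det_def G_def by (intro continuous_intros)
  have "G 0 = mat 1" "G 1 = gram A" by (simp_all add: G_def)
  then have "\<exists>t\<ge>0. t \<le> 1 \<and> det (G t) = 0"
    using IVT2'[of "\<lambda>t. det (G t)" 1 0 0] cont neg by simp
  then obtain t where t: "0 \<le> t" "t \<le> 1" "det (G t) = 0" by blast
  then obtain x where x: "x \<noteq> 0" "G t *v x = 0"
    using invertible_det_nz[of "G t"] matrix_left_invertible_ker[of "G t"] invertible_left_inverse[of "G t"]
    by (auto simp: invertible_left_inverse)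
  have "x \<bullet> (G t *v x) = (1 - t) * (norm x)\<^sup>2 + t * (norm (A x))\<^sup>2"
    unfolding G_def
    by (simp add: matrix_vector_mult_add_rdistrib scaleR_matrix_vector_assoc[symmetric] inner_add_right
       gram_quadratic[OF A(1)] power2_norm_eq_inner)
  also have "\<dots> > 0"
  proof -
    have "norm x > 0" "norm (A x) > 0" using x(1) A linear_injective_0 by auto
    then show ?thesis using t by (cases "t = 0") (auto intro!: add_nonneg_pos)
  qed
  finally show False using x by simp
qed

lemma local_param_derivative:
  assumes "local_param k M U \<phi>" "1 \<le> k" "u \<in> U"
  shows "(\<phi> has_derivative frechet_derivative \<phi> (at u)) (at u)"
    and "linear (frechet_derivative \<phi> (at u))" and "inj (frechet_derivative \<phi> (at u))"
proof -
  have "\<forall>hs. length hs < k \<longrightarrow> (\<forall>x\<in>U. iter_deriv hs \<phi> differentiable (at x))"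
    using assms unfolding local_param_def Ck_on_def by blast
  from this[rule_format, of "[]", OF _ assms(3)] assms(2) have "\<phi> differentiable (at u)" by simp
  then show *: "(\<phi> has_derivative frechet_derivative \<phi> (at u)) (at u)"
    by (simp add: frechet_derivative_works)
  then show "linear (frechet_derivative \<phi> (at u))" by (rule has_derivative_linear)
  show "inj (frechet_derivative \<phi> (at u))" using assms unfolding local_param_def by blast
qed

lemma local_param_continuous:
  assumes "local_param k M U \<phi>"
  shows "continuous_on U \<phi>"
proof -
  have "\<forall>hs. length hs \<le> k \<longrightarrow> continuous_on U (iter_deriv hs \<phi>)"
    using assms unfolding local_param_def Ck_on_def by blast
  from this[rule_format, of "[]"] show ?thesis by simp
qed

lemma local_param_mono: "local_param k M U \<phi> \<Longrightarrow> m \<le> k \<Longrightarrow> local_param m M U \<phi>"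
  unfolding local_param_def using Ck_on_mono by blast

lemma continuous_on_jacobian:
  fixes \<phi> :: "real^'d::finite \<Rightarrow> 'a::real_inner"
  assumes "Ck_on k U \<phi>" "1 \<le> k"
  shows "continuous_on U (jacobian \<phi>)"
proof -
  have "\<forall>hs. length hs \<le> k \<longrightarrow> continuous_on U (iter_deriv hs \<phi>)"
    using assms(1) unfolding Ck_on_def by blast
  from this[rule_format, of "[axis _ 1]"] assms(2)
  have "continuous_on U (iter_deriv [axis i 1] \<phi>)" for i :: 'd by simp
  then have "continuous_on U (\<lambda>u. frechet_derivative \<phi> (at u) (axis i 1))" for i :: 'd by simp
  then show ?thesis unfolding jacobian_def det_def by (auto intro!: continuous_intros)
qed

lemma jacobian_pos:
  assumes "local_param k M U \<phi>" "1 \<le> k" "u \<in> U"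
  shows "0 < jacobian \<phi> u"
  using det_gram_pos[OF local_param_derivative(2,3)[OF assms]] by (simp add: jacobian_gram)

lemma local_param_homeomorphism:
  assumes "local_param k M U \<phi>"
  obtains g where "continuous_on (\<phi> ` U) g" "\<And>u. u \<in> U \<Longrightarrow> g (\<phi> u) = u" "inj_on \<phi> U"
proof -
  obtain g where g: "homeomorphism U (\<phi> ` U) \<phi> g" using assms unfolding local_param_def by blast
  then show ?thesis
    using that[of g] unfolding homeomorphism_def by (auto intro: inj_on_inverseI)
qed

text \<open>
  Being a chart is a local property: a chart of \<open>M\<close> restricted to an open set \<open>O'\<close> is
  also a chart of any \<open>M'\<close> that coincides with \<open>M\<close> in \<open>O'\<close>.
\<close>

lemma local_param_restrict:
  fixes \<phi> :: "real^'d::finite \<Rightarrow> 'a::real_inner"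
  assumes lp: "local_param k M U \<phi>" and O: "open O'" and eq: "M \<inter> O' = M' \<inter> O'"
  shows "local_param k M' (U \<inter> \<phi> -` O') \<phi>" and "\<phi> ` (U \<inter> \<phi> -` O') = \<phi> ` U \<inter> O'"
proof -
  let ?V = "U \<inter> \<phi> -` O'"
  have U: "open U" "Ck_on k U \<phi>" "\<forall>u\<in>U. inj (frechet_derivative \<phi> (at u))"
    "openin (top_of_set M) (\<phi> ` U)"
    using lp unfolding local_param_def by auto
  have cont: "continuous_on U \<phi>" by (rule local_param_continuous[OF lp])
  obtain g where g: "homeomorphism U (\<phi> ` U) \<phi> g" using lp unfolding local_param_def by blast
  have V: "open ?V" using continuous_open_preimage[OF cont U(1) O] .
  show im: "\<phi> ` ?V = \<phi> ` U \<inter> O'" by auto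
  obtain W where W: "open W" "\<phi> ` U = M \<inter> W" using U(4) openin_open by blast
  have "\<phi> ` ?V = M' \<inter> (W \<inter> O')" unfolding im W(2) using eq by blast
  then have "openin (top_of_set M') (\<phi> ` ?V)"
    using openin_open_Int[OF open_Int[OF W(1) O], of M'] by simp
  moreover have "homeomorphism ?V (\<phi> ` ?V) \<phi> g"
    by (rule homeomorphism_of_subsets[OF g]) auto
  moreover have "Ck_on k ?V \<phi>" by (rule Ck_on_subset[OF U(2)]) simp
  ultimately show "local_param k M' ?V \<phi>"
    unfolding local_param_def using V U(3) by blast
qed

lemma local_param_measurable:
  fixes \<phi> :: "real^'d::finite \<Rightarrow> 'a::real_inner"
  assumes lp: "local_param k M U \<phi>" and B: "B \<in> sets borel"
  shows "U \<inter> \<phi> -` B \<in> sets borel"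
proof -
  have U: "open U" using lp unfolding local_param_def by blast
  have "\<phi> \<in> borel_measurable (restrict_space borel U)"
    using borel_measurable_continuous_on_restrict[OF local_param_continuous[OF lp]] .
  from measurable_sets[OF this B] have "\<phi> -` B \<inter> U \<in> sets (restrict_space borel U)"
    by (simp add: space_restrict_space)
  then show ?thesis using U by (simp add: sets_restrict_space_iff Int_commute)
qed

lemma jacobian_indicator_measurable:
  fixes \<phi> :: "real^'d::finite \<Rightarrow> 'a::real_inner"
  assumes lp: "local_param k M U \<phi>" "1 \<le> k" and S: "S \<in> sets borel" "S \<subseteq> U"
  shows "(\<lambda>u. indicator S u * jacobian \<phi> u) \<in> borel_measurable borel"
proof -
  have U: "open U" "Ck_on k U \<phi>" using lp unfolding local_param_def by auto
  have "(\<lambda>u. indicator U u *\<^sub>R jacobian \<phi> u) \<in> borel_measurable borel"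
    by (rule borel_measurable_continuous_on_indicator) (use U continuous_on_jacobian[OF U(2) lp(2)] in auto)
  then have "(\<lambda>u. indicator S u * (indicator U u * jacobian \<phi> u)) \<in> borel_measurable borel"
    using S(1) by simp
  also have "(\<lambda>u. indicator S u * (indicator U u * jacobian \<phi> u)) = (\<lambda>u. indicator S u * jacobian \<phi> u)"
    using S(2) by (intro ext) (auto simp: indicator_def)
  finally show ?thesis .
qed

text \<open>
  The transition map \<open>\<tau>\<close> satisfies \<open>\<psi> \<circ> \<tau> = \<phi>\<close>, so the Gram matrix of \<open>\<phi>\<close> is that of \<open>\<psi>\<close>
  conjugated by the matrix of \<open>\<tau>\<close>, and the volume densities differ by the factor
  \<open>\<bar>det\<bar>\<close> that the change of variables produces.
\<close>

theorem chart_volume_eq: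
  fixes \<phi> \<psi> :: "real^'d::finite \<Rightarrow> 'a::real_inner"
  assumes \<phi>: "local_param 1 M U \<phi>" and \<psi>: "local_param 1 M V \<psi>"
    and B: "B \<in> sets borel" "B \<subseteq> \<phi> ` U" "B \<subseteq> \<psi> ` V"
  shows "(\<integral>\<^sup>+u\<in>U \<inter> \<phi> -` B. ennreal (jacobian \<phi> u) \<partial>lborel) =
         (\<integral>\<^sup>+u\<in>V \<inter> \<psi> -` B. ennreal (jacobian \<psi> u) \<partial>lborel)"
proof -
  obtain g where g: "continuous_on (\<psi> ` V) g" "\<And>v. v \<in> V \<Longrightarrow> g (\<psi> v) = v"
    using local_param_homeomorphism[OF \<psi>] by blast
  have inj\<phi>: "inj_on \<phi> U" using local_param_homeomorphism[OF \<phi>] by blast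
  define \<tau> where "\<tau> = (\<lambda>u. g (\<phi> u))"
  obtain W where W: "open W" "\<psi> ` V = M \<inter> W"
    using \<psi> openin_open unfolding local_param_def by metis
  have \<phi>M: "\<phi> ` U \<subseteq> M" using \<phi> openin_imp_subset unfolding local_param_def by blast
  define U1 where "U1 = U \<inter> \<phi> -` W"
  have U1: "open U1"
    using \<phi> continuous_open_preimage[OF local_param_continuous[OF \<phi>] _ W(1)]
    unfolding U1_def local_param_def by blast
  have U1V: "\<phi> u \<in> \<psi> ` V" if "u \<in> U1" for u using that W(2) \<phi>M unfolding U1_def by blast
  have \<tau>: "\<psi> (\<tau> u) = \<phi> u" "\<tau> u \<in> V" if "u \<in> U1" for u
    using U1V[OF that] g(2) unfolding \<tau>_def by auto
  have cont: "continuous_on U1 \<tau>" unfolding \<tau>_def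
    by (rule continuous_on_compose2[OF g(1) continuous_on_subset[OF local_param_continuous[OF \<phi>]]])
      (use U1V in \<open>auto simp: U1_def\<close>)
  have ex: "\<exists>T. (\<tau> has_derivative T) (at u) \<and>
      (\<forall>h. frechet_derivative \<phi> (at u) h = frechet_derivative \<psi> (at (\<tau> u)) (T h))" if u: "u \<in> U1" for u
  proof -
    have "isCont \<tau> u" using cont U1 u continuous_on_eq_continuous_at by blast
    moreover have uU: "u \<in> U" using u by (simp add: U1_def)
    ultimately obtain T where "(\<tau> has_derivative T) (at u)"
        "\<And>h. frechet_derivative \<phi> (at u) h = frechet_derivative \<psi> (at (\<tau> u)) (T h)"
      using has_derivative_lift_through_immersion[OF local_param_derivative(1)[OF \<phi> order_refl uU]
          local_param_derivative(1)[OF \<psi> order_refl \<tau>(2)[OF u]]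
          local_param_derivative(3)[OF \<psi> order_refl \<tau>(2)[OF u]] _ U1 u \<tau>(1)] by blast
    then show ?thesis by blast
  qed
  then obtain T where T: "\<And>u. u \<in> U1 \<Longrightarrow> (\<tau> has_derivative T u) (at u)"
      "\<And>u h. u \<in> U1 \<Longrightarrow> frechet_derivative \<phi> (at u) h = frechet_derivative \<psi> (at (\<tau> u)) (T u h)"
    by metis
  have jac: "jacobian \<phi> u = \<bar>det (matrix (T u))\<bar> * jacobian \<psi> (\<tau> u)" if u: "u \<in> U1" for u
  proof -
    have "frechet_derivative \<phi> (at u) = (\<lambda>h. frechet_derivative \<psi> (at (\<tau> u)) (T u h))"
      using T(2)[OF u] by blast
    moreover have "linear (frechet_derivative \<psi> (at (\<tau> u)))"
      using local_param_derivative(2)[OF \<psi> _ \<tau>(2)[OF u]] by simp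
    ultimately have "det (gram (frechet_derivative \<phi> (at u))) =
        (det (matrix (T u)))\<^sup>2 * det (gram (frechet_derivative \<psi> (at (\<tau> u))))"
      by (simp add: gram_compose det_mul det_transpose power2_eq_square)
    then show ?thesis by (simp add: jacobian_gram real_sqrt_mult)
  qed
  define S where "S = U \<inter> \<phi> -` B"
  have SU1: "S \<subseteq> U1" using B(3) W(2) unfolding S_def U1_def by auto
  have Sb: "S \<in> sets borel" unfolding S_def by (rule local_param_measurable[OF \<phi> B(1)])
  have im: "\<tau> ` S = V \<inter> \<psi> -` B"
  proof (intro set_eqI iffI)
    fix v assume "v \<in> \<tau> ` S"
    then show "v \<in> V \<inter> \<psi> -` B" using \<tau> SU1 unfolding S_def by auto
  next
    fix v assume v: "v \<in> V \<inter> \<psi> -` B"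
    then obtain u where u: "u \<in> U" "\<phi> u = \<psi> v" using B(2) by force
    then have "\<tau> u = v" "u \<in> S" using v g(2) unfolding \<tau>_def S_def by auto
    then show "v \<in> \<tau> ` S" by blast
  qed
  have Vb: "V \<inter> \<psi> -` B \<in> sets borel" by (rule local_param_measurable[OF \<psi> B(1)])
  have "(\<integral>\<^sup>+u\<in>U \<inter> \<phi> -` B. ennreal (jacobian \<phi> u) \<partial>lborel) =
     (\<integral>\<^sup>+u. ennreal (indicator S u * (\<bar>det (matrix (T u))\<bar> * jacobian \<psi> (\<tau> u))) \<partial>lborel)"
    unfolding S_def[symmetric]
    by (rule nn_integral_cong) (use jac SU1 in \<open>auto simp: indicator_def\<close>)
  also have "\<dots> = (\<integral>\<^sup>+v. ennreal (indicator (\<tau> ` S) v * jacobian \<psi> v) \<partial>lborel)"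
  proof (rule nn_integral_change_of_variables)
    show "S \<in> sets borel" by (rule Sb)
    show "(\<tau> has_derivative T u) (at u within S)" if "u \<in> S" for u
      using T(1) SU1 that has_derivative_at_withinI by blast
    show "inj_on \<tau> S"
    proof (rule inj_onI)
      fix x y assume xy: "x \<in> S" "y \<in> S" "\<tau> x = \<tau> y"
      then have "x \<in> U1" "y \<in> U1" using SU1 by auto
      from \<tau>(1)[OF this(1)] \<tau>(1)[OF this(2)] xy(3) have "\<phi> x = \<phi> y" by simp
      then show "x = y" using inj\<phi> xy unfolding S_def inj_on_def by blast
    qed
    have "(\<lambda>x. indicator S x * (\<bar>det (matrix (T x))\<bar> * jacobian \<psi> (\<tau> x))) = (\<lambda>u. indicator S u * jacobian \<phi> u)"
    proof
      fix u show "indicator S u * (\<bar>det (matrix (T u))\<bar> * jacobian \<psi> (\<tau> u)) = indicator S u * jacobian \<phi> u"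
        using jac[of u] SU1 by (cases "u \<in> S") auto
    qed
    moreover have "(\<lambda>u. indicator S u * jacobian \<phi> u) \<in> borel_measurable borel"
      by (rule jacobian_indicator_measurable[OF \<phi> _ Sb]) (auto simp: S_def)
    ultimately show "(\<lambda>x. indicator S x * (\<bar>det (matrix (T x))\<bar> * jacobian \<psi> (\<tau> x))) \<in> borel_measurable borel"
      by simp
    show "(\<lambda>y. indicator (\<tau> ` S) y * jacobian \<psi> y) \<in> borel_measurable borel"
      unfolding im by (rule jacobian_indicator_measurable[OF \<psi> _ Vb]) auto
    show "0 \<le> jacobian \<psi> y" if "y \<in> \<tau> ` S" for y
      using jacobian_pos[OF \<psi>, of y] that unfolding im by simp
  qed
  also have "\<dots> = (\<integral>\<^sup>+u\<in>V \<inter> \<psi> -` B. ennreal (jacobian \<psi> u) \<partial>lborel)"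
    unfolding im by (rule nn_integral_cong) (auto simp: indicator_def)
  finally show ?thesis .
qed

section \<open>The volume measure of a compact submanifold\<close>

lemma borel_on_UNIV: "borel_on (UNIV :: 'a::topological_space set) = borel"
  unfolding borel_on_def by (rule measure_eqI) (auto simp: sets_restrict_space emeasure_restrict_space)

lemma finite_sum_measure:
  assumes "\<And>i. i < (m::nat) \<Longrightarrow> sets (N i) = sets K"
  obtains \<mu> where "sets \<mu> = sets K" "\<And>B. B \<in> sets K \<Longrightarrow> emeasure \<mu> B = (\<Sum>i<m. emeasure (N i) B)"
proof
  let ?\<mu> = "measure_of (space K) (sets K) (\<lambda>B. \<Sum>i<m. emeasure (N i) B)"
  show s: "sets ?\<mu> = sets K" by (simp add: sets.sets_measure_of_eq)
  fix B assume B: "B \<in> sets K"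
  show "emeasure ?\<mu> B = (\<Sum>i<m. emeasure (N i) B)"
  proof (rule emeasure_measure_of[where \<Omega>="space K" and A="sets K"])
    show "positive (sets ?\<mu>) (\<lambda>B. \<Sum>i<m. emeasure (N i) B)" by (simp add: positive_def)
    show "countably_additive (sets ?\<mu>) (\<lambda>B. \<Sum>i<m. emeasure (N i) B)"
    proof (rule countably_additiveI)
      fix F :: "nat \<Rightarrow> _" assume F: "range F \<subseteq> sets ?\<mu>" "disjoint_family F"
      have "(\<Sum>n. \<Sum>i<m. emeasure (N i) (F n)) = (\<Sum>i<m. \<Sum>n. emeasure (N i) (F n))"
        by (rule suminf_sum) (simp add: summableI)
      also have "\<dots> = (\<Sum>i<m. emeasure (N i) (\<Union>(range F)))"
        by (rule sum.cong[OF refl]) (use F assms s in \<open>simp add: suminf_emeasure\<close>)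
      finally show "(\<Sum>n. \<Sum>i<m. emeasure (N i) (F n)) = (\<Sum>i<m. emeasure (N i) (\<Union>(range F)))" .
    qed
  qed (use B s sets.space_closed in auto)
qed

text \<open>
  Compactness yields finitely many charts from any supply of charts around each point; the
  predicate \<open>Q\<close> lets the supply be restricted, for instance to charts with bounded density.
\<close>

lemma compact_finite_atlas:
  fixes M :: "'a::real_inner set"
  assumes "compact M"
    and ch: "\<And>p. p \<in> M \<Longrightarrow> \<exists>(U :: (real^'d::finite) set) \<phi>. local_param k M U \<phi> \<and> p \<in> \<phi> ` U \<and> Q U \<phi>"
  obtains m :: nat and U :: "nat \<Rightarrow> (real^'d) set" and \<phi> where
    "\<And>i. i < m \<Longrightarrow> local_param k M (U i) (\<phi> i)" "\<And>i. i < m \<Longrightarrow> Q (U i) (\<phi> i)"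
    "M = (\<Union>i<m. \<phi> i ` U i)"
proof -
  obtain U :: "'a \<Rightarrow> (real^'d) set" and \<phi> where
    lp: "\<And>p. p \<in> M \<Longrightarrow> local_param k M (U p) (\<phi> p) \<and> p \<in> \<phi> p ` U p \<and> Q (U p) (\<phi> p)"
    using ch by metis
  have "\<exists>W. open W \<and> \<phi> p ` U p = M \<inter> W" if "p \<in> M" for p
    using lp[OF that] unfolding local_param_def openin_open by blast
  then obtain W where W: "\<And>p. p \<in> M \<Longrightarrow> open (W p) \<and> \<phi> p ` U p = M \<inter> W p" by metis
  have "M \<subseteq> (\<Union>p\<in>M. W p)" using lp W by blast
  then obtain C where C: "C \<subseteq> M" "finite C" "M \<subseteq> (\<Union>p\<in>C. W p)"
    using compactE_image[OF assms(1), of M W] W by blast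
  obtain h where h: "bij_betw h {0..<card C} C" using ex_bij_betw_nat_finite[OF C(2)] by blast
  have hC: "h i \<in> M" if "i < card C" for i using h that C(1) by (auto simp: bij_betw_def)
  show ?thesis
  proof (rule that[of "card C" "\<lambda>i. U (h i)" "\<lambda>i. \<phi> (h i)"])
    have "C = h ` {..<card C}" using h by (simp add: bij_betw_def lessThan_atLeast0)
    then have "M \<subseteq> (\<Union>i<card C. W (h i))" using C(3) by (metis image_image)
    then show "M = (\<Union>i<card C. \<phi> (h i) ` U (h i))" using W hC by fastforce
  qed (use lp hC in auto)
qed

lemma local_param_image_borel:
  assumes "compact M" "local_param k M U \<phi>"
  shows "\<phi> ` U \<in> sets borel"
proof -
  obtain W where "open W" "\<phi> ` U = M \<inter> W"
    using assms(2) unfolding local_param_def openin_open by blast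
  then show ?thesis using compact_imp_closed[OF assms(1)] by simp
qed

lemma local_param_image_subset: "local_param k M U \<phi> \<Longrightarrow> \<phi> ` U \<subseteq> M"
  unfolding local_param_def by (meson openin_imp_subset)

lemma chart_measure_exists:
  fixes \<phi> :: "real^'d::finite \<Rightarrow> 'a::real_inner"
  assumes lp: "local_param 1 M U \<phi>" and A: "A \<in> sets borel"
  obtains N :: "'a measure" where "sets N = sets borel"
    "\<And>B. B \<in> sets borel \<Longrightarrow> emeasure N B = (\<integral>\<^sup>+u\<in>U \<inter> \<phi> -` (B \<inter> A). ennreal (jacobian \<phi> u) \<partial>lborel)"
proof
  let ?\<phi> = "\<lambda>u. if u \<in> U then \<phi> u else 0"
  let ?S = "U \<inter> \<phi> -` A"
  let ?g = "\<lambda>u. ennreal (indicator ?S u * jacobian \<phi> u)"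
  have U: "U \<in> sets borel" using lp unfolding local_param_def by auto
  have m: "?\<phi> \<in> borel_measurable borel"
    using borel_measurable_continuous_on_restrict[OF local_param_continuous[OF lp]] U
    by (subst measurable_If_restrict_space_iff) auto
  have S: "?S \<in> sets borel" by (rule local_param_measurable[OF lp A])
  have g: "?g \<in> borel_measurable borel"
    using jacobian_indicator_measurable[OF lp _ S] by simp
  let ?N = "distr (density lborel ?g) borel ?\<phi>"
  show "sets ?N = sets borel" by simp
  fix B :: "'a set" assume B: "B \<in> sets borel"
  have pre: "?\<phi> -` B \<in> sets borel" using measurable_sets_borel[OF m B] .
  have "emeasure ?N B = emeasure (density lborel ?g) (?\<phi> -` B)"
    using m B by (subst emeasure_distr) auto
  also have "\<dots> = (\<integral>\<^sup>+u. ?g u * indicator (?\<phi> -` B) u \<partial>lborel)"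
    using g pre by (subst emeasure_density) auto
  also have "\<dots> = (\<integral>\<^sup>+u\<in>U \<inter> \<phi> -` (B \<inter> A). ennreal (jacobian \<phi> u) \<partial>lborel)"
    by (rule nn_integral_cong) (auto simp: indicator_def)
  finally show "emeasure ?N B = (\<integral>\<^sup>+u\<in>U \<inter> \<phi> -` (B \<inter> A). ennreal (jacobian \<phi> u) \<partial>lborel)" .
qed

lemma submanifold_charts:
  assumes "submanifold TYPE('d::finite) k M" "1 \<le> k" "p \<in> M"
  shows "\<exists>(U :: (real^'d) set) \<phi>. local_param 1 M U \<phi> \<and> p \<in> \<phi> ` U \<and> True"
  using assms unfolding submanifold_def by (meson local_param_mono)

text \<open>
  Disjoint Borel pieces, each inside one chart, reduce statements on the volume of a
  Borel set to the chart formula and additivity.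
\<close>

lemma finite_atlas_partition:
  fixes M :: "'a::real_inner set"
  assumes M: "compact M" "submanifold TYPE('d::finite) k M" "1 \<le> k"
  obtains m :: nat and U :: "nat \<Rightarrow> (real^'d) set" and \<phi> A where
    "\<And>i. i < m \<Longrightarrow> local_param 1 M (U i) (\<phi> i)" "\<And>i. i < m \<Longrightarrow> A i \<in> sets borel"
    "\<And>i. i < m \<Longrightarrow> A i \<subseteq> \<phi> i ` U i" "disjoint_family_on A {..<m}" "M = (\<Union>i<m. A i)"
proof -
  obtain m :: nat and U :: "nat \<Rightarrow> (real^'d) set" and \<phi> where
    at: "\<And>i. i < m \<Longrightarrow> local_param 1 M (U i) (\<phi> i)" "M = (\<Union>i<m. \<phi> i ` U i)"
    using compact_finite_atlas[OF M(1) submanifold_charts[OF M(2,3)]] by metis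
  let ?A = "disjointed (\<lambda>i. \<phi> i ` U i)"
  show ?thesis
  proof (rule that[of m U \<phi> ?A])
    show "?A i \<in> sets borel" if "i < m" for i
      unfolding disjointed_def
      by (intro sets.Diff sets.finite_UN local_param_image_borel[OF M(1) at(1)]) (use that in auto)
    show "?A i \<subseteq> \<phi> i ` U i" for i by (rule disjointed_subset)
    show "disjoint_family_on ?A {..<m}"
      using disjoint_family_disjointed[of "\<lambda>i. \<phi> i ` U i"] by (rule disjoint_family_on_mono[rotated]) simp
    show "M = (\<Union>i<m. ?A i)"
      using at(2) finite_UN_disjointed_eq[of "\<lambda>i. \<phi> i ` U i" m] by (simp add: lessThan_atLeast0)
  qed (use at in auto)
qed

text \<open>
  The measure is the sum of the chart formulas over a partition subordinate to a finite
  atlas. On a Borel set inside another chart each piece can be computed in that chart instead, and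
  the pieces add up.
\<close>

theorem volume_measure_exists:
  fixes M :: "'a::real_inner set"
  assumes M: "compact M" "submanifold TYPE('d::finite) k M" "1 \<le> k"
  obtains \<mu> where "volume_measure TYPE('d) UNIV M \<mu>"
proof -
  obtain m :: nat and U :: "nat \<Rightarrow> (real^'d) set" and \<phi> A where
    at: "\<And>i. i < m \<Longrightarrow> local_param 1 M (U i) (\<phi> i)" "\<And>i. i < m \<Longrightarrow> A i \<in> sets borel"
    "\<And>i. i < m \<Longrightarrow> A i \<subseteq> \<phi> i ` U i" "disjoint_family_on A {..<m}" "M = (\<Union>i<m. A i)"
    using finite_atlas_partition[OF M] by blast
  have "\<exists>N. sets N = sets borel \<and> (\<forall>B\<in>sets borel. emeasure N B =
      (\<integral>\<^sup>+u\<in>U i \<inter> \<phi> i -` (B \<inter> A i). ennreal (jacobian (\<phi> i) u) \<partial>lborel))" if "i < m" for i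
    using chart_measure_exists[OF at(1)[OF that] at(2)[OF that]] by metis
  then obtain N where N: "\<And>i. i < m \<Longrightarrow> sets (N i) = sets borel"
    "\<And>i B. i < m \<Longrightarrow> B \<in> sets borel \<Longrightarrow> emeasure (N i) B =
      (\<integral>\<^sup>+u\<in>U i \<inter> \<phi> i -` (B \<inter> A i). ennreal (jacobian (\<phi> i) u) \<partial>lborel)" by metis
  obtain \<mu> :: "'a measure" where \<mu>: "sets \<mu> = sets borel"
    "\<And>B. B \<in> sets borel \<Longrightarrow> emeasure \<mu> B = (\<Sum>i<m. emeasure (N i) B)"
    using finite_sum_measure[of m N borel] N(1) by blast
  have "volume_measure TYPE('d) UNIV M \<mu>"
    unfolding volume_measure_def borel_on_UNIV
  proof (intro conjI allI impI)
    show "sets \<mu> = sets borel" by (rule \<mu>(1))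
    have "emeasure (N i) (UNIV - M) = 0" if i: "i < m" for i
    proof -
      have "(UNIV - M) \<inter> A i = {}" using at(5) i by auto
      moreover have "UNIV - M \<in> sets borel" using compact_imp_closed[OF M(1)] by auto
      ultimately show ?thesis using N(2)[OF i, of "UNIV - M"] by (simp del: vimage_Int)
    qed
    moreover have "UNIV - M \<in> sets borel" using compact_imp_closed[OF M(1)] by auto
    ultimately show "emeasure \<mu> (UNIV - M) = 0" by (simp add: \<mu>(2))
  next
    fix V :: "(real^'d) set" and \<psi> B
    assume "local_param 1 M V \<psi> \<and> B \<in> sets borel \<and> B \<subseteq> \<psi> ` V"
    then have \<psi>: "local_param 1 M V \<psi>" and B: "B \<in> sets borel" "B \<subseteq> \<psi> ` V" by auto
    have BM: "B \<subseteq> M" using B(2) local_param_image_subset[OF \<psi>] by blast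
    have V: "V \<inter> \<psi> -` (B \<inter> A i) \<in> sets borel" if "i < m" for i
      by (rule local_param_measurable[OF \<psi>]) (use B at(2)[OF that] in auto)
    have "emeasure \<mu> B = (\<Sum>i<m. \<integral>\<^sup>+u\<in>U i \<inter> \<phi> i -` (B \<inter> A i). ennreal (jacobian (\<phi> i) u) \<partial>lborel)"
      unfolding \<mu>(2)[OF B(1)] by (rule sum.cong[OF refl]) (use N(2) B(1) in auto)
    also have "\<dots> = (\<Sum>i<m. \<integral>\<^sup>+v\<in>V \<inter> \<psi> -` (B \<inter> A i). ennreal (jacobian \<psi> v) \<partial>lborel)"
      by (rule sum.cong[OF refl], rule chart_volume_eq[OF at(1) \<psi>]) (use at(2,3) B in auto)
    also have "\<dots> = (\<Sum>i<m. \<integral>\<^sup>+v. ennreal (indicator (V \<inter> \<psi> -` (B \<inter> A i)) v * jacobian \<psi> v) \<partial>lborel)"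
      by (intro sum.cong[OF refl] nn_integral_cong) (auto simp: indicator_def)
    also have "\<dots> = (\<integral>\<^sup>+v. (\<Sum>i<m. ennreal (indicator (V \<inter> \<psi> -` (B \<inter> A i)) v * jacobian \<psi> v)) \<partial>lborel)"
      by (rule nn_integral_sum[symmetric])
        (use jacobian_indicator_measurable[OF \<psi> _ V] in simp)
    also have "\<dots> = (\<integral>\<^sup>+v\<in>V \<inter> \<psi> -` B. ennreal (jacobian \<psi> v) \<partial>lborel)"
    proof (rule nn_integral_cong)
      fix v
      have dis: "disjoint_family_on (\<lambda>i. V \<inter> \<psi> -` (B \<inter> A i)) {..<m}"
        using at(4) unfolding disjoint_family_on_def by blast
      have un: "(\<Union>i<m. V \<inter> \<psi> -` (B \<inter> A i)) = V \<inter> \<psi> -` B" using BM at(5) by blast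
      have "(\<Sum>i<m. ennreal (indicator (V \<inter> \<psi> -` (B \<inter> A i)) v * jacobian \<psi> v))
        = ennreal (jacobian \<psi> v) * (\<Sum>i<m. indicator (V \<inter> \<psi> -` (B \<inter> A i)) v)"
        unfolding sum_distrib_left by (rule sum.cong) (auto simp: indicator_def)
      also have "\<dots> = ennreal (jacobian \<psi> v) * indicator (V \<inter> \<psi> -` B) v"
        using indicator_UN_disjoint[OF finite_lessThan dis, of v] un by metis
      finally show "(\<Sum>i<m. ennreal (indicator (V \<inter> \<psi> -` (B \<inter> A i)) v * jacobian \<psi> v))
        = ennreal (jacobian \<psi> v) * indicator (V \<inter> \<psi> -` B) v" .
    qed
    finally show "emeasure \<mu> B = (\<integral>\<^sup>+v\<in>V \<inter> \<psi> -` B. ennreal (jacobian \<psi> v) \<partial>lborel)" .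
  qed
  then show ?thesis by (rule that)
qed

lemma volume_measureD:
  assumes "volume_measure TYPE('d::finite) UNIV M \<mu>"
  shows "sets \<mu> = sets borel" "emeasure \<mu> (UNIV - M) = 0"
    and "\<And>(U :: (real^'d) set) \<phi> B. local_param 1 M U \<phi> \<Longrightarrow> B \<in> sets borel \<Longrightarrow> B \<subseteq> \<phi> ` U \<Longrightarrow>
      emeasure \<mu> B = (\<integral>\<^sup>+u\<in>U \<inter> \<phi> -` B. ennreal (jacobian \<phi> u) \<partial>lborel)"
  using assms unfolding volume_measure_def borel_on_UNIV by blast+

lemma volume_measure_Int:
  assumes "volume_measure TYPE('d::finite) UNIV M \<mu>" "compact M" "B \<in> sets borel"
  shows "emeasure \<mu> (B \<inter> M) = emeasure \<mu> B"
proof -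
  note v = volume_measureD[OF assms(1)]
  have M: "M \<in> sets borel" using compact_imp_closed[OF assms(2)] by auto
  have "emeasure \<mu> (B - M) \<le> emeasure \<mu> (UNIV - M)"
    by (rule emeasure_mono) (use v(1) M in auto)
  then have "emeasure \<mu> (B - M) = 0" using v(2) by simp
  moreover have "emeasure \<mu> B = emeasure \<mu> (B \<inter> M) + emeasure \<mu> (B - M)"
    by (subst plus_emeasure) (use v(1) M assms(3) in \<open>auto intro!: arg_cong[where f="emeasure \<mu>"]\<close>)
  ultimately show ?thesis by simp
qed

text \<open>
  Within \<open>O'\<close> the restricted charts of \<open>M\<close> are charts of \<open>M'\<close>, so both measures obey the
  same chart formula on each piece of a partition.
\<close>

theorem volume_measure_local:
  fixes M M' :: "'a::real_inner set"
  assumes M: "compact M" "submanifold TYPE('d::finite) k M" "1 \<le> k" and M': "compact M'"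
    and v: "volume_measure TYPE('d) UNIV M \<mu>" and v': "volume_measure TYPE('d) UNIV M' \<mu>'"
    and O: "open O'" "M \<inter> O' = M' \<inter> O'" and B: "B \<in> sets borel" "B \<subseteq> O'"
  shows "emeasure \<mu> B = emeasure \<mu>' B"
proof -
  obtain m :: nat and U :: "nat \<Rightarrow> (real^'d) set" and \<phi> A where
    at: "\<And>i. i < m \<Longrightarrow> local_param 1 M (U i) (\<phi> i)" "\<And>i. i < m \<Longrightarrow> A i \<in> sets borel"
    "\<And>i. i < m \<Longrightarrow> A i \<subseteq> \<phi> i ` U i" "disjoint_family_on A {..<m}" "M = (\<Union>i<m. A i)"
    using finite_atlas_partition[OF M] by blast
  have dis: "disjoint_family_on (\<lambda>i. B \<inter> A i) {..<m}"
    using at(4) unfolding disjoint_family_on_def by blast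
  have un: "(\<Union>i<m. B \<inter> A i) = B \<inter> M" using at(5) by blast
  have BM: "B \<inter> M = B \<inter> M'" using O(2) B(2) by blast
  have sum: "emeasure \<nu> (B \<inter> M) = (\<Sum>i<m. emeasure \<nu> (B \<inter> A i))" if "sets \<nu> = sets borel" for \<nu>
  proof -
    have "(\<lambda>i. B \<inter> A i) ` {..<m} \<subseteq> sets \<nu>" using that at(2) B(1) by auto
    from sum_emeasure[OF this dis finite_lessThan] show ?thesis unfolding un by simp
  qed
  have eq: "emeasure \<mu> (B \<inter> A i) = emeasure \<mu>' (B \<inter> A i)" if i: "i < m" for i
  proof -
    have b: "B \<inter> A i \<in> sets borel" using B(1) at(2)[OF i] by auto
    note r = local_param_restrict[OF at(1)[OF i] O(1)]
    have s: "B \<inter> A i \<subseteq> \<phi> i ` (U i \<inter> \<phi> i -` O')"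
      unfolding r(2)[OF refl] using at(3)[OF i] B(2) by blast
    show ?thesis
      using volume_measureD(3)[OF v r(1)[OF refl] b s] volume_measureD(3)[OF v' r(1)[OF O(2)] b s] by simp
  qed
  have "emeasure \<mu> B = (\<Sum>i<m. emeasure \<mu> (B \<inter> A i))"
    using sum[OF volume_measureD(1)[OF v]] volume_measure_Int[OF v M(1) B(1)] by simp
  also have "\<dots> = (\<Sum>i<m. emeasure \<mu>' (B \<inter> A i))" using eq by simp
  also have "\<dots> = emeasure \<mu>' B"
    using sum[OF volume_measureD(1)[OF v']] volume_measure_Int[OF v' M' B(1)] BM by simp
  finally show ?thesis .
qed

lemma volume_measure_le:
  fixes \<phi> :: "real^'d::finite \<Rightarrow> 'a::real_inner"
  assumes v: "volume_measure TYPE('d) UNIV M \<mu>" and lp: "local_param 1 M U \<phi>"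
    and B: "B \<in> sets borel" "B \<subseteq> \<phi> ` U"
    and S: "U \<inter> \<phi> -` B \<subseteq> S" "S \<in> sets borel" and K: "\<And>u. u \<in> U \<inter> S \<Longrightarrow> jacobian \<phi> u \<le> K"
  shows "emeasure \<mu> B \<le> ennreal K * emeasure lborel S"
proof -
  have "emeasure \<mu> B = (\<integral>\<^sup>+u\<in>U \<inter> \<phi> -` B. ennreal (jacobian \<phi> u) \<partial>lborel)"
    by (rule volume_measureD(3)[OF v lp B])
  also have "\<dots> \<le> (\<integral>\<^sup>+u. ennreal K * indicator S u \<partial>lborel)"
  proof (rule nn_integral_mono)
    fix u
    show "ennreal (jacobian \<phi> u) * indicator (U \<inter> \<phi> -` B) u \<le> ennreal K * indicator S u"
      using S(1) K[of u] by (cases "u \<in> U \<inter> \<phi> -` B") (auto intro!: ennreal_leI)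
  qed
  also have "\<dots> = ennreal K * emeasure lborel S" using S(2) by (simp add: nn_integral_cmult_indicator)
  finally show ?thesis .
qed

lemma volume_measure_open_pos:
  fixes M :: "'a::real_inner set"
  assumes v: "volume_measure TYPE('d) UNIV M \<mu>" and M: "compact M" "submanifold TYPE('d::finite) k M" "1 \<le> k"
    and p: "p \<in> M" "p \<in> W" "open W"
  shows "0 < emeasure \<mu> W"
proof -
  obtain U :: "(real^'d) set" and \<phi> where lp: "local_param 1 M U \<phi>" "p \<in> \<phi> ` U"
    using submanifold_charts[OF M(2,3) p(1)] by blast
  define V where "V = U \<inter> \<phi> -` W"
  have lpV: "local_param 1 M V \<phi>" unfolding V_def by (rule local_param_restrict(1)[OF lp(1) p(3) refl])
  have V: "open V" "V \<noteq> {}" using lpV lp(2) p(2) unfolding local_param_def V_def by auto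
  have B: "\<phi> ` V \<in> sets borel" by (rule local_param_image_borel[OF M(1) lpV])
  have eq: "emeasure \<mu> (\<phi> ` V) = (\<integral>\<^sup>+u. ennreal (indicator V u * jacobian \<phi> u) \<partial>lborel)"
    unfolding volume_measureD(3)[OF v lpV B order_refl]
    by (rule nn_integral_cong) (auto simp: indicator_def)
  have meas: "(\<lambda>u. ennreal (indicator V u * jacobian \<phi> u)) \<in> borel_measurable lborel"
    using jacobian_indicator_measurable[OF lpV _ _ order_refl] V(1) by simp
  have "emeasure \<mu> (\<phi> ` V) \<noteq> 0"
  proof
    assume "emeasure \<mu> (\<phi> ` V) = 0"
    then have "emeasure lborel {u \<in> space lborel. ennreal (indicator V u * jacobian \<phi> u) \<noteq> 0} = 0"
      unfolding eq using nn_integral_0_iff[OF meas] by simp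
    moreover have "{u \<in> space lborel. ennreal (indicator V u * jacobian \<phi> u) \<noteq> 0} = V"
    proof (intro set_eqI)
      fix u show "u \<in> {u \<in> space lborel. ennreal (indicator V u * jacobian \<phi> u) \<noteq> 0} \<longleftrightarrow> u \<in> V"
        using jacobian_pos[OF lpV order_refl, of u] by (cases "u \<in> V") (auto simp: ennreal_eq_0_iff)
    qed
    ultimately have "V \<in> null_sets lborel" using V(1) by auto
    then have "V \<in> null_sets lebesgue" by (rule null_sets_completionI)
    then show False using open_not_negligible[OF V] by (simp add: negligible_iff_null_sets)
  qed
  moreover have "emeasure \<mu> (\<phi> ` V) \<le> emeasure \<mu> W"
    by (rule emeasure_mono) (use volume_measureD(1)[OF v] p(3) in \<open>auto simp: V_def\<close>)
  ultimately show ?thesis by (metis le_zero_eq zero_less_iff_neq_zero)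
qed

lemma volume_measure_finite:
  fixes M :: "'a::real_inner set"
  assumes v: "volume_measure TYPE('d) UNIV M \<mu>" and M: "compact M" "submanifold TYPE('d::finite) k M" "1 \<le> k"
  shows "emeasure \<mu> M < \<infinity>"
proof -
  let ?Q = "\<lambda>(U :: (real^'d) set) \<phi>. bounded U \<and> (\<exists>K. \<forall>u\<in>U. jacobian (\<phi> :: _ \<Rightarrow> 'a) u \<le> K)"
  have "\<exists>(U :: (real^'d) set) \<phi>. local_param 1 M U \<phi> \<and> p \<in> \<phi> ` U \<and> ?Q U \<phi>" if p: "p \<in> M" for p
  proof -
    obtain U :: "(real^'d) set" and \<phi> u0 where lp: "local_param 1 M U \<phi>" "p = \<phi> u0" "u0 \<in> U"
      using submanifold_charts[OF M(2,3) p] by blast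
    have U: "open U" "openin (top_of_set M) (\<phi> ` U)" "Ck_on 1 U \<phi>" using lp(1) unfolding local_param_def by auto
    obtain r where r: "r > 0" "cball u0 r \<subseteq> U" using U(1) lp(3) open_contains_cball by blast
    obtain g where g: "homeomorphism U (\<phi> ` U) \<phi> g" using lp(1) unfolding local_param_def by blast
    have sub: "ball u0 r \<subseteq> U" using r ball_subset_cball by blast
    then have "openin (top_of_set U) (ball u0 r)" by (simp add: open_subset)
    from homeomorphism_imp_open_map[OF g this] U(2) have "openin (top_of_set M) (\<phi> ` ball u0 r)"
      by (rule openin_trans)
    then obtain O' where O: "open O'" "\<phi> ` ball u0 r = M \<inter> O'" unfolding openin_open by blast
    have inj: "inj_on \<phi> U" using local_param_homeomorphism[OF lp(1)] by blast
    have "U \<inter> \<phi> -` O' = ball u0 r"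
    proof (intro set_eqI iffI)
      fix u assume u: "u \<in> U \<inter> \<phi> -` O'"
      then have "\<phi> u \<in> \<phi> ` ball u0 r" using O(2) local_param_image_subset[OF lp(1)] by blast
      then show "u \<in> ball u0 r" using inj sub u unfolding inj_on_def by blast
    next
      fix u assume "u \<in> ball u0 r"
      then show "u \<in> U \<inter> \<phi> -` O'" using O(2) sub by blast
    qed
    then have "local_param 1 M (ball u0 r) \<phi>" using local_param_restrict(1)[OF lp(1) O(1) refl] by simp
    moreover have "\<exists>K. \<forall>u\<in>ball u0 r. jacobian \<phi> u \<le> K"
    proof -
      have "compact (jacobian \<phi> ` cball u0 r)"
        by (intro compact_continuous_image continuous_on_subset[OF continuous_on_jacobian[OF U(3)]] r) auto
      then obtain K where "\<forall>x\<in>jacobian \<phi> ` cball u0 r. norm x \<le> K"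
        using compact_imp_bounded bounded_iff by metis
      then have "\<bar>jacobian \<phi> u\<bar> \<le> K" if "u \<in> ball u0 r" for u using that by simp
      then have "jacobian \<phi> u \<le> K" if "u \<in> ball u0 r" for u using that by (meson abs_le_D1)
      then show ?thesis by blast
    qed
    ultimately show ?thesis
      using lp(2) r(1) bounded_ball centre_in_ball by blast
  qed
  then obtain m :: nat and U :: "nat \<Rightarrow> (real^'d) set" and \<phi> where
    at: "\<And>i. i < m \<Longrightarrow> local_param 1 M (U i) (\<phi> i)" "\<And>i. i < m \<Longrightarrow> ?Q (U i) (\<phi> i)"
    "M = (\<Union>i<m. \<phi> i ` U i)"
    using compact_finite_atlas[OF M(1), of 1 ?Q] by blast
  have fin: "emeasure \<mu> (\<phi> i ` U i) < \<infinity>" if i: "i < m" for i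
  proof -
    obtain K where K: "\<And>u. u \<in> U i \<Longrightarrow> jacobian (\<phi> i) u \<le> K" and bd: "bounded (U i)" using at(2)[OF i] by blast
    have U: "U i \<in> sets borel" using at(1)[OF i] unfolding local_param_def by auto
    have "emeasure \<mu> (\<phi> i ` U i) \<le> ennreal K * emeasure lborel (U i)"
      by (rule volume_measure_le[OF v at(1)[OF i] local_param_image_borel[OF M(1) at(1)[OF i]]])
        (use K U in auto)
    also have "\<dots> < \<infinity>"
      using emeasure_bounded_finite[OF bd] by (simp add: ennreal_mult_less_top)
    finally show ?thesis .
  qed
  have "emeasure \<mu> M \<le> (\<Sum>i<m. emeasure \<mu> (\<phi> i ` U i))"
    unfolding at(3) by (rule emeasure_subadditive_finite)
      (use local_param_image_borel[OF M(1) at(1)] volume_measureD(1)[OF v] in auto)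
  also have "\<dots> < \<infinity>" using fin by (simp add: ennreal_sum_less_top)
  finally show ?thesis .
qed

text \<open>
  Constructing the measure in the whole space first keeps total volumes independent of
  the ambient dimension; the measure on \<open>E\<close> is obtained afterwards by restriction.
\<close>

lemma volume_measure_restrict:
  assumes v: "volume_measure TYPE('d::finite) UNIV M \<mu>" and E: "closed E" "M \<subseteq> E" and M: "compact M"
  shows "volume_measure TYPE('d) E M (restrict_space \<mu> E)"
  unfolding volume_measure_def
proof (intro conjI allI impI)
  have Eb: "E \<in> sets borel" using E(1) by auto
  have E\<mu>: "E \<inter> space \<mu> \<in> sets \<mu>" using volume_measureD(1)[OF v] Eb by auto
  show "sets (restrict_space \<mu> E) = sets (borel_on E)"
    using volume_measureD(1)[OF v] unfolding borel_on_def by (rule sets_restrict_space_cong)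
  have em: "emeasure (restrict_space \<mu> E) B = emeasure \<mu> B" if "B \<subseteq> E" for B
    by (rule emeasure_restrict_space[OF E\<mu> that])
  have "emeasure \<mu> (E - M) \<le> emeasure \<mu> (UNIV - M)"
    using volume_measureD(1)[OF v] compact_imp_closed[OF M] by (intro emeasure_mono) auto
  then show "emeasure (restrict_space \<mu> E) (E - M) = 0" using em[of "E - M"] volume_measureD(2)[OF v] by auto
  fix U :: "(real^'d) set" and \<phi> B
  assume a: "local_param 1 M U \<phi> \<and> B \<in> sets (borel_on E) \<and> B \<subseteq> \<phi> ` U"
  have "B \<in> sets borel" "B \<subseteq> E"
    using a Eb unfolding borel_on_def by (auto simp: sets_restrict_space_iff)
  then show "emeasure (restrict_space \<mu> E) B = (\<integral>\<^sup>+u\<in>U \<inter> \<phi> -` B. ennreal (jacobian \<phi> u) \<partial>lborel)"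
    using em volume_measureD(3)[OF v] a by simp
qed

section \<open>Two-point lower bound for the minimax risk\<close>

text \<open>
  A product density with respect to a product measure gives the product of the
  densities; both sides agree on boxes.
\<close>

lemma PiM_density:
  fixes M :: "'a measure" and w :: "'a \<Rightarrow> ennreal"
  assumes M: "sigma_finite_measure M" "sigma_finite_measure (density M w)"
    and w: "w \<in> borel_measurable M" and I: "finite I"
  shows "density (\<Pi>\<^sub>M i\<in>I. M) (\<lambda>X. \<Prod>i\<in>I. w (X i)) = (\<Pi>\<^sub>M i\<in>I. density M w)"
proof -
  interpret M: product_sigma_finite "\<lambda>_. M" by (simp add: product_sigma_finite_def M)
  interpret D: product_sigma_finite "\<lambda>_. density M w" by (simp add: product_sigma_finite_def M)
  have mw: "(\<lambda>X. w (X i)) \<in> borel_measurable (\<Pi>\<^sub>M i\<in>I. M)" if "i \<in> I" for i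
    by (rule measurable_compose[OF measurable_component_singleton[OF that] w])
  have m: "(\<lambda>X. \<Prod>i\<in>I. w (X i)) \<in> borel_measurable (\<Pi>\<^sub>M i\<in>I. M)"
    by (rule borel_measurable_prod_ennreal) (rule mw)
  show ?thesis
  proof (rule D.PiM_eqI[OF I])
    show "sets (density (\<Pi>\<^sub>M i\<in>I. M) (\<lambda>X. \<Prod>i\<in>I. w (X i))) = sets (\<Pi>\<^sub>M i\<in>I. density M w)"
      by (simp cong: sets_PiM_cong)
  next
    fix A :: "'b \<Rightarrow> 'a set" assume A: "\<And>i. i \<in> I \<Longrightarrow> A i \<in> sets (density M w)"
    have AM: "Pi\<^sub>E I A \<in> sets (\<Pi>\<^sub>M i\<in>I. M)" using A by (intro sets_PiM_I_finite I) auto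
    have "emeasure (density (\<Pi>\<^sub>M i\<in>I. M) (\<lambda>X. \<Prod>i\<in>I. w (X i))) (Pi\<^sub>E I A)
      = (\<integral>\<^sup>+X. (\<Prod>i\<in>I. w (X i)) * indicator (Pi\<^sub>E I A) X \<partial>(\<Pi>\<^sub>M i\<in>I. M))"
      by (rule emeasure_density[OF m AM])
    also have "\<dots> = (\<integral>\<^sup>+X. (\<Prod>i\<in>I. w (X i) * indicator (A i) (X i)) \<partial>(\<Pi>\<^sub>M i\<in>I. M))"
    proof (rule nn_integral_cong)
      fix X assume X: "X \<in> space (\<Pi>\<^sub>M i\<in>I. M)"
      then have ext: "X \<in> extensional I" by (auto simp: space_PiM PiE_def)
      show "(\<Prod>i\<in>I. w (X i)) * indicator (Pi\<^sub>E I A) X = (\<Prod>i\<in>I. w (X i) * indicator (A i) (X i))"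
      proof (cases "\<forall>i\<in>I. X i \<in> A i")
        case True
        then show ?thesis using ext by (auto simp: PiE_def Pi_def intro!: prod.cong)
      next
        case False
        then obtain i where i: "i \<in> I" "X i \<notin> A i" by blast
        then have "(\<Prod>i\<in>I. w (X i) * indicator (A i) (X i)) = 0"
          by (intro prod_zero[OF I] bexI[of _ i]) auto
        moreover have "X \<notin> Pi\<^sub>E I A" using i by auto
        ultimately show ?thesis by simp
      qed
    qed
    also have "\<dots> = (\<Prod>i\<in>I. \<integral>\<^sup>+x. w x * indicator (A i) x \<partial>M)"
      by (rule M.product_nn_integral_prod[OF I]) (use A w in auto)
    also have "\<dots> = (\<Prod>i\<in>I. emeasure (density M w) (A i))"
      by (rule prod.cong[OF refl]) (use A w in \<open>simp add: emeasure_density\<close>)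
    finally show "emeasure (density (\<Pi>\<^sub>M i\<in>I. M) (\<lambda>X. \<Prod>i\<in>I. w (X i))) (Pi\<^sub>E I A)
      = (\<Prod>i\<in>I. emeasure (density M w) (A i))" .
  qed
qed

lemma sigma_finite_density_le_1:
  assumes "prob_space P" "w \<in> borel_measurable P" "\<And>x. w x \<le> (1::ennreal)"
  shows "sigma_finite_measure (density P w)"
proof -
  have "emeasure (density P w) (space P) = (\<integral>\<^sup>+x. w x * indicator (space P) x \<partial>P)"
    by (rule emeasure_density[OF assms(2)]) simp
  also have "\<dots> \<le> (\<integral>\<^sup>+x. 1 \<partial>P)"
    using assms(3) by (intro nn_integral_mono) (auto simp: indicator_def)
  also have "\<dots> = 1" using prob_space.emeasure_space_1[OF assms(1)] by simp
  finally have "emeasure (density P w) (space (density P w)) \<noteq> \<infinity>"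
    by (metis ennreal_one_less_top infinity_ennreal_def leD space_density)
  then have "finite_measure (density P w)" by (rule finite_measureI)
  then show ?thesis by (simp add: finite_measure_def)
qed

text \<open>
  The common part \<open>density P0 w0 = density P1 w1\<close> of the two distributions lies below both,
  so its \<open>n\<close>-fold product lies below both sample laws. Integrating \<open>h0 + h1\<close> against it bounds the
  sum of the risks from below.
\<close>

lemma lecam_two_point:
  fixes P0 P1 :: "'a measure" and w0 w1 :: "'a \<Rightarrow> ennreal"
  assumes P: "prob_space P0" "prob_space P1" "sets P1 = sets P0"
    and w: "w0 \<in> borel_measurable P0" "w1 \<in> borel_measurable P1" "\<And>x. w0 x \<le> 1" "\<And>x. w1 x \<le> 1"
    and eq: "density P0 w0 = density P1 w1"
    and h: "h0 \<in> borel_measurable (\<Pi>\<^sub>M i\<in>{..<n::nat}. P0)" "h1 \<in> borel_measurable (\<Pi>\<^sub>M i\<in>{..<n}. P0)"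
    and c: "\<And>X. c \<le> h0 X + h1 X"
  shows "c * emeasure (density P0 w0) (space P0) ^ n
     \<le> (\<integral>\<^sup>+X. h0 X \<partial>(\<Pi>\<^sub>M i\<in>{..<n}. P0)) + (\<integral>\<^sup>+X. h1 X \<partial>(\<Pi>\<^sub>M i\<in>{..<n}. P1))"
proof -
  let ?\<nu> = "density P0 w0"
  let ?N = "\<Pi>\<^sub>M i\<in>{..<n}. ?\<nu>"
  have sf: "sigma_finite_measure ?\<nu>" by (rule sigma_finite_density_le_1[OF P(1) w(1,3)])
  have le: "(\<integral>\<^sup>+X. h X \<partial>?N) \<le> (\<integral>\<^sup>+X. h X \<partial>(\<Pi>\<^sub>M i\<in>{..<n}. P))"
    if "prob_space P" "w \<in> borel_measurable P" "\<And>x. w x \<le> 1" "density P w = ?\<nu>"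
      "h \<in> borel_measurable (\<Pi>\<^sub>M i\<in>{..<n}. P)" for P :: "'a measure" and w h
  proof -
    have s: "sigma_finite_measure P"
      using that(1) by (simp add: prob_space_def finite_measure_def)
    have mw: "(\<lambda>X. w (X i)) \<in> borel_measurable (\<Pi>\<^sub>M i\<in>{..<n}. P)" if "i \<in> {..<n}" for i
      by (rule measurable_compose[OF measurable_component_singleton[OF that] \<open>w \<in> borel_measurable P\<close>])
    have m: "(\<lambda>X. \<Prod>i<n. w (X i)) \<in> borel_measurable (\<Pi>\<^sub>M i\<in>{..<n}. P)"
      by (rule borel_measurable_prod_ennreal) (rule mw)
    have "(\<integral>\<^sup>+X. h X \<partial>?N) = (\<integral>\<^sup>+X. (\<Prod>i<n. w (X i)) * h X \<partial>(\<Pi>\<^sub>M i\<in>{..<n}. P))"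
      unfolding that(4)[symmetric]
      using PiM_density[OF s _ that(2), of "{..<n}"] sf that(4) nn_integral_density[OF m that(5)] by simp
    also have "\<dots> \<le> (\<integral>\<^sup>+X. 1 * h X \<partial>(\<Pi>\<^sub>M i\<in>{..<n}. P))"
    proof (intro nn_integral_mono mult_right_mono)
      fix X :: "nat \<Rightarrow> 'a"
      show "(\<Prod>i<n. w (X i)) \<le> 1" using that(3) by (intro prod_le_1) auto
    qed simp
    finally show ?thesis by simp
  qed
  have h1: "h1 \<in> borel_measurable (\<Pi>\<^sub>M i\<in>{..<n}. P1)"
    using h(2) P(3) by (simp cong: sets_PiM_cong measurable_cong_sets)
  have sN: "sets ?N = sets (\<Pi>\<^sub>M i\<in>{..<n}. P0)" by (simp cong: sets_PiM_cong)
  interpret D: product_sigma_finite "\<lambda>_. ?\<nu>" by (simp add: product_sigma_finite_def sf)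
  have "c * emeasure ?\<nu> (space P0) ^ n = (\<integral>\<^sup>+X. c \<partial>?N)"
    using D.emeasure_PiM[of "{..<n}" "\<lambda>_. space P0"] by (simp add: space_PiM)
  also have "\<dots> \<le> (\<integral>\<^sup>+X. h0 X + h1 X \<partial>?N)" by (intro nn_integral_mono c)
  also have "\<dots> = (\<integral>\<^sup>+X. h0 X \<partial>?N) + (\<integral>\<^sup>+X. h1 X \<partial>?N)"
    by (rule nn_integral_add) (use h sN in \<open>auto cong: measurable_cong_sets\<close>)
  also have "\<dots> \<le> (\<integral>\<^sup>+X. h0 X \<partial>(\<Pi>\<^sub>M i\<in>{..<n}. P0)) + (\<integral>\<^sup>+X. h1 X \<partial>(\<Pi>\<^sub>M i\<in>{..<n}. P1))"
    by (intro add_mono le[OF P(1) w(1,3) refl h(1)] le[OF P(2) w(2,4) eq[symmetric] h1])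
  finally show ?thesis .
qed

text \<open>
  Two uniform distributions on spaces of volume \<open>V0\<close> and \<open>V1\<close> which share the part \<open>A\<close>
  have the common part with density \<open>1 / max V0 V1\<close> on \<open>A\<close>. As the rest has volume at most \<open>\<epsilon>\<close> on
  either side, \<open>A\<close> has volume at least \<open>V0 - \<epsilon>\<close> and \<open>max V0 V1\<close> is at most \<open>V0 + \<epsilon>\<close>.
\<close>

lemma density_const_overlap:
  fixes \<mu>0 \<mu>1 :: "'a measure"
  assumes s: "sets \<mu>1 = sets \<mu>0" and A: "A \<in> sets \<mu>0"
    and eq: "\<And>B. B \<in> sets \<mu>0 \<Longrightarrow> B \<subseteq> A \<Longrightarrow> emeasure \<mu>0 B = emeasure \<mu>1 B"
    and V: "emeasure \<mu>0 (space \<mu>0) = ennreal V0" "emeasure \<mu>1 (space \<mu>1) = ennreal V1" "0 < V0" "0 < V1"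
    and \<epsilon>: "emeasure \<mu>0 (space \<mu>0 - A) \<le> ennreal \<epsilon>" "emeasure \<mu>1 (space \<mu>1 - A) \<le> ennreal \<epsilon>" "0 \<le> \<epsilon>"
  defines "P0 \<equiv> density \<mu>0 (\<lambda>_. ennreal (1 / V0))" and "P1 \<equiv> density \<mu>1 (\<lambda>_. ennreal (1 / V1))"
  obtains w0 w1 where "w0 \<in> borel_measurable P0" "w1 \<in> borel_measurable P1"
    "\<And>x. w0 x \<le> (1::ennreal)" "\<And>x. w1 x \<le> (1::ennreal)" "density P0 w0 = density P1 w1"
    "ennreal ((V0 - \<epsilon>) / (V0 + \<epsilon>)) \<le> emeasure (density P0 w0) (space P0)"
proof -
  define V where "V = max V0 V1"
  have Vp: "V > 0" "V0 \<le> V" "V1 \<le> V" using V by (auto simp: V_def)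
  define w where "w = (\<lambda>v x. ennreal (v / V) * indicator A x :: ennreal)"
  have A1: "A \<in> sets \<mu>1" using A s by simp
  have dens: "density (density \<mu> (\<lambda>_. ennreal (1 / v))) (w v) = density \<mu> (\<lambda>x. ennreal (1 / V) * indicator A x)"
    if "0 < v" "A \<in> sets \<mu>" for \<mu> v
  proof -
    have "w v \<in> borel_measurable \<mu>" using that(2) by (simp add: w_def)
    then have "density (density \<mu> (\<lambda>_. ennreal (1 / v))) (w v) = density \<mu> (\<lambda>x. ennreal (1 / v) * w v x)"
      by (intro density_density_eq) auto
    also have "(\<lambda>x. ennreal (1 / v) * w v x) = (\<lambda>x. ennreal (1 / V) * indicator A x)"
      using that(1) Vp(1) by (auto simp: w_def ennreal_mult[symmetric] mult.assoc[symmetric])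
    finally show ?thesis .
  qed
  have em: "emeasure (density \<mu> (\<lambda>x. ennreal (1 / V) * indicator A x)) B = ennreal (1 / V) * emeasure \<mu> (A \<inter> B)"
    if "A \<in> sets \<mu>" "B \<in> sets \<mu>" for \<mu> B
  proof -
    have "emeasure (density \<mu> (\<lambda>x. ennreal (1 / V) * indicator A x)) B = (\<integral>\<^sup>+x. ennreal (1 / V) * indicator A x * indicator B x \<partial>\<mu>)"
      using that by (subst emeasure_density) auto
    also have "\<dots> = (\<integral>\<^sup>+x. ennreal (1 / V) * indicator (A \<inter> B) x \<partial>\<mu>)"
      by (rule nn_integral_cong) (auto simp: indicator_def)
    also have "\<dots> = ennreal (1 / V) * emeasure \<mu> (A \<inter> B)"
      using that by (intro nn_integral_cmult_indicator) auto
    finally show ?thesis .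
  qed
  have split: "emeasure \<mu> (space \<mu>) = emeasure \<mu> A + emeasure \<mu> (space \<mu> - A)" if "A \<in> sets \<mu>" for \<mu>
    using that sets.sets_into_space[OF that]
    by (subst plus_emeasure) (auto intro!: arg_cong[where f="emeasure \<mu>"])
  obtain a where a: "emeasure \<mu>0 A = ennreal a" "0 \<le> a"
    using emeasure_mono[OF sets.sets_into_space[OF A], of \<mu>0] V(1) by (cases "emeasure \<mu>0 A" rule: ennreal_cases) (auto simp: top_unique)
  have "ennreal V0 \<le> ennreal a + ennreal \<epsilon>" using split[OF A] a V(1) \<epsilon>(1) by (metis add_left_mono)
  then have a0: "V0 - \<epsilon> \<le> a" using a(2) \<epsilon>(3) by (simp add: ennreal_plus[symmetric] del: ennreal_plus)
  have "ennreal V1 \<le> ennreal a + ennreal \<epsilon>"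
    using split[OF A1] a V(2) \<epsilon>(2) eq[OF A order_refl] by (metis add_left_mono)
  then have a1: "V1 \<le> a + \<epsilon>" using a(2) \<epsilon>(3) by (simp add: ennreal_plus[symmetric] del: ennreal_plus)
  have "ennreal a \<le> ennreal V0" using emeasure_mono[OF sets.sets_into_space[OF A], of \<mu>0] V(1) a by simp
  then have "a \<le> V0" using V(3) by simp
  then have Vle: "V \<le> V0 + \<epsilon>" using a1 \<epsilon>(3) by (simp add: V_def)
  have wle: "w v x \<le> 1" if "0 < v" "v \<le> V" for v x
    using that by (auto simp: w_def indicator_def)
  show ?thesis
  proof (rule that[of "w V0" "w V1"])
    show "w V0 \<in> borel_measurable P0" "w V1 \<in> borel_measurable P1"
      using A A1 unfolding P0_def P1_def w_def by auto
    show "w V0 x \<le> 1" "w V1 x \<le> 1" for x using wle V Vp by auto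
    show "density P0 (w V0) = density P1 (w V1)"
      unfolding P0_def P1_def dens[OF V(3) A] dens[OF V(4) A1]
    proof (rule measure_eqI)
      fix B assume "B \<in> sets (density \<mu>0 (\<lambda>x. ennreal (1 / V) * indicator A x))"
      then have B: "B \<in> sets \<mu>0" by simp
      then show "emeasure (density \<mu>0 (\<lambda>x. ennreal (1 / V) * indicator A x)) B
          = emeasure (density \<mu>1 (\<lambda>x. ennreal (1 / V) * indicator A x)) B"
        using em[OF A B] em[OF A1, of B] s eq[of "A \<inter> B"] A by auto
    qed (use s in simp)
    have "(V0 - \<epsilon>) / (V0 + \<epsilon>) \<le> 1 / V * a"
      using a0 Vle Vp(1) a(2) V(3) \<epsilon>(3) by (simp add: divide_simps mult.commute)
        (smt (verit) mult_mono mult_nonneg_nonneg mult_nonneg_nonpos mult.commute)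
    then have "ennreal ((V0 - \<epsilon>) / (V0 + \<epsilon>)) \<le> ennreal (1 / V) * ennreal a"
      using Vp(1) a(2) by (simp add: ennreal_mult[symmetric] ennreal_leI)
    also have "\<dots> = emeasure (density P0 (w V0)) (space P0)"
      unfolding P0_def dens[OF V(3) A] using em[OF A, of "space \<mu>0"] sets.sets_into_space[OF A] a(1)
      by (simp add: Int_absorb2)
    finally show "ennreal ((V0 - \<epsilon>) / (V0 + \<epsilon>)) \<le> emeasure (density P0 (w V0)) (space P0)" .
  qed
qed

text \<open>
  The triangle inequality for the losses at two parameters, in a form that covers
  infinite reach.
\<close>

lemma ereal_distance_sum:
  assumes "ereal a \<le> r0" "r1 \<le> ereal b"
  shows "ennreal (a - b) \<le> e2ennreal \<bar>ereal x - r0\<bar> + e2ennreal \<bar>ereal x - r1\<bar>"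
proof (cases "r0 = \<infinity> \<or> r1 = -\<infinity>")
  case True
  then have "e2ennreal \<bar>ereal x - r0\<bar> = top \<or> e2ennreal \<bar>ereal x - r1\<bar> = top" by auto
  then show ?thesis by auto
next
  case False
  then obtain s t where st: "r0 = ereal s" "r1 = ereal t"
    using assms by (cases r0; cases r1) auto
  have "a - b \<le> \<bar>x - s\<bar> + \<bar>x - t\<bar>" using assms st by auto
  then have "ennreal (a - b) \<le> ennreal (\<bar>x - s\<bar> + \<bar>x - t\<bar>)" by (rule ennreal_leI)
  then show ?thesis using st by simp
qed

text \<open>
  By Bernoulli's inequality the \<open>n\<close>-fold common part keeps mass at least \<open>1 / 2\<close>. The
  sum of the two risks is then at least \<open>(a - b) / 2\<close>, and the larger one at least half of this.
\<close>

lemma minimax_reach_risk_two_point: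
  fixes P0 P1 :: "'a::real_inner measure" and w0 w1 :: "'a \<Rightarrow> ennreal"
  assumes mem: "P0 \<in> \<P>" "P1 \<in> \<P>"
    and P: "prob_space P0" "prob_space P1" "sets P0 = sets (borel_on E)" "sets P1 = sets (borel_on E)"
    and w: "w0 \<in> borel_measurable P0" "w1 \<in> borel_measurable P1" "\<And>x. w0 x \<le> 1" "\<And>x. w1 x \<le> 1"
    and eq: "density P0 w0 = density P1 w1"
    and mass: "ennreal (1 - 1 / (2 * real n)) \<le> emeasure (density P0 w0) (space P0)" and n: "1 \<le> n"
    and r: "ereal a \<le> reach E (measure_support E P0)" "reach E (measure_support E P1) \<le> ereal b" "b \<le> a"
  shows "ennreal ((a - b) / 4) \<le> minimax_reach_risk E n \<P>"
  unfolding minimax_reach_risk_def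
proof (rule INF_greatest)
  fix R :: "(nat \<Rightarrow> 'a) \<Rightarrow> real" assume R: "R \<in> borel_measurable (\<Pi>\<^sub>M i\<in>{..<n}. borel_on E)"
  have R0: "R \<in> borel_measurable (\<Pi>\<^sub>M i\<in>{..<n}. P0)"
    using R P(3) by (simp cong: sets_PiM_cong measurable_cong_sets)
  let ?h = "\<lambda>P X. e2ennreal \<bar>ereal (R X) - reach E (measure_support E P)\<bar>"
  have m: "?h P \<in> borel_measurable (\<Pi>\<^sub>M i\<in>{..<n}. P0)" for P using R0 by measurable
  let ?x = "1 - 1 / (2 * real n)"
  have x: "0 \<le> ?x" using n by simp
  have "1 / 2 = 1 + real n * (- (1 / (2 * real n)))" using n by simp
  also have "\<dots> \<le> (1 + (- (1 / (2 * real n)))) ^ n"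
    by (rule Bernoulli_inequality) (use n in simp)
  finally have half: "1 / 2 \<le> ?x ^ n" by simp
  have "ennreal ((a - b) / 2) = ennreal ((a - b) * (1 / 2))" by simp
  also have "\<dots> \<le> ennreal ((a - b) * ?x ^ n)"
    by (intro ennreal_leI mult_left_mono half) (use r(3) in simp)
  also have "\<dots> = ennreal (a - b) * ennreal ?x ^ n"
    using r(3) x by (simp add: ennreal_mult ennreal_power)
  also have "\<dots> \<le> ennreal (a - b) * emeasure (density P0 w0) (space P0) ^ n"
    by (intro mult_left_mono power_mono mass) auto
  also have "\<dots> \<le> reach_risk E n R P0 + reach_risk E n R P1"
    unfolding reach_risk_def
    by (rule lecam_two_point[OF P(1,2) _ w eq m m])
      (use P(3,4) r(1,2) in \<open>auto intro: ereal_distance_sum\<close>)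
  also have "\<dots> \<le> (SUP P\<in>\<P>. reach_risk E n R P) + (SUP P\<in>\<P>. reach_risk E n R P)"
    by (intro add_mono SUP_upper mem)
  also have "\<dots> = 2 * (SUP P\<in>\<P>. reach_risk E n R P)" by (simp add: mult_2)
  finally have two: "ennreal ((a - b) / 2) \<le> 2 * (SUP P\<in>\<P>. reach_risk E n R P)" .
  show "ennreal ((a - b) / 4) \<le> (SUP P\<in>\<P>. reach_risk E n R P)"
  proof (cases "(SUP P\<in>\<P>. reach_risk E n R P)" rule: ennreal_cases)
    case (real s)
    have "ennreal ((a - b) / 2) \<le> ennreal (2 * s)"
      using two real by (simp add: ennreal_mult)
    then have "(a - b) / 2 \<le> 2 * s" using real by simp
    then show ?thesis using real by (simp add: ennreal_leI)
  next
    case top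
    then show ?thesis by (simp only: top_greatest)
  qed
qed

section \<open>Hypersurfaces with Lipschitz gradient\<close>

lemma isometry_inner:
  fixes f :: "'a::real_inner \<Rightarrow> 'b::real_inner"
  assumes "linear f" "\<And>x. norm (f x) = norm x"
  shows "f x \<bullet> f y = x \<bullet> y"
  using assms(2)[of "x + y"] assms(2)[of x] assms(2)[of y]
  by (simp add: dot_norm linear_add[OF assms(1)])

lemma isometry_inj:
  fixes f :: "'a::real_normed_vector \<Rightarrow> 'b::real_normed_vector"
  assumes "linear f" "\<And>x. norm (f x) = norm x"
  shows "inj f"
  using assms(2) by (subst linear_injective_0[OF assms(1)]) (metis norm_eq_zero)

lemma isometry_bounded_linear:
  fixes f :: "'a::real_normed_vector \<Rightarrow> 'b::real_normed_vector"
  assumes "linear f" "\<And>x. norm (f x) = norm x"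
  shows "bounded_linear f"
  by (rule bounded_linear_intro[where K=1])
    (use assms in \<open>auto simp: linear_add linear_cmul\<close>)

text \<open>
  Orthonormal coordinates on the hyperplane orthogonal to \<open>g\<close>, which for \<open>g\<close> the gradient at a
  point is the tangent space of the level set.
\<close>

definition isometric_frame :: "('a::real_inner \<Rightarrow> 'e::real_inner) \<Rightarrow> 'e \<Rightarrow> bool" where
  "isometric_frame Q g \<longleftrightarrow> linear Q \<and> (\<forall>v. norm (Q v) = norm v) \<and> range Q = {y. g \<bullet> y = 0}"

lemma isometric_frame_exists:
  fixes g :: "'e::euclidean_space"
  assumes "g \<noteq> 0" "DIM('e) = CARD('d::finite) + 1"
  obtains Q :: "real^'d \<Rightarrow> 'e" where "isometric_frame Q g"
proof -
  have "dim {y. g \<bullet> y = 0} = dim (UNIV :: (real^'d) set)"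
    using dim_hyperplane[OF assms(1)] assms(2) by (simp add: DIM_cart)
  then obtain Q :: "real^'d \<Rightarrow> 'e" and Q' where "linear Q" "Q ` UNIV = {y. g \<bullet> y = 0}"
    "\<And>x. x \<in> UNIV \<Longrightarrow> norm (Q x) = norm x"
    using isometries_subspaces[of "UNIV :: (real^'d) set" "{y. g \<bullet> y = 0}"] subspace_hyperplane[of g]
    by (metis subspace_UNIV)
  then show ?thesis using that[of Q] by (simp add: isometric_frame_def)
qed

text \<open>
  The zero set of \<open>F\<close>, where \<open>gr\<close> is the gradient of \<open>F\<close>. The two constants \<open>a\<close> and \<open>B\<close> control the
  whole geometry: the curvature is at most \<open>B / a\<close>, so the zero set is a graph over tangent balls of
  radius proportional to \<open>a / B\<close>, and its reach is at least \<open>a / B\<close>.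
\<close>

locale regular_hypersurface =
  fixes F :: "'e::euclidean_space \<Rightarrow> real" and gr :: "'e \<Rightarrow> 'e" and a B :: real
  assumes der: "\<And>x. (F has_derivative (\<lambda>h. gr x \<bullet> h)) (at x)"
    and lip: "\<And>x y. norm (gr x - gr y) \<le> B * norm (x - y)"
    and nondeg: "\<And>x. F x = 0 \<Longrightarrow> a \<le> norm (gr x)"
    and pos: "0 < a" "0 < B"
begin

definition \<nu> :: "'e \<Rightarrow> 'e" where "\<nu> x = gr x /\<^sub>R norm (gr x)"
definition r :: real where "r = a / (4 * B)"
definition pt :: "'e \<Rightarrow> ('c \<Rightarrow> 'e) \<Rightarrow> 'c \<Rightarrow> real \<Rightarrow> 'e" where
  "pt x Q v t = x + Q v + t *\<^sub>R \<nu> x"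
text \<open>
  Over the ball of radius \<open>r\<close> in the tangent plane, the zero set within normal distance \<open>r\<close> is the
  graph of \<open>s\<close>, with no further points.
\<close>

definition is_graph :: "'e \<Rightarrow> (('c::real_normed_vector) \<Rightarrow> 'e) \<Rightarrow> ('c \<Rightarrow> real) \<Rightarrow> bool" where
  "is_graph x Q s \<longleftrightarrow> (\<forall>v\<in>ball 0 r. \<bar>s v\<bar> < r \<and> F (pt x Q v (s v)) = 0 \<and>
      (\<forall>t. \<bar>t\<bar> < r \<and> F (pt x Q v t) = 0 \<longrightarrow> t = s v))"

lemma r_pos: "0 < r" using pos by (simp add: r_def)

lemma second_order_bound: "\<bar>F y - F x - gr x \<bullet> (y - x)\<bar> \<le> B / 2 * (norm (y - x))\<^sup>2"
proof -
  define n where "n = norm (y - x)"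
  define \<phi> where "\<phi> = (\<lambda>t. F (x + t *\<^sub>R (y - x)))"
  have d\<phi>: "(\<phi> has_real_derivative gr (x + t *\<^sub>R (y - x)) \<bullet> (y - x)) (at t)" for t
  proof -
    have "((\<lambda>t. x + t *\<^sub>R (y - x)) has_derivative (\<lambda>h. h *\<^sub>R (y - x))) (at t)"
      by (auto intro!: derivative_eq_intros)
    from has_derivative_compose[OF this der]
    have "(\<phi> has_derivative (\<lambda>h. gr (x + t *\<^sub>R (y - x)) \<bullet> (h *\<^sub>R (y - x)))) (at t)" unfolding \<phi>_def .
    then show ?thesis unfolding has_field_derivative_def by (simp add: mult_commute_abs)
  qed
  have close: "\<bar>gr (x + t *\<^sub>R (y - x)) \<bullet> (y - x) - gr x \<bullet> (y - x)\<bar> \<le> B * t * n\<^sup>2" if "0 \<le> t" for t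
  proof -
    have "\<bar>gr (x + t *\<^sub>R (y - x)) \<bullet> (y - x) - gr x \<bullet> (y - x)\<bar> = \<bar>(gr (x + t *\<^sub>R (y - x)) - gr x) \<bullet> (y - x)\<bar>"
      by (simp add: inner_diff_left)
    also have "\<dots> \<le> norm (gr (x + t *\<^sub>R (y - x)) - gr x) * n" unfolding n_def by (rule Cauchy_Schwarz_ineq2)
    also have "\<dots> \<le> (B * (t * n)) * n"
      using lip[of "x + t *\<^sub>R (y - x)" x] that by (intro mult_right_mono) (auto simp: n_def)
    finally show ?thesis by (simp add: power2_eq_square mult_ac)
  qed
  have up: "\<phi> 1 - \<phi> 0 - gr x \<bullet> (y - x) \<le> B / 2 * n\<^sup>2"
  proof -
    have "\<phi> 1 - 1 * (gr x \<bullet> (y - x)) - B / 2 * 1\<^sup>2 * n\<^sup>2 \<le> \<phi> 0 - 0 * (gr x \<bullet> (y - x)) - B / 2 * 0\<^sup>2 * n\<^sup>2"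
    proof (rule DERIV_nonpos_imp_nonincreasing[of 0 1 "\<lambda>t. \<phi> t - t * (gr x \<bullet> (y - x)) - B / 2 * t\<^sup>2 * n\<^sup>2"])
      fix t :: real assume t: "0 \<le> t" "t \<le> 1"
      have "((\<lambda>t. \<phi> t - t * (gr x \<bullet> (y - x)) - B / 2 * t\<^sup>2 * n\<^sup>2) has_real_derivative
          gr (x + t *\<^sub>R (y - x)) \<bullet> (y - x) - gr x \<bullet> (y - x) - B * t * n\<^sup>2) (at t)"
        by (rule derivative_eq_intros d\<phi> refl)+ simp
      moreover have "gr (x + t *\<^sub>R (y - x)) \<bullet> (y - x) - gr x \<bullet> (y - x) - B * t * n\<^sup>2 \<le> 0"
        using close[OF t(1)] by simp
      ultimately show "\<exists>z. ((\<lambda>t. \<phi> t - t * (gr x \<bullet> (y - x)) - B / 2 * t\<^sup>2 * n\<^sup>2) has_real_derivative z) (at t) \<and> z \<le> 0"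
        by blast
    qed simp
    then show ?thesis by simp
  qed
  have lo: "- (B / 2 * n\<^sup>2) \<le> \<phi> 1 - \<phi> 0 - gr x \<bullet> (y - x)"
  proof -
    have "\<phi> 0 - 0 * (gr x \<bullet> (y - x)) + B / 2 * 0\<^sup>2 * n\<^sup>2 \<le> \<phi> 1 - 1 * (gr x \<bullet> (y - x)) + B / 2 * 1\<^sup>2 * n\<^sup>2"
    proof (rule DERIV_nonneg_imp_nondecreasing[of 0 1 "\<lambda>t. \<phi> t - t * (gr x \<bullet> (y - x)) + B / 2 * t\<^sup>2 * n\<^sup>2"])
      fix t :: real assume t: "0 \<le> t" "t \<le> 1"
      have "((\<lambda>t. \<phi> t - t * (gr x \<bullet> (y - x)) + B / 2 * t\<^sup>2 * n\<^sup>2) has_real_derivative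
          gr (x + t *\<^sub>R (y - x)) \<bullet> (y - x) - gr x \<bullet> (y - x) + B * t * n\<^sup>2) (at t)"
        by (rule derivative_eq_intros d\<phi> refl)+ simp
      moreover have "0 \<le> gr (x + t *\<^sub>R (y - x)) \<bullet> (y - x) - gr x \<bullet> (y - x) + B * t * n\<^sup>2"
        using close[OF t(1)] by simp
      ultimately show "\<exists>z. ((\<lambda>t. \<phi> t - t * (gr x \<bullet> (y - x)) + B / 2 * t\<^sup>2 * n\<^sup>2) has_real_derivative z) (at t) \<and> 0 \<le> z"
        by blast
    qed simp
    then show ?thesis by simp
  qed
  have "\<phi> 1 = F y" "\<phi> 0 = F x" by (simp_all add: \<phi>_def)
  then show ?thesis using up lo unfolding n_def abs_le_iff by linarith
qed

lemma gr_nonzero: "F x = 0 \<Longrightarrow> gr x \<noteq> 0"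
  using nondeg[of x] pos by auto

lemma normal_facts:
  assumes "F x = 0"
  shows "norm (\<nu> x) = 1" "\<nu> x \<bullet> \<nu> x = 1" "gr x \<bullet> \<nu> x = norm (gr x)" "gr x = norm (gr x) *\<^sub>R \<nu> x"
    "\<And>y. gr x \<bullet> y = 0 \<longleftrightarrow> \<nu> x \<bullet> y = 0"
  using gr_nonzero[OF assms] unfolding \<nu>_def
  by (auto simp: dot_square_norm power2_eq_square)

lemma frameD:
  assumes "isometric_frame Q (gr x)"
  shows "linear Q" "\<And>v. norm (Q v) = norm v" "\<And>v. gr x \<bullet> Q v = 0" "bounded_linear Q"
  using assms isometry_bounded_linear[of Q] unfolding isometric_frame_def by auto

lemma norm_pt_diff_le:
  assumes "F x = 0" "isometric_frame Q (gr x)"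
  shows "norm (pt x Q v t - x) \<le> norm v + \<bar>t\<bar>"
  using norm_triangle_ineq[of "Q v" "t *\<^sub>R \<nu> x"] normal_facts(1)[OF assms(1)] frameD(2)[OF assms(2)]
  by (simp add: pt_def)

text \<open>
  Over the radius \<open>r = a / (4 * B)\<close> the gradient moves by at most \<open>B * (2 * r) = a / 2\<close>, so its
  normal component keeps half of its size at \<open>x\<close>. This makes \<open>F\<close> strictly increasing along the
  normal direction.
\<close>

lemma gr_pt_normal_ge:
  assumes x: "F x = 0" "isometric_frame Q (gr x)" and "norm v \<le> r" "\<bar>t\<bar> \<le> r"
  shows "a / 2 \<le> gr (pt x Q v t) \<bullet> \<nu> x"
proof -
  have "norm (pt x Q v t - x) \<le> 2 * r" using norm_pt_diff_le[OF x, of v t] assms by simp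
  then have "norm (gr (pt x Q v t) - gr x) \<le> B * (2 * r)"
    using lip[of "pt x Q v t" x] pos by (meson mult_left_mono order_trans less_imp_le)
  also have "B * (2 * r) = a / 2" using pos by (simp add: r_def)
  finally have "\<bar>(gr (pt x Q v t) - gr x) \<bullet> \<nu> x\<bar> \<le> a / 2"
    using Cauchy_Schwarz_ineq2[of "gr (pt x Q v t) - gr x" "\<nu> x"] normal_facts(1)[OF x(1)] by simp
  then show ?thesis using normal_facts(3)[OF x(1)] nondeg[OF x(1)] unfolding inner_diff_left by linarith
qed

lemma F_pt_mono:
  assumes x: "F x = 0" "isometric_frame Q (gr x)" and v: "norm v \<le> r" and t: "- r \<le> t1" "t1 \<le> t2" "t2 \<le> r"
  shows "a / 2 * (t2 - t1) \<le> F (pt x Q v t2) - F (pt x Q v t1)"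
proof (cases "t1 = t2")
  case False
  have d: "((\<lambda>t. F (pt x Q v t)) has_real_derivative gr (pt x Q v t) \<bullet> \<nu> x) (at t)" for t
  proof -
    have "((\<lambda>t. pt x Q v t) has_derivative (\<lambda>h. h *\<^sub>R \<nu> x)) (at t)"
      unfolding pt_def by (auto intro!: derivative_eq_intros)
    from has_derivative_compose[OF this der]
    show ?thesis unfolding has_field_derivative_def by (simp add: mult_commute_abs)
  qed
  obtain z where z: "t1 < z" "z < t2" "F (pt x Q v t2) - F (pt x Q v t1) = (t2 - t1) * (gr (pt x Q v z) \<bullet> \<nu> x)"
    using MVT2[of t1 t2 "\<lambda>t. F (pt x Q v t)" "\<lambda>t. gr (pt x Q v t) \<bullet> \<nu> x"] d t False by auto
  have "a / 2 \<le> gr (pt x Q v z) \<bullet> \<nu> x" by (rule gr_pt_normal_ge[OF x v]) (use z t in auto)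
  from mult_left_mono[OF this, of "t2 - t1"] show ?thesis using z t by (simp add: mult.commute)
qed simp

text \<open>
  Since \<open>gr x\<close> is orthogonal to the tangent plane, \<open>F\<close> is only quadratically small on it, at
  most \<open>B / 2 * r\<^sup>2 = a / 8 * r\<close>. Moving by \<open>3 * r / 4\<close> along the normal changes \<open>F\<close> by at least
  \<open>3 * a / 8 * r\<close>, which forces a sign change.
\<close>

lemma graph_exists:
  assumes x: "F x = 0" "isometric_frame Q (gr x)"
  obtains s where "is_graph x Q s"
proof -
  have ex: "\<exists>t. \<bar>t\<bar> < r \<and> F (pt x Q v t) = 0 \<and> (\<forall>t'. \<bar>t'\<bar> < r \<and> F (pt x Q v t') = 0 \<longrightarrow> t' = t)"
    if v: "v \<in> ball 0 r" for v
  proof -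
    have nv: "norm v \<le> r" using v by simp
    define R where "R = 3 * r / 4"
    have rp: "0 < r" by (rule r_pos)
    have "\<bar>F (pt x Q v 0)\<bar> \<le> B / 2 * (norm v)\<^sup>2"
      using second_order_bound[of "pt x Q v 0" x] x frameD[OF x(2)] by (simp add: pt_def)
    also have "\<dots> \<le> B / 2 * r\<^sup>2"
      using nv pos by (intro mult_left_mono power_mono) auto
    also have "\<dots> = a / 8 * r" using pos by (simp add: r_def power2_eq_square)
    finally have F0: "\<bar>F (pt x Q v 0)\<bar> \<le> a / 8 * r" .
    have ar: "0 < a * r" using pos rp by simp
    have "a / 2 * (R - 0) \<le> F (pt x Q v R) - F (pt x Q v 0)"
      by (rule F_pt_mono[OF x nv]) (use rp in \<open>auto simp: R_def\<close>)
    then have up: "0 \<le> F (pt x Q v R)" using F0 ar by (simp add: R_def abs_le_iff)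
    have "a / 2 * (0 - (- R)) \<le> F (pt x Q v 0) - F (pt x Q v (- R))"
      by (rule F_pt_mono[OF x nv]) (use rp in \<open>auto simp: R_def\<close>)
    then have lo: "F (pt x Q v (- R)) \<le> 0" using F0 ar by (simp add: R_def abs_le_iff)
    have "continuous_on {-R..R} (\<lambda>t. F (pt x Q v t))"
    proof (rule continuous_on_compose2[of UNIV F])
      show "continuous_on UNIV F"
        using der has_derivative_continuous continuous_at_imp_continuous_on by blast
    qed (auto simp: pt_def intro!: continuous_intros)
    then obtain t where t: "- R \<le> t" "t \<le> R" "F (pt x Q v t) = 0"
      using IVT'[of "\<lambda>t. F (pt x Q v t)" "- R" 0 R] up lo rp by (auto simp: R_def)
    have un: "t' = t" if t': "\<bar>t'\<bar> < r" "F (pt x Q v t') = 0" for t'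
    proof (rule ccontr)
      assume ne: "t' \<noteq> t"
      have tr: "\<bar>t\<bar> < r" using t rp by (auto simp: R_def)
      have "a / 2 * (max t t' - min t t') \<le> F (pt x Q v (max t t')) - F (pt x Q v (min t t'))"
        by (rule F_pt_mono[OF x nv]) (use tr t' in auto)
      also have "\<dots> = 0" using t(3) t'(2) by (simp add: max_def min_def)
      finally show False using ne pos by (auto simp: max_def min_def mult_le_0_iff split: if_splits)
    qed
    show ?thesis using t un rp by (intro exI[of _ t]) (auto simp: R_def)
  qed
  then obtain s where "\<forall>v\<in>ball 0 r. \<bar>s v\<bar> < r \<and> F (pt x Q v (s v)) = 0 \<and>
      (\<forall>t. \<bar>t\<bar> < r \<and> F (pt x Q v t) = 0 \<longrightarrow> t = s v)" by metis
  then show ?thesis using that unfolding is_graph_def by blast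
qed

lemma graphD:
  assumes "is_graph x Q s" "norm v < r"
  shows "\<bar>s v\<bar> < r" "F (pt x Q v (s v)) = 0" "\<And>t. \<bar>t\<bar> < r \<Longrightarrow> F (pt x Q v t) = 0 \<Longrightarrow> t = s v"
  using assms unfolding is_graph_def by auto

lemma graph_at_0:
  assumes "F x = 0" "isometric_frame Q (gr x)" "is_graph x Q s"
  shows "s 0 = 0"
  using graphD(3)[OF assms(3), of 0 0] r_pos assms(1) linear_0[OF frameD(1)[OF assms(2)]]
  by (simp add: pt_def)

lemma graph_continuous:
  assumes x: "F x = 0" "isometric_frame Q (gr x)" and s: "is_graph x Q s"
  shows "continuous_on (ball 0 r) s"
proof -
  define G where "G = norm (gr x) + B * (2 * r) + B / 2 * (2 * r)"
  have rp: "0 < r" by (rule r_pos)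
  have G: "0 \<le> G" using pos rp by (simp add: G_def)
  have "\<bar>s v - s v'\<bar> \<le> 2 * G / a * norm (v - v')" if v: "v \<in> ball 0 r" "v' \<in> ball 0 r" for v v'
  proof -
    have nv: "norm v < r" "norm v' < r" using v by auto
    note b = graphD[OF s nv(1)] graphD[OF s nv(2)]
    have "a / 2 * (max (s v) (s v') - min (s v) (s v')) \<le> F (pt x Q v (max (s v) (s v'))) - F (pt x Q v (min (s v) (s v')))"
      by (rule F_pt_mono[OF x]) (use nv b(1,4) in auto)
    then have 1: "a / 2 * \<bar>s v - s v'\<bar> \<le> \<bar>F (pt x Q v (s v'))\<bar>"
      using b(2) by (auto simp: max_def min_def abs_if split: if_splits)
    let ?y = "pt x Q v (s v')" and ?z = "pt x Q v' (s v')"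
    have d: "?y - ?z = Q (v - v')" by (simp add: pt_def linear_diff[OF frameD(1)[OF x(2)]])
    have nd: "norm (?y - ?z) = norm (v - v')" unfolding d by (rule frameD(2)[OF x(2)])
    have n2: "norm (v - v') \<le> 2 * r" using norm_triangle_ineq4[of v v'] nv by simp
    have "norm (gr ?z) \<le> norm (gr x) + norm (gr ?z - gr x)" by (metis add.commute diff_add_cancel norm_triangle_ineq)
    also have "norm (gr ?z - gr x) \<le> B * norm (?z - x)" by (rule lip)
    also have "\<dots> \<le> B * (2 * r)"
      using norm_pt_diff_le[OF x, of v' "s v'"] nv b(4) pos by (intro mult_left_mono) auto
    finally have g: "norm (gr ?z) \<le> norm (gr x) + B * (2 * r)" by simp
    have "\<bar>F ?y\<bar> \<le> \<bar>F ?y - F ?z - gr ?z \<bullet> (?y - ?z)\<bar> + \<bar>gr ?z \<bullet> (?y - ?z)\<bar>" using b(5) by simp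
    also have "\<dots> \<le> B / 2 * (norm (v - v'))\<^sup>2 + norm (gr ?z) * norm (v - v')"
      using second_order_bound[of ?y ?z] Cauchy_Schwarz_ineq2[of "gr ?z" "?y - ?z"] unfolding nd by (intro add_mono)
    also have "\<dots> \<le> (B / 2 * (2 * r)) * norm (v - v') + (norm (gr x) + B * (2 * r)) * norm (v - v')"
    proof (rule add_mono)
      have "norm (v - v') * norm (v - v') \<le> 2 * r * norm (v - v')" by (rule mult_right_mono[OF n2 norm_ge_zero])
      from mult_left_mono[OF this, of "B / 2"] pos
      show "B / 2 * (norm (v - v'))\<^sup>2 \<le> B / 2 * (2 * r) * norm (v - v')"
        by (simp add: power2_eq_square mult.assoc)
    qed (rule mult_right_mono[OF g norm_ge_zero])
    also have "\<dots> = G * norm (v - v')" by (simp add: G_def algebra_simps)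
    finally have "a / 2 * \<bar>s v - s v'\<bar> \<le> G * norm (v - v')" using 1 by simp
    then show ?thesis using pos by (simp add: field_simps)
  qed
  then have "(2 * G / a)-lipschitz_on (ball 0 r) s"
    using G pos by (intro lipschitz_onI) (auto simp: dist_norm)
  then show ?thesis by (rule lipschitz_on_continuous_on)
qed

text \<open>
  The graph map \<open>v \<mapsto> (v, s v)\<close> is a continuous lift of \<open>v \<mapsto> (v, 0)\<close> through
  \<open>(v, t) \<mapsto> (v, F (pt x Q v t))\<close>, which is an immersion because the normal derivative of \<open>F\<close> does not
  vanish.
\<close>

lemma graph_has_derivative:
  fixes Q :: "'c::euclidean_space \<Rightarrow> 'e"
  assumes x: "F x = 0" "isometric_frame Q (gr x)" and s: "is_graph x Q s" and v: "norm v < r"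
  shows "(s has_derivative (\<lambda>h. - (gr (pt x Q v (s v)) \<bullet> Q h) / (gr (pt x Q v (s v)) \<bullet> \<nu> x))) (at v)"
proof -
  let ?y = "pt x Q v (s v)"
  define \<psi> where "\<psi> = (\<lambda>z :: 'c \<times> real. (fst z, F (pt x Q (fst z) (snd z))))"
  define \<tau> where "\<tau> = (\<lambda>v. (v, s v))"
  let ?A = "\<lambda>h :: 'c \<times> real. (fst h, gr ?y \<bullet> (Q (fst h) + snd h *\<^sub>R \<nu> x))"
  have pos': "0 < gr ?y \<bullet> \<nu> x"
    using gr_pt_normal_ge[OF x, of v "s v"] graphD(1)[OF s v] v pos by simp
  have d\<phi>: "((\<lambda>v :: 'c. (v, 0 :: real)) has_derivative (\<lambda>h. (h, 0))) (at v)"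
    by (auto intro!: derivative_eq_intros)
  have dpt: "((\<lambda>z. pt x Q (fst z) (snd z)) has_derivative (\<lambda>h. Q (fst h) + snd h *\<^sub>R \<nu> x)) (at z)" for z
    unfolding pt_def
    by (auto intro!: derivative_eq_intros bounded_linear.has_derivative[OF frameD(4)[OF x(2)]])
  have d\<psi>: "(\<psi> has_derivative ?A) (at (\<tau> v))"
    unfolding \<psi>_def
    by (intro has_derivative_Pair has_derivative_fst has_derivative_ident)
      (use has_derivative_compose[OF dpt[of "\<tau> v"] der] in \<open>simp add: \<tau>_def\<close>)
  have inj: "inj ?A"
  proof (rule injI)
    fix h h' assume e: "?A h = ?A h'"
    then have "fst h = fst h'" by simp
    moreover have "snd h * (gr ?y \<bullet> \<nu> x) = snd h' * (gr ?y \<bullet> \<nu> x)"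
      using e \<open>fst h = fst h'\<close> by (simp add: inner_add_right)
    ultimately show "h = h'" using pos' by (simp add: prod_eq_iff)
  qed
  have vb: "v \<in> ball 0 r" using v by simp
  have "isCont s v" using graph_continuous[OF x s] vb continuous_on_eq_continuous_at[OF open_ball] by blast
  then have cont: "isCont \<tau> v" unfolding \<tau>_def by (intro continuous_intros)
  obtain T where T: "(\<tau> has_derivative T) (at v)" "\<And>h. (h, 0) = ?A (T h)"
    by (rule has_derivative_lift_through_immersion[OF d\<phi> d\<psi> inj cont open_ball vb])
      (use graphD(2)[OF s] in \<open>auto simp: \<psi>_def \<tau>_def\<close>)
  have "((\<lambda>v. snd (\<tau> v)) has_derivative (\<lambda>h. snd (T h))) (at v)" by (rule has_derivative_snd[OF T(1)])
  moreover have "snd (T h) = - (gr ?y \<bullet> Q h) / (gr ?y \<bullet> \<nu> x)" for h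
  proof -
    have "fst (T h) = h" "gr ?y \<bullet> (Q (fst (T h)) + snd (T h) *\<^sub>R \<nu> x) = 0" using T(2)[of h] by auto
    then have "gr ?y \<bullet> Q h + snd (T h) * (gr ?y \<bullet> \<nu> x) = 0" by (simp add: inner_add_right)
    then show ?thesis using pos' by (simp add: field_simps)
  qed
  ultimately show ?thesis by (simp add: \<tau>_def)
qed

subsection \<open>The embedded hypersurface\<close>

text \<open>
  The hypersurface lives in a Euclidean space \<open>'e\<close> of dimension one more than its own; \<open>J\<close> embeds it
  isometrically into an ambient space of higher, possibly infinite, dimension.
\<close>

context
  fixes J :: "'e \<Rightarrow> 'a::real_inner" and M :: "'a set"
  assumes J: "linear J" "\<And>y. norm (J y) = norm y" and M_def: "M = J ` {x. F x = 0}"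
begin

lemma J_bounded_linear: "bounded_linear J" by (rule isometry_bounded_linear[OF J])
lemma J_inner: "J x \<bullet> J y = x \<bullet> y" by (rule isometry_inner[OF J])

lemma chart_eq: "J x + J (Q v) + s v *\<^sub>R J (\<nu> x) = J (pt x Q v (s v))"
  by (simp add: pt_def linear_add[OF J(1)] linear_cmul[OF J(1)])

text \<open>
  The curve is the graph over a line in the tangent plane. Tangent vectors are velocities of
  curves defined on the whole real line, hence the constant continuation outside a neighbourhood of
  \<open>0\<close>.
\<close>

lemma tangent_vector_curve:
  fixes Q :: "'c::euclidean_space \<Rightarrow> 'e"
  assumes x: "F x = 0" "isometric_frame Q (gr x)"
  obtains \<gamma> where "\<gamma> 0 = J x" "range \<gamma> \<subseteq> M" "(\<gamma> has_vector_derivative J (Q w)) (at 0)"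
proof -
  obtain s where s: "is_graph x Q s" by (rule graph_exists[OF x])
  note s0 = graph_at_0[OF x s]
  define U where "U = {t :: real. norm (t *\<^sub>R w) < r}"
  define \<gamma>' where "\<gamma>' = (\<lambda>t. J (pt x Q (t *\<^sub>R w) (s (t *\<^sub>R w))))"
  define \<gamma> where "\<gamma> = (\<lambda>t. if t \<in> U then \<gamma>' t else J x)"
  have U: "open U" unfolding U_def by (intro open_Collect_less continuous_intros)
  have 0: "0 \<in> U" using r_pos by (simp add: U_def)
  have pt0: "pt x Q 0 0 = x" by (simp add: pt_def linear_0[OF frameD(1)[OF x(2)]])
  have ds: "(s has_derivative (\<lambda>h. 0)) (at 0)"
    using graph_has_derivative[OF x s, of 0] r_pos by (simp add: s0 pt0 frameD(3)[OF x(2)])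
  have dw: "((\<lambda>t. t *\<^sub>R w) has_derivative (\<lambda>h. h *\<^sub>R w)) (at 0)" by (auto intro!: derivative_eq_intros)
  have "((\<lambda>t. s (t *\<^sub>R w)) has_derivative (\<lambda>h. 0)) (at 0)"
    using has_derivative_compose[OF dw, of s "\<lambda>_. 0"] ds by simp
  then have "((\<lambda>t. pt x Q (t *\<^sub>R w) (s (t *\<^sub>R w))) has_derivative (\<lambda>h. Q (h *\<^sub>R w))) (at 0)"
    unfolding pt_def
    by (auto intro!: derivative_eq_intros bounded_linear.has_derivative[OF frameD(4)[OF x(2)] dw])
  from bounded_linear.has_derivative[OF J_bounded_linear this]
  have "(\<gamma>' has_derivative (\<lambda>h. J (Q (h *\<^sub>R w)))) (at 0)" unfolding \<gamma>'_def .
  then have "(\<gamma>' has_vector_derivative J (Q w)) (at 0)"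
    unfolding has_vector_derivative_def by (simp add: linear_cmul[OF frameD(1)[OF x(2)]] linear_cmul[OF J(1)])
  then have "(\<gamma> has_vector_derivative J (Q w)) (at 0)"
    by (rule has_vector_derivative_transform_within_open[OF _ U 0]) (simp add: \<gamma>_def)
  moreover have "\<gamma> 0 = J x" by (simp add: \<gamma>_def \<gamma>'_def 0 s0 pt0)
  moreover have "range \<gamma> \<subseteq> M"
    using graphD(2)[OF s] x(1) by (auto simp: \<gamma>_def \<gamma>'_def U_def M_def)
  ultimately show ?thesis using that by blast
qed

lemma tangent_space_eq:
  assumes x: "F x = 0" "isometric_frame (Q :: 'c::euclidean_space \<Rightarrow> 'e) (gr x)"
  shows "tangent_space M (J x) = range (\<lambda>w. J (Q w))"
proof (intro equalityI subsetI)
  fix v assume "v \<in> range (\<lambda>w. J (Q w))"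
  then obtain w where w: "v = J (Q w)" by blast
  obtain \<gamma> where "\<gamma> 0 = J x" "range \<gamma> \<subseteq> M" "(\<gamma> has_vector_derivative J (Q w)) (at 0)"
    by (rule tangent_vector_curve[OF x])
  then show "v \<in> tangent_space M (J x)" unfolding tangent_space_def w by blast
next
  fix v assume "v \<in> tangent_space M (J x)"
  then obtain \<gamma> :: "real \<Rightarrow> 'a" where \<gamma>: "\<gamma> 0 = J x" "range \<gamma> \<subseteq> M" "(\<gamma> has_vector_derivative v) (at 0)"
    unfolding tangent_space_def by blast
  obtain K where K: "bounded_linear K" "\<And>y. K (J y) = y"
    using bounded_left_inverse[OF J(1) isometry_inj[OF J]] by blast
  have JK: "J (K (\<gamma> t)) = \<gamma> t" and FK: "F (K (\<gamma> t)) = 0" for t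
  proof -
    obtain y where "\<gamma> t = J y" "F y = 0" using \<gamma>(2) unfolding M_def by blast
    then show "J (K (\<gamma> t)) = \<gamma> t" "F (K (\<gamma> t)) = 0" by (simp_all add: K(2))
  qed
  have dK: "((\<lambda>t. K (\<gamma> t)) has_vector_derivative K v) (at 0)"
    by (rule bounded_linear.has_vector_derivative[OF K(1) \<gamma>(3)])
  have "((\<lambda>t. J (K (\<gamma> t))) has_vector_derivative J (K v)) (at 0)"
    by (rule bounded_linear.has_vector_derivative[OF J_bounded_linear dK])
  then have "(\<gamma> has_vector_derivative J (K v)) (at 0)" unfolding JK .
  note v = vector_derivative_unique_at[OF \<gamma>(3) this]
  have K0: "K (\<gamma> 0) = x" by (simp add: \<gamma>(1) K(2))
  have "((\<lambda>t. F (K (\<gamma> t))) has_derivative (\<lambda>h. gr x \<bullet> (h *\<^sub>R K v))) (at 0)"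
    using has_derivative_compose[OF dK[unfolded has_vector_derivative_def] der[of "K (\<gamma> 0)"]] unfolding K0 .
  moreover have "((\<lambda>t. F (K (\<gamma> t))) has_derivative (\<lambda>h. 0)) (at 0)" unfolding FK by simp
  ultimately have "(\<lambda>h. gr x \<bullet> (h *\<^sub>R K v)) = (\<lambda>h::real. 0)" by (rule has_derivative_unique)
  from fun_cong[OF this, of 1] have "gr x \<bullet> K v = 0" by simp
  then obtain w where w: "K v = Q w" using x(2) unfolding isometric_frame_def by blast
  show "v \<in> range (\<lambda>w. J (Q w))" by (rule range_eqI[where x = w]) (rule v[unfolded w])
qed

text \<open>
  The squared distance to \<open>z\<close> along a curve in \<open>M\<close> has a minimum at the nearest point.
\<close>

lemma nearest_orthogonal:
  fixes Q :: "'c::euclidean_space \<Rightarrow> 'e"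
  assumes x: "F x = 0" "isometric_frame Q (gr x)" and near: "\<And>p. p \<in> M \<Longrightarrow> dist z (J x) \<le> dist z p"
  shows "(z - J x) \<bullet> J (Q w) = 0"
proof -
  obtain \<gamma> where \<gamma>: "\<gamma> 0 = J x" "range \<gamma> \<subseteq> M" "(\<gamma> has_vector_derivative J (Q w)) (at 0)"
    by (rule tangent_vector_curve[OF x])
  have d: "((\<lambda>t. z - \<gamma> t) has_derivative (\<lambda>h. - (h *\<^sub>R J (Q w)))) (at 0)"
    using \<gamma>(3) unfolding has_vector_derivative_def by (auto intro!: derivative_eq_intros)
  have "((\<lambda>t. (z - \<gamma> t) \<bullet> (z - \<gamma> t)) has_derivative
      (\<lambda>h. (z - \<gamma> 0) \<bullet> (- (h *\<^sub>R J (Q w))) + (- (h *\<^sub>R J (Q w))) \<bullet> (z - \<gamma> 0))) (at 0)"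
    by (rule has_derivative_inner[OF d d])
  then have "((\<lambda>t. (z - \<gamma> t) \<bullet> (z - \<gamma> t)) has_real_derivative - 2 * ((z - J x) \<bullet> J (Q w))) (at 0)"
    unfolding has_field_derivative_def \<gamma>(1)
    by (rule has_derivative_eq_rhs) (auto simp: inner_commute)
  note D = this
  have m: "(z - \<gamma> 0) \<bullet> (z - \<gamma> 0) \<le> (z - \<gamma> t) \<bullet> (z - \<gamma> t)" for t
    using near[of "\<gamma> t"] \<gamma>(2) unfolding \<gamma>(1)
    by (auto simp: dist_norm power2_norm_eq_inner[symmetric] intro!: power_mono)
  have "- 2 * ((z - J x) \<bullet> J (Q w)) = 0"
    by (rule DERIV_local_min[OF D, of 1]) (use m in auto)
  then show ?thesis by simp
qed

text \<open>
  Federer's argument. If \<open>q1\<close> and \<open>q2\<close> are two nearest points of \<open>z\<close>, at distance \<open>\<rho>\<close>, then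
  expanding \<open>(norm (z - q2))\<^sup>2\<close> around \<open>q1\<close> gives
  \<open>(norm (q2 - q1))\<^sup>2 = 2 * ((z - q1) \<bullet> (q2 - q1))\<close>. As \<open>z - q1\<close> is orthogonal to the tangent space, only
  the normal component \<open>l\<close> of \<open>q2 - q1\<close> contributes, and the second order bound on \<open>F\<close> gives
  \<open>a * \<bar>l\<bar> \<le> B / 2 * (norm (q2 - q1))\<^sup>2\<close>. Together this forces \<open>\<rho> \<ge> a / B\<close>. The argument allows
  \<open>z - q1\<close> to have components outside the span of the hypersurface.
\<close>

theorem reach_ge:
  assumes dim: "DIM('e) = CARD('d::finite) + 1" and cM: "compact M"
  shows "ereal (a / B) \<le> reach E M"
  unfolding reach_def
proof (rule Sup_upper, rule CollectI, intro exI[of _ "a / B"] conjI refl ballI)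
  show "0 \<le> a / B" using pos by simp
  fix z assume z: "z \<in> E \<inter> (\<Union>p\<in>M. ball p (a / B))"
  then obtain p0 where p0: "p0 \<in> M" "dist z p0 < a / B" by (auto simp: dist_commute)
  have "\<exists>q\<in>M. \<forall>p\<in>M. dist z q \<le> dist z p"
  proof (rule continuous_attains_inf[OF cM])
    show "continuous_on M (\<lambda>p. dist z p)" by (intro continuous_intros)
  qed (use p0(1) in auto)
  moreover have "q1 = q2" if q: "q1 \<in> M \<and> (\<forall>p\<in>M. dist z q1 \<le> dist z p)" "q2 \<in> M \<and> (\<forall>p\<in>M. dist z q2 \<le> dist z p)" for q1 q2
  proof (rule ccontr)
    assume ne: "q1 \<noteq> q2"
    obtain x y where xy: "q1 = J x" "F x = 0" "q2 = J y" "F y = 0" using q unfolding M_def by blast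
    obtain Q :: "real^'d \<Rightarrow> 'e" where Q: "isometric_frame Q (gr x)"
      using isometric_frame_exists[OF gr_nonzero[OF xy(2)] dim] by blast
    define \<rho> where "\<rho> = dist z q1"
    have \<rho>: "\<rho> < a / B" using q(1) p0 unfolding \<rho>_def by force
    have \<rho>0: "0 \<le> \<rho>" by (simp add: \<rho>_def)
    have \<rho>2: "dist z q2 = \<rho>" unfolding \<rho>_def using q by (intro antisym) auto
    define l where "l = \<nu> x \<bullet> (y - x)"
    note n = normal_facts[OF xy(2)]
    have "gr x \<bullet> (y - x - l *\<^sub>R \<nu> x) = 0"
      unfolding n(5) by (simp add: l_def inner_diff_right n(2))
    then obtain w where w: "y - x - l *\<^sub>R \<nu> x = Q w" using Q unfolding isometric_frame_def by blast
    have yx: "y - x = Q w + l *\<^sub>R \<nu> x" using w by (simp add: algebra_simps)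
    have J': "q2 - q1 = J (Q w) + l *\<^sub>R J (\<nu> x)"
      unfolding xy(1,3) by (simp add: linear_diff[OF J(1), symmetric] yx linear_add[OF J(1)] linear_cmul[OF J(1)])
    have orth: "(z - q1) \<bullet> J (Q w) = 0"
      unfolding xy(1) by (rule nearest_orthogonal[OF xy(2) Q]) (use q xy(1) in auto)
    have "(norm (z - q2))\<^sup>2 = (norm (z - q1))\<^sup>2 - 2 * ((z - q1) \<bullet> (q2 - q1)) + (norm (q2 - q1))\<^sup>2"
      unfolding power2_norm_eq_inner by (simp add: inner_diff_left inner_diff_right inner_commute)
    then have "(norm (q2 - q1))\<^sup>2 = 2 * ((z - q1) \<bullet> (q2 - q1))"
      using \<rho>2 unfolding \<rho>_def dist_norm by simp
    also have "\<dots> = 2 * (l * ((z - q1) \<bullet> J (\<nu> x)))" unfolding J' by (simp add: inner_add_right orth)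
    also have "\<dots> \<le> 2 * (\<bar>l\<bar> * \<rho>)"
    proof -
      have "\<bar>(z - q1) \<bullet> J (\<nu> x)\<bar> \<le> \<rho>"
        using Cauchy_Schwarz_ineq2[of "z - q1" "J (\<nu> x)"] n(1) by (simp add: J(2) \<rho>_def dist_norm)
      then have "\<bar>l * ((z - q1) \<bullet> J (\<nu> x))\<bar> \<le> \<bar>l\<bar> * \<rho>" unfolding abs_mult by (intro mult_left_mono) auto
      then show ?thesis by linarith
    qed
    finally have 1: "(norm (q2 - q1))\<^sup>2 \<le> 2 * (\<bar>l\<bar> * \<rho>)" .
    have nq: "norm (q2 - q1) = norm (y - x)"
      unfolding xy(1,3) by (simp add: linear_diff[OF J(1), symmetric] J(2))
    have "a * \<bar>l\<bar> \<le> norm (gr x) * \<bar>l\<bar>" using nondeg[OF xy(2)] by (intro mult_right_mono) auto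
    also have "\<dots> = \<bar>gr x \<bullet> (y - x)\<bar>" unfolding l_def by (subst n(4)) (simp add: abs_mult)
    also have "\<dots> \<le> B / 2 * (norm (y - x))\<^sup>2" using second_order_bound[of y x] xy(2,4) by simp
    finally have 2: "a * \<bar>l\<bar> \<le> B / 2 * (norm (q2 - q1))\<^sup>2" by (simp add: nq)
    have npos: "0 < (norm (q2 - q1))\<^sup>2" using ne by simp
    have lpos: "0 < \<bar>l\<bar>" using 1 npos by (cases "l = 0") auto
    have "\<rho> * B < a" using \<rho> pos by (simp add: field_simps)
    then have "\<bar>l\<bar> * (\<rho> * B) < \<bar>l\<bar> * a" using lpos by (intro mult_strict_left_mono) auto
    also have "\<dots> \<le> B / 2 * (norm (q2 - q1))\<^sup>2" using 2 by (simp add: mult.commute)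
    also have "\<dots> \<le> B / 2 * (2 * (\<bar>l\<bar> * \<rho>))" using 1 pos by (intro mult_left_mono) auto
    finally show False by (simp add: mult_ac)
  qed
  ultimately show "\<exists>!q. q \<in> M \<and> (\<forall>p\<in>M. dist z q \<le> dist z p)" by blast
qed

text \<open>
  The image of the graph chart is cut out of \<open>M\<close> by a tube: uniqueness of the height over \<open>v\<close>
  shows that no other sheet of \<open>M\<close> enters it.
\<close>

lemma graph_image:
  fixes Q :: "'c::euclidean_space \<Rightarrow> 'e"
  assumes x: "F x = 0" "isometric_frame Q (gr x)" and s: "is_graph x Q s"
  defines "\<phi> \<equiv> \<lambda>v. J x + J (Q v) + s v *\<^sub>R J (\<nu> x)"
    and "h \<equiv> \<lambda>y. (y - J x) \<bullet> J (\<nu> x)"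
  shows "\<phi> ` ball 0 r = M \<inter> {y. \<bar>h y\<bar> < r \<and> norm (y - J x - h y *\<^sub>R J (\<nu> x)) < r}"
    and "\<And>v. h (\<phi> v) = s v"
proof -
  note n = normal_facts[OF x(1)]
  have nQ: "\<nu> x \<bullet> Q v = 0" for v using frameD(3)[OF x(2), of v] n(5) by simp
  show h\<phi>: "h (\<phi> v) = s v" for v
  proof -
    have "h (\<phi> v) = (J (Q v) + s v *\<^sub>R J (\<nu> x)) \<bullet> J (\<nu> x)" by (simp add: h_def \<phi>_def)
    also have "\<dots> = Q v \<bullet> \<nu> x + s v * (\<nu> x \<bullet> \<nu> x)" by (simp only: inner_add_left inner_scaleR_left J_inner)
    finally show ?thesis using nQ[of v] n(2) by (simp add: inner_commute)
  qed
  show "\<phi> ` ball 0 r = M \<inter> {y. \<bar>h y\<bar> < r \<and> norm (y - J x - h y *\<^sub>R J (\<nu> x)) < r}" (is "_ = M \<inter> ?W")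
  proof (intro equalityI subsetI)
    fix y assume "y \<in> \<phi> ` ball 0 r"
    then obtain v where v: "norm v < r" "y = \<phi> v" by auto
    have "\<phi> v \<in> M" unfolding \<phi>_def chart_eq M_def using graphD(2)[OF s v(1)] by blast
    moreover have "norm (\<phi> v - J x - s v *\<^sub>R J (\<nu> x)) = norm v"
      unfolding \<phi>_def by (simp add: J(2) frameD(2)[OF x(2)])
    ultimately show "y \<in> M \<inter> ?W" using graphD(1)[OF s v(1)] v by (simp add: h\<phi>)
  next
    fix y assume y: "y \<in> M \<inter> ?W"
    then obtain u where u: "y = J u" "F u = 0" unfolding M_def by blast
    have hy: "h y = (u - x) \<bullet> \<nu> x"
      by (simp add: h_def u linear_diff[OF J(1), symmetric] J_inner)
    have "gr x \<bullet> (u - x - h y *\<^sub>R \<nu> x) = 0"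
      unfolding n(5) by (simp add: hy inner_diff_right n(2) inner_commute inner_diff_left)
    then obtain v where v: "u - x - h y *\<^sub>R \<nu> x = Q v" using x(2) unfolding isometric_frame_def by blast
    have e: "y - J x - h y *\<^sub>R J (\<nu> x) = J (Q v)"
      unfolding v[symmetric] u by (simp add: linear_diff[OF J(1)] linear_cmul[OF J(1)])
    have "norm (y - J x - h y *\<^sub>R J (\<nu> x)) < r" "\<bar>h y\<bar> < r" using y by blast+
    then have nv: "norm v < r" and hr: "\<bar>h y\<bar> < r" unfolding e by (simp_all add: J(2) frameD(2)[OF x(2)])
    have u': "u = pt x Q v (h y)" unfolding pt_def v[symmetric] by simp
    have "F (pt x Q v (h y)) = 0" unfolding u'[symmetric] by (rule u(2))
    then have hs: "h y = s v" by (rule graphD(3)[OF s nv hr])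
    have "y = J (pt x Q v (h y))" unfolding u'[symmetric] by (rule u(1))
    also have "\<dots> = \<phi> v" unfolding \<phi>_def chart_eq by (simp only: hs)
    finally have "y = \<phi> v" .
    then show "y \<in> \<phi> ` ball 0 r" using nv by auto
  qed
qed

lemma graph_local_param:
  fixes Q :: "real^'d::finite \<Rightarrow> 'e"
  assumes x: "F x = 0" "isometric_frame Q (gr x)" and s: "is_graph x Q s" and k: "Ck_on k (ball 0 r) s"
  defines "\<phi> \<equiv> \<lambda>v. J x + J (Q v) + s v *\<^sub>R J (\<nu> x)"
  shows "local_param k M (ball 0 r) \<phi>" and "inj_on \<phi> (ball 0 r)"
    and "\<And>v. norm v < r \<Longrightarrow> frechet_derivative \<phi> (at v) =
       (\<lambda>h. J (Q h) + frechet_derivative s (at v) h *\<^sub>R J (\<nu> x))"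
proof -
  define h where "h = (\<lambda>y. (y - J x) \<bullet> J (\<nu> x))"
  have im: "\<phi> ` ball 0 r = M \<inter> {y. \<bar>h y\<bar> < r \<and> norm (y - J x - h y *\<^sub>R J (\<nu> x)) < r}"
    unfolding \<phi>_def h_def by (rule graph_image(1)[OF x s])
  have h\<phi>: "h (\<phi> v) = s v" for v unfolding \<phi>_def h_def by (rule graph_image(2)[OF x s])
  have JQ: "linear (\<lambda>v. J (Q v))" "\<And>v. norm (J (Q v)) = norm v"
    using linear_compose[OF frameD(1)[OF x(2)] J(1)] by (simp_all add: o_def J(2) frameD(2)[OF x(2)])
  note blJQ = isometry_bounded_linear[OF JQ]
  obtain L where L: "bounded_linear L" "\<And>v. L (J (Q v)) = v"
    using bounded_left_inverse[OF JQ(1) isometry_inj[OF JQ]] by blast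
  define g where "g = (\<lambda>y. L (y - J x - h y *\<^sub>R J (\<nu> x)))"
  have g\<phi>: "g (\<phi> v) = v" for v unfolding g_def h\<phi> by (simp add: \<phi>_def L(2))
  have contg: "continuous_on UNIV g" unfolding g_def h_def
    by (intro bounded_linear.continuous_on[OF L(1)] continuous_intros)
  show inj: "inj_on \<phi> (ball 0 r)" by (rule inj_on_inverseI[of _ g]) (rule g\<phi>)
  have Ck: "Ck_on k (ball 0 r) \<phi>"
  proof -
    have "Ck_on k (ball 0 r) (\<lambda>v. J (Q v) + s v *\<^sub>R J (\<nu> x))"
      by (rule Ck_on_linear_combination[OF open_ball Ck_on_id k blJQ bounded_linear_scaleR_left])
    from Ck_on_linear_combination[OF open_ball Ck_on_const[of k _ "J x"] this bounded_linear_ident bounded_linear_ident]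
    show ?thesis by (simp add: \<phi>_def add.assoc)
  qed
  have cont: "continuous_on (ball 0 r) \<phi>"
    unfolding \<phi>_def
    by (intro continuous_on_add continuous_on_scaleR continuous_on_const graph_continuous[OF x s]
        linear_continuous_on[OF blJQ])
  have d\<phi>: "(\<phi> has_derivative (\<lambda>h. J (Q h) + frechet_derivative s (at v) h *\<^sub>R J (\<nu> x))) (at v)" if v: "norm v < r" for v
  proof -
    have "s differentiable (at v)"
      using graph_has_derivative[OF x s v] unfolding differentiable_def by blast
    then have "(s has_derivative frechet_derivative s (at v)) (at v)"
      by (simp add: frechet_derivative_works)
    from has_derivative_add[OF has_derivative_add[OF has_derivative_const[of "J x"]
        bounded_linear_imp_has_derivative[OF blJQ]] has_derivative_scaleR_left[OF this]]
    show ?thesis unfolding \<phi>_def by simp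
  qed
  then show d\<phi>': "\<And>v. norm v < r \<Longrightarrow> frechet_derivative \<phi> (at v) =
       (\<lambda>h. J (Q h) + frechet_derivative s (at v) h *\<^sub>R J (\<nu> x))"
    by (rule frechet_derivative_at[symmetric])
  have injd: "inj (frechet_derivative \<phi> (at v))" if v: "v \<in> ball 0 r" for v
  proof -
    have nv: "norm v < r" using v by simp
    have lin: "linear (frechet_derivative \<phi> (at v))"
      unfolding d\<phi>'[OF nv] by (rule has_derivative_linear[OF d\<phi>[OF nv]])
    show ?thesis
    proof (subst linear_injective_0[OF lin], intro allI impI)
      fix w assume "frechet_derivative \<phi> (at v) w = 0"
      then have 0: "J (Q w) + frechet_derivative s (at v) w *\<^sub>R J (\<nu> x) = 0" using d\<phi>'[OF nv] by simp
      have "J (\<nu> x) \<bullet> J (Q w) = 0" using frameD(3)[OF x(2), of w] normal_facts(5)[OF x(1)] by (simp add: J_inner)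
      then have "J (Q w) \<bullet> J (Q w) = J (Q w) \<bullet> (J (Q w) + frechet_derivative s (at v) w *\<^sub>R J (\<nu> x))"
        by (simp add: inner_add_right inner_commute)
      then have "J (Q w) = 0" using 0 by simp
      then show "w = 0" using JQ(2)[of w] by simp
    qed
  qed
  have op: "openin (top_of_set M) (\<phi> ` ball 0 r)"
  proof -
    have "open {y. \<bar>h y\<bar> < r \<and> norm (y - J x - h y *\<^sub>R J (\<nu> x)) < r}"
      unfolding h_def by (intro open_Collect_conj open_Collect_less continuous_intros)
    then show ?thesis unfolding im by (rule openin_open_Int)
  qed
  have "homeomorphism (ball 0 r) (\<phi> ` ball 0 r) \<phi> g"
    unfolding homeomorphism_def using cont continuous_on_subset[OF contg] g\<phi> by (auto simp: image_image)
  then show "local_param k M (ball 0 r) \<phi>"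
    unfolding local_param_def using Ck injd op by auto
qed

lemma graph_graph_param:
  fixes Q :: "real^'d::finite \<Rightarrow> 'e"
  assumes x: "F x = 0" "isometric_frame Q (gr x)" and s: "is_graph x Q s" and k: "Ck_on k (ball 0 r) s"
    and k2: "2 \<le> k" and E: "range J \<subseteq> E"
    and C: "\<And>v hs. norm v < r \<Longrightarrow> length hs \<le> k \<Longrightarrow> (\<forall>h\<in>set hs. norm h \<le> 1) \<Longrightarrow> \<bar>iter_deriv hs s v\<bar> \<le> C"
    and Lp: "1 / (4 * Lperp) \<le> r" "C \<le> Lperp" "\<And>i. i \<in> {3..k} \<Longrightarrow> C \<le> L i"
  shows "graph_param k Lperp L E M (J x) (\<lambda>v. J (Q v)) r (\<lambda>v. s v *\<^sub>R J (\<nu> x))"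
proof -
  note lp = graph_local_param[OF x s k]
  have "linear (\<lambda>v. J (Q v))" "\<And>v. norm (J (Q v)) = norm v"
    using linear_compose[OF frameD(1)[OF x(2)] J(1)] by (simp_all add: o_def J(2) frameD(2)[OF x(2)])
  moreover have "range (\<lambda>v. J (Q v)) = tangent_space M (J x)" by (rule tangent_space_eq[OF x, symmetric])
  moreover have "openin (top_of_set M) ((\<lambda>v. J x + J (Q v) + s v *\<^sub>R J (\<nu> x)) ` ball 0 r)"
    using lp(1) unfolding local_param_def by blast
  moreover have "(\<lambda>v. s v *\<^sub>R J (\<nu> x)) ` ball 0 r \<subseteq> E"
    using E by (auto simp: linear_cmul[OF J(1), symmetric])
  moreover have bl0: "bounded_linear (\<lambda>_::real. 0 :: 'a)" by (rule bounded_linear_zero)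
  have "Ck_on k (ball 0 r) (\<lambda>v. s v *\<^sub>R J (\<nu> x))"
    using Ck_on_linear_combination[OF open_ball k Ck_on_const[of k _ 0] bounded_linear_scaleR_left[of "J (\<nu> x)"] bl0] by simp
  moreover have "s 0 *\<^sub>R J (\<nu> x) = 0" by (simp add: graph_at_0[OF x s])
  moreover have "((\<lambda>v. s v *\<^sub>R J (\<nu> x)) has_derivative (\<lambda>_. 0)) (at 0)"
  proof -
    have "pt x Q 0 0 = x" by (simp add: pt_def linear_0[OF frameD(1)[OF x(2)]])
    then have "(s has_derivative (\<lambda>h. 0)) (at 0)"
      using graph_has_derivative[OF x s, of 0] r_pos by (simp add: graph_at_0[OF x s] frameD(3)[OF x(2)])
    then show ?thesis by (auto intro!: derivative_eq_intros)
  qed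
  moreover have bd: "deriv_opnorm i (\<lambda>v. s v *\<^sub>R J (\<nu> x)) v \<le> C" if v: "v \<in> ball 0 r" and i: "i \<le> k" for v i
    unfolding deriv_opnorm_def
  proof (rule cSUP_least)
    have "replicate i 0 \<in> {hs. length hs = i \<and> (\<forall>h\<in>set hs. norm (h::real^'d) \<le> 1)}" by auto
    then show "{hs. length hs = i \<and> (\<forall>h\<in>set hs. norm (h::real^'d) \<le> 1)} \<noteq> {}" by blast
    fix hs :: "(real^'d) list" assume hs: "hs \<in> {hs. length hs = i \<and> (\<forall>h\<in>set hs. norm h \<le> 1)}"
    have "iter_deriv hs (\<lambda>v. s v *\<^sub>R J (\<nu> x)) v = iter_deriv hs s v *\<^sub>R J (\<nu> x)"
      using iter_deriv_linear_combination[OF open_ball k Ck_on_const[of k _ 0] bounded_linear_scaleR_left[of "J (\<nu> x)"] bl0, of hs v]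
        hs i v by simp
    then show "norm (iter_deriv hs (\<lambda>v. s v *\<^sub>R J (\<nu> x)) v) \<le> C"
      using C[of v hs] hs i v normal_facts(1)[OF x(1)] by (simp add: J(2))
  qed
  have "deriv_opnorm 2 (\<lambda>v. s v *\<^sub>R J (\<nu> x)) v \<le> Lperp \<and>
       (\<forall>i\<in>{3..k}. deriv_opnorm i (\<lambda>v. s v *\<^sub>R J (\<nu> x)) v \<le> L i)" if "v \<in> ball 0 r" for v
    using bd[OF that] Lp(2,3) k2 by (meson atLeastAtMost_iff order_trans)
  ultimately show ?thesis
    unfolding graph_param_def using Lp(1) lp(2) by blast
qed

end

end

section \<open>Implicit functions depending on parameters\<close>

lemma Cb_inner_square:
  fixes U :: "'i \<Rightarrow> 'a::euclidean_space set"
  assumes op: "\<forall>i\<in>I. open (U i)" and "\<And>i x. i \<in> I \<Longrightarrow> x \<in> U i \<Longrightarrow> norm x \<le> B"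
  shows "Cb k I U (\<lambda>i x. x \<bullet> x)"
proof -
  have "Cb k I U (\<lambda>i x. \<Sum>b\<in>Basis. (x \<bullet> b) * (x \<bullet> b))"
  proof (intro Cb_sum Cb_mult op finite_Basis)
    fix b :: 'a assume "b \<in> Basis"
    then show "Cb k I U (\<lambda>i x. x \<bullet> b)" "Cb k I U (\<lambda>i x. x \<bullet> b)"
      by (intro Cb_inner[OF op assms(2), where C = 1]; simp)+
  qed
  then show ?thesis by (simp add: euclidean_inner[symmetric])
qed

text \<open>
  The derivative of the implicit function \<open>s\<close> is a quotient of first derivatives of \<open>F\<close> at the
  graph point \<open>g i v\<close>. If \<open>s\<close> is bounded in \<open>C\<^sup>j\<close> with \<open>j < k\<close>, then so are \<open>g\<close>, these derivatives at \<open>g\<close>, and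
  their quotient, whose denominator is at least \<open>c\<close>; hence \<open>s\<close> is bounded in \<open>C\<close> of order \<open>j + 1\<close>. The
  induction stops at \<open>j = k\<close>, when the derivatives of \<open>F\<close> are exhausted.
\<close>

lemma Cb_implicit_graph:
  fixes F :: "'i \<Rightarrow> 'e::euclidean_space \<Rightarrow> real" and gr :: "'i \<Rightarrow> 'e \<Rightarrow> 'e" and x n :: "'i \<Rightarrow> 'e"
    and Q :: "'i \<Rightarrow> 'c::euclidean_space \<Rightarrow> 'e" and s :: "'i \<Rightarrow> 'c \<Rightarrow> real"
  defines "g \<equiv> \<lambda>i v. x i + Q i v + s i v *\<^sub>R n i"
  assumes F: "Cb k I (\<lambda>_. ball 0 R) F"
    and gr: "\<And>i y. i \<in> I \<Longrightarrow> (F i has_derivative (\<lambda>h. gr i y \<bullet> h)) (at y)"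
    and Q: "\<And>i. i \<in> I \<Longrightarrow> linear (Q i)" "\<And>i v. i \<in> I \<Longrightarrow> norm (Q i v) = norm v"
    and n: "\<And>i. i \<in> I \<Longrightarrow> norm (n i) = 1" and x: "\<And>i. i \<in> I \<Longrightarrow> norm (x i) \<le> R"
    and s: "\<And>i v. i \<in> I \<Longrightarrow> v \<in> ball 0 \<rho> \<Longrightarrow> \<bar>s i v\<bar> \<le> \<rho>"
    and g: "\<And>i v. i \<in> I \<Longrightarrow> v \<in> ball 0 \<rho> \<Longrightarrow> g i v \<in> ball 0 R"
    and der: "\<And>i v. i \<in> I \<Longrightarrow> v \<in> ball 0 \<rho> \<Longrightarrow>
       (s i has_derivative (\<lambda>h. - (gr i (g i v) \<bullet> Q i h) / (gr i (g i v) \<bullet> n i))) (at v)"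
    and c: "0 < c" "\<And>i v. i \<in> I \<Longrightarrow> v \<in> ball 0 \<rho> \<Longrightarrow> c \<le> gr i (g i v) \<bullet> n i"
  shows "Cb k I (\<lambda>_. ball 0 \<rho>) s"
proof -
  have op: "\<forall>i\<in>I. open (ball (0::'c) \<rho>)" by simp
  have opR: "\<forall>i\<in>I. open (ball (0::'e) R)" by simp
  have bd: "\<exists>B. \<forall>i\<in>I. \<forall>v\<in>ball 0 \<rho>. \<bar>s i v\<bar> \<le> B" using s by blast
  have bas: "\<bar>y \<bullet> b\<bar> \<le> norm y" if "b \<in> Basis" for y b :: 'e using Basis_le_norm[OF that] .
  have const: "Cb j I U (\<lambda>i v. y i \<bullet> b)" if "\<And>i. i \<in> I \<Longrightarrow> norm (y i) \<le> C" "b \<in> Basis"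
    for y :: "'i \<Rightarrow> 'e" and C b j and U :: "'i \<Rightarrow> 'c set"
    by (rule Cb_const[of _ _ C]) (use that bas order_trans in blast)
  have "Cb j I (\<lambda>_. ball 0 \<rho>) s" if "j \<le> k" for j
    using that
  proof (induction j)
    case 0
    have "continuous_on (ball 0 \<rho>) (s i)" if "i \<in> I" for i
      using der[OF that] has_derivative_continuous continuous_at_imp_continuous_on by blast
    then show ?case using bd by simp
  next
    case (Suc j)
    then have IH: "Cb j I (\<lambda>_. ball 0 \<rho>) s" by simp
    have gcomp: "Cb j I (\<lambda>_. ball 0 \<rho>) (\<lambda>i v. g i v \<bullet> b)" if b: "b \<in> Basis" for b
    proof -
      have "Cb j I (\<lambda>_. ball 0 \<rho>) (\<lambda>i v. x i \<bullet> b + (\<Sum>d\<in>Basis. (v \<bullet> d) * (Q i d \<bullet> b)) + s i v * (n i \<bullet> b))"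
      proof (intro Cb_add Cb_mult Cb_sum op finite_Basis IH)
        show "Cb j I (\<lambda>_. ball (0::'c) \<rho>) (\<lambda>i v. x i \<bullet> b)" by (rule const[OF x]) (use b in auto)
        show "Cb j I (\<lambda>_. ball (0::'c) \<rho>) (\<lambda>i v. n i \<bullet> b)" by (rule const[of n 1]) (use n b in auto)
        fix d :: 'c assume d: "d \<in> Basis"
        show "Cb j I (\<lambda>_. ball 0 \<rho>) (\<lambda>i v. v \<bullet> d)"
          by (rule Cb_inner[OF op, of \<rho> _ 1]) (use d in auto)
        show "Cb j I (\<lambda>_. ball (0::'c) \<rho>) (\<lambda>i v. Q i d \<bullet> b)"
          by (rule const[of "\<lambda>i. Q i d" 1]) (use Q d b in auto)
      qed
      then show ?thesis
      proof (rule Cb_cong[OF op, rotated])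
        fix i v assume i: "i \<in> I"
        have "Q i v = Q i (\<Sum>d\<in>Basis. (v \<bullet> d) *\<^sub>R d)" by (simp add: euclidean_representation)
        then have "Q i v \<bullet> b = (\<Sum>d\<in>Basis. (v \<bullet> d) * (Q i d \<bullet> b))"
          by (simp add: linear_sum[OF Q(1)[OF i]] linear_cmul[OF Q(1)[OF i]] inner_sum_left)
        then show "x i \<bullet> b + (\<Sum>d\<in>Basis. (v \<bullet> d) * (Q i d \<bullet> b)) + s i v * (n i \<bullet> b) = g i v \<bullet> b"
          by (simp add: g_def inner_add_left)
      qed
    qed
    obtain k' where k': "k = Suc k'" "j \<le> k'" using Suc.prems by (cases k) auto
    have grc: "Cb j I (\<lambda>_. ball 0 \<rho>) (\<lambda>i v. gr i (g i v) \<bullet> b)" if b: "b \<in> Basis" for b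
    proof (rule Cb_compose[where V = "\<lambda>_. ball 0 R" and f = "\<lambda>i y. gr i y \<bullet> b", OF op])
      have "Cb j I (\<lambda>_. ball 0 R) (\<lambda>i y. frechet_derivative (F i) (at y) b)"
        using Cb_mono[OF Cb_partial[OF F[unfolded k'(1)] b] k'(2)] .
      then show "Cb j I (\<lambda>_. ball 0 R) (\<lambda>i y. gr i y \<bullet> b)"
        by (rule Cb_cong[OF opR, rotated]) (use frechet_derivative_at[OF gr] in metis)
    qed (use gcomp g in auto)
    have inner_gr: "Cb j I (\<lambda>_. ball 0 \<rho>) (\<lambda>i v. gr i (g i v) \<bullet> y i)" if y: "\<And>i. i \<in> I \<Longrightarrow> norm (y i) \<le> 1" for y
    proof -
      have "Cb j I (\<lambda>_. ball 0 \<rho>) (\<lambda>i v. \<Sum>b\<in>Basis. (gr i (g i v) \<bullet> b) * (y i \<bullet> b))"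
        by (intro Cb_sum Cb_mult op finite_Basis grc const[of y 1] y)
      then show ?thesis by (simp add: euclidean_inner[symmetric])
    qed
    show ?case
    proof (rule Cb_SucI[OF op bd])
      show "(s i has_derivative (\<lambda>h. - (gr i (g i v) \<bullet> Q i h) / (gr i (g i v) \<bullet> n i))) (at v)"
        if "i \<in> I" "v \<in> ball 0 \<rho>" for i v by (rule der[OF that])
      fix d :: 'c assume d: "d \<in> Basis"
      have "Cb j I (\<lambda>_. ball 0 \<rho>) (\<lambda>i v. (- (gr i (g i v) \<bullet> Q i d)) * inverse (gr i (g i v) \<bullet> n i))"
      proof (intro Cb_mult Cb_minus op)
        show "Cb j I (\<lambda>_. ball 0 \<rho>) (\<lambda>i v. gr i (g i v) \<bullet> Q i d)" by (rule inner_gr) (use Q d in auto)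
        have "Cb j I (\<lambda>_. ball 0 \<rho>) (\<lambda>i v. gr i (g i v) \<bullet> n i)" by (rule inner_gr) (use n in auto)
        then show "Cb j I (\<lambda>_. ball 0 \<rho>) (\<lambda>i v. inverse (gr i (g i v) \<bullet> n i))"
          by (rule Cb_inverse[OF op _ c(1)]) (use c(2) in force)
      qed
      then show "Cb j I (\<lambda>_. ball 0 \<rho>) (\<lambda>i v. - (gr i (g i v) \<bullet> Q i d) / (gr i (g i v) \<bullet> n i))"
        by (simp add: divide_inverse)
    qed
  qed
  then show ?thesis by simp
qed

definition grad :: "('e::euclidean_space \<Rightarrow> real) \<Rightarrow> 'e \<Rightarrow> 'e" where
  "grad f x = (\<Sum>b\<in>Basis. frechet_derivative f (at x) b *\<^sub>R b)"

lemma has_derivative_grad: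
  assumes "f differentiable (at x)"
  shows "(f has_derivative (\<lambda>h. grad f x \<bullet> h)) (at x)"
proof -
  have d: "(f has_derivative frechet_derivative f (at x)) (at x)" using assms by (simp add: frechet_derivative_works)
  have lin: "linear (frechet_derivative f (at x))" by (rule has_derivative_linear[OF d])
  have "frechet_derivative f (at x) h = grad f x \<bullet> h" for h
  proof -
    have "frechet_derivative f (at x) h = frechet_derivative f (at x) (\<Sum>b\<in>Basis. (h \<bullet> b) *\<^sub>R b)"
      by (simp add: euclidean_representation)
    also have "\<dots> = (\<Sum>b\<in>Basis. (h \<bullet> b) * frechet_derivative f (at x) b)"
      by (simp add: linear_sum[OF lin] linear_cmul[OF lin])
    also have "\<dots> = grad f x \<bullet> h"
      unfolding grad_def inner_sum_left inner_scaleR_left by (simp add: inner_commute mult.commute)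
    finally show ?thesis .
  qed
  then have "frechet_derivative f (at x) = (\<lambda>h. grad f x \<bullet> h)" by blast
  then show ?thesis using d by simp
qed

lemma grad_norm_le: "norm (grad f x) \<le> (\<Sum>b\<in>Basis. \<bar>frechet_derivative f (at x) b\<bar>)"
proof -
  have "norm (grad f x) \<le> (\<Sum>b\<in>Basis. norm (frechet_derivative f (at x) b *\<^sub>R b))"
    unfolding grad_def by (rule norm_sum)
  also have "\<dots> = (\<Sum>b\<in>Basis. \<bar>frechet_derivative f (at x) b\<bar>)" by (rule sum.cong) auto
  finally show ?thesis .
qed

lemma uniform_bound_Basis:
  fixes f :: "'i \<Rightarrow> 'a::euclidean_space \<Rightarrow> 'x \<Rightarrow> real"
  assumes "\<And>b. b \<in> Basis \<Longrightarrow> \<exists>B. \<forall>i\<in>I. \<forall>x\<in>U i. \<bar>f i b x\<bar> \<le> B"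
  shows "\<exists>B\<ge>0. \<forall>i\<in>I. \<forall>x\<in>U i. (\<Sum>b\<in>Basis. \<bar>f i b x\<bar>) \<le> B"
proof -
  obtain B where B: "\<And>b i x. b \<in> Basis \<Longrightarrow> i \<in> I \<Longrightarrow> x \<in> U i \<Longrightarrow> \<bar>f i b x\<bar> \<le> B b"
    using assms by metis
  show ?thesis
  proof (intro exI[of _ "\<Sum>b\<in>(Basis::'a set). \<bar>B b\<bar>"] conjI ballI)
    fix i x assume "i \<in> I" "x \<in> U i"
    then show "(\<Sum>b\<in>Basis. \<bar>f i b x\<bar>) \<le> (\<Sum>b\<in>Basis. \<bar>B b\<bar>)"
      by (intro sum_mono) (use B in force)
  qed (simp add: sum_nonneg)
qed

lemma Cb_lipschitz:
  fixes f :: "'i \<Rightarrow> 'a::euclidean_space \<Rightarrow> real"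
  assumes f: "Cb (Suc k) I (\<lambda>_. UNIV) f"
  shows "\<exists>C\<ge>0. \<forall>i\<in>I. \<forall>x y. \<bar>f i x - f i y\<bar> \<le> C * norm (x - y)"
proof -
  have "\<exists>C\<ge>0. \<forall>i\<in>I. \<forall>x\<in>UNIV. (\<Sum>b\<in>Basis. \<bar>frechet_derivative (f i) (at x) b\<bar>) \<le> C"
    by (rule uniform_bound_Basis) (rule Cb_bounded[OF Cb_partial[OF f]])
  then obtain C where C: "C \<ge> 0" "\<And>i x. i \<in> I \<Longrightarrow> (\<Sum>b\<in>Basis. \<bar>frechet_derivative (f i) (at x) b\<bar>) \<le> C" by blast
  have "\<bar>f i x - f i y\<bar> \<le> C * norm (x - y)" if i: "i \<in> I" for i x y
  proof -
    have "norm (f i x - f i y) \<le> C * norm (x - y)"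
    proof (rule differentiable_bound[of UNIV])
      fix x
      show "(f i has_derivative (\<lambda>h. grad (f i) x \<bullet> h)) (at x within UNIV)"
        by (rule has_derivative_at_withinI, rule has_derivative_grad, rule Cb_differentiable[OF f i]) simp
      have "norm (grad (f i) x) \<le> C" using grad_norm_le C(2)[OF i] order_trans by blast
      then have "norm (grad (f i) x \<bullet> h) \<le> C * norm h" for h
        using Cauchy_Schwarz_ineq2[of "grad (f i) x" h] mult_right_mono[of "norm (grad (f i) x)" C "norm h"] by simp
      then show "onorm (\<lambda>h. grad (f i) x \<bullet> h) \<le> C" by (rule onorm_le)
    qed auto
    then show ?thesis by simp
  qed
  then show ?thesis using C(1) by blast
qed

lemma Cb_grad_bounds:
  fixes W :: "'i \<Rightarrow> 'a::euclidean_space \<Rightarrow> real"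
  assumes W: "Cb (Suc (Suc k)) I (\<lambda>_. UNIV) W"
  obtains C where "0 < C" "\<And>i x. i \<in> I \<Longrightarrow> \<bar>W i x\<bar> \<le> C" "\<And>i x. i \<in> I \<Longrightarrow> norm (grad (W i) x) \<le> C"
    "\<And>i x y. i \<in> I \<Longrightarrow> norm (grad (W i) x - grad (W i) y) \<le> C * norm (x - y)"
    "\<And>i x. i \<in> I \<Longrightarrow> (W i has_derivative (\<lambda>h. grad (W i) x \<bullet> h)) (at x)"
proof -
  obtain C0 where C0: "\<And>i x. i \<in> I \<Longrightarrow> \<bar>W i x\<bar> \<le> C0" using Cb_bounded[OF W] by auto
  have "\<exists>C\<ge>0. \<forall>i\<in>I. \<forall>x\<in>UNIV. (\<Sum>b\<in>Basis. \<bar>frechet_derivative (W i) (at x) b\<bar>) \<le> C"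
    by (rule uniform_bound_Basis) (rule Cb_bounded[OF Cb_partial[OF W]])
  then obtain C1 where C1: "C1 \<ge> 0" "\<And>i x. i \<in> I \<Longrightarrow> (\<Sum>b\<in>Basis. \<bar>frechet_derivative (W i) (at x) b\<bar>) \<le> C1" by blast
  have "\<exists>C\<ge>0. \<forall>i\<in>I. \<forall>x y. \<bar>frechet_derivative (W i) (at x) b - frechet_derivative (W i) (at y) b\<bar> \<le> C * norm (x - y)"
    if "b \<in> Basis" for b by (rule Cb_lipschitz[OF Cb_partial[OF W that]])
  then obtain L where L: "\<And>b. b \<in> Basis \<Longrightarrow> L b \<ge> 0" "\<And>b i x y. b \<in> Basis \<Longrightarrow> i \<in> I \<Longrightarrow>
      \<bar>frechet_derivative (W i) (at x) b - frechet_derivative (W i) (at y) b\<bar> \<le> L b * norm (x - y)" by metis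
  define C where "C = 1 + \<bar>C0\<bar> + C1 + (\<Sum>b\<in>(Basis::'a set). L b)"
  have Ls: "0 \<le> (\<Sum>b\<in>(Basis::'a set). L b)" using L(1) by (intro sum_nonneg) auto
  show ?thesis
  proof (rule that[of C])
    show "0 < C" using C1(1) Ls by (simp add: C_def)
    show "\<bar>W i x\<bar> \<le> C" if "i \<in> I" for i x using C0[OF that, of x] C1(1) Ls by (simp add: C_def)
    show "norm (grad (W i) x) \<le> C" if "i \<in> I" for i x
      using grad_norm_le[of "W i" x] C1(2)[OF that, of x] Ls by (simp add: C_def)
    show "(W i has_derivative (\<lambda>h. grad (W i) x \<bullet> h)) (at x)" if "i \<in> I" for i x
      by (rule has_derivative_grad) (use Cb_differentiable[OF W that] in simp)
    show "norm (grad (W i) x - grad (W i) y) \<le> C * norm (x - y)" if i: "i \<in> I" for i x y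
    proof -
      have "grad (W i) x - grad (W i) y = (\<Sum>b\<in>Basis. (frechet_derivative (W i) (at x) b - frechet_derivative (W i) (at y) b) *\<^sub>R b)"
        unfolding grad_def by (simp add: sum_subtractf scaleR_diff_left)
      also have "norm \<dots> \<le> (\<Sum>b\<in>Basis. norm ((frechet_derivative (W i) (at x) b - frechet_derivative (W i) (at y) b) *\<^sub>R b))"
        by (rule norm_sum)
      also have "\<dots> \<le> (\<Sum>b\<in>Basis. L b * norm (x - y))"
        by (rule sum_mono) (use L(2)[OF _ i] in auto)
      also have "\<dots> = (\<Sum>b\<in>(Basis::'a set). L b) * norm (x - y)" by (simp add: sum_distrib_right)
      also have "\<dots> \<le> C * norm (x - y)"
        using C1(1) by (intro mult_right_mono) (auto simp: C_def)
      finally show ?thesis .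
    qed
  qed
qed

subsection \<open>A bump below the squared norm\<close>

text \<open>
  With \<open>t = y \<bullet> y\<close> this is \<open>t * (4 * t * max 0 (1 - t)) ^ Suc k\<close>. The second factor lies
  between \<open>0\<close> and \<open>1\<close> and equals \<open>1\<close> exactly at \<open>t = 1 / 2\<close>, and the exponent makes the cut-off
  at \<open>t = 1\<close> a function of class \<open>C\<^sup>k\<close>.
\<close>

definition bump :: "nat \<Rightarrow> 'e::euclidean_space \<Rightarrow> real" where
  "bump k y = (y \<bullet> y) * (4 * (y \<bullet> y)) ^ Suc k * max 0 (1 - y \<bullet> y) ^ Suc k"

lemma bump_nonneg: "0 \<le> bump k y" unfolding bump_def by simp

lemma bump_le: "bump k y \<le> y \<bullet> y"
proof -
  let ?t = "y \<bullet> y"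
  have t: "0 \<le> ?t" by simp
  have "4 * ?t * max 0 (1 - ?t) \<le> 1"
  proof (cases "?t \<le> 1")
    case True
    have "0 \<le> (1 - 2 * ?t)\<^sup>2" by simp
    then have "4 * ?t * (1 - ?t) \<le> 1" by (simp add: power2_eq_square algebra_simps)
    then show ?thesis using True by simp
  qed simp
  then have "(4 * ?t * max 0 (1 - ?t)) ^ Suc k \<le> 1" by (intro power_le_one) auto
  from mult_left_mono[OF this t] show ?thesis
    by (simp add: bump_def power_mult_distrib mult.assoc del: power_Suc)
qed

lemma bump_eq: "y \<bullet> y = 1 / 2 \<Longrightarrow> bump k y = y \<bullet> y"
proof -
  assume "y \<bullet> y = 1 / 2"
  moreover have "bump k y = (y \<bullet> y) * (4 * (y \<bullet> y) * max 0 (1 - y \<bullet> y)) ^ Suc k"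
    unfolding bump_def by (simp only: power_mult_distrib mult.assoc)
  moreover have "4 * (1 / 2) * max 0 (1 - 1 / 2) = (1 :: real)" by simp
  ultimately show ?thesis by (simp only: power_one mult_1_right)
qed

lemma bump_zero: "1 \<le> norm y \<Longrightarrow> bump k y = 0"
proof -
  assume "1 \<le> norm y"
  then have "1 \<le> y \<bullet> y" by (simp add: power2_norm_eq_inner[symmetric])
  then show ?thesis by (simp add: bump_def)
qed

lemma Cb_bump: "Cb k {()} (\<lambda>_. UNIV) (\<lambda>_. bump k :: 'e::euclidean_space \<Rightarrow> real)"
proof (rule Cb_extend_zero)
  have op: "\<forall>i\<in>{()}. open (ball (0::'e) 2)" by simp
  have sq: "Cb k {()} (\<lambda>_. ball (0::'e) 2) (\<lambda>_ y. y \<bullet> y)"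
    by (rule Cb_inner_square[OF op, of 2]) auto
  have "Cb k {()} (\<lambda>_. ball (0::'e) 2) (\<lambda>_ y. 1 + - (y \<bullet> y))"
    by (rule Cb_add[OF op Cb_const[of _ _ 1] Cb_minus[OF op sq]]) simp
  from Cb_pos_power[OF op this, of 0]
  have p: "Cb k {()} (\<lambda>_. ball (0::'e) 2) (\<lambda>_ y. max 0 (1 - y \<bullet> y) ^ Suc k)" by simp
  show "Cb k {()} (\<lambda>_. ball 0 2) (\<lambda>_. bump k :: 'e \<Rightarrow> real)"
    unfolding bump_def
    by (intro Cb_mult[OF op] Cb_power[OF op] Cb_cmult[OF op] sq p)
qed (simp add: bump_zero)

section \<open>Dented spheres\<close>

text \<open>
  A copy of the bump at \<open>e\<close> of width \<open>\<gamma>\<close>. Its height \<open>\<gamma> ^ k\<close> has the largest order for which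
  the derivatives up to order \<open>k\<close> stay bounded as \<open>\<gamma>\<close> tends to \<open>0\<close>, cf. \<open>Cb_rescale\<close>.
\<close>

definition dent :: "nat \<Rightarrow> 'e::euclidean_space \<Rightarrow> real \<Rightarrow> 'e \<Rightarrow> real" where
  "dent k e \<gamma> x = \<gamma> ^ k * bump k ((x - e) /\<^sub>R \<gamma>)"

lemma dent_nonneg: "0 \<le> \<gamma> \<Longrightarrow> 0 \<le> dent k e \<gamma> x"
  by (simp add: dent_def bump_nonneg)

lemma inner_scaled_self: "(x /\<^sub>R \<gamma>) \<bullet> (x /\<^sub>R \<gamma>) = (x \<bullet> x) / \<gamma>\<^sup>2"
  by (simp add: power2_eq_square divide_inverse mult_ac)

lemma power_times_div_square: "2 \<le> k \<Longrightarrow> 0 < \<gamma> \<Longrightarrow> \<gamma> ^ k * (t / \<gamma>\<^sup>2) = \<gamma> ^ (k - 2) * (t :: real)"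
  by (auto simp: power_add power2_eq_square dest!: le_Suc_ex)

text \<open>
  The bound \<open>bump k y \<le> y \<bullet> y\<close> after rescaling: two of the \<open>k\<close> powers of \<open>\<gamma>\<close> are used up by the
  square.
\<close>

lemma dent_le: "2 \<le> k \<Longrightarrow> 0 < \<gamma> \<Longrightarrow> dent k e \<gamma> x \<le> \<gamma> ^ (k - 2) * ((x - e) \<bullet> (x - e))"
  using mult_left_mono[OF bump_le[of k "(x - e) /\<^sub>R \<gamma>"], of "\<gamma> ^ k"] power_times_div_square[of k \<gamma> "(x - e) \<bullet> (x - e)"]
  unfolding dent_def inner_scaled_self by simp

lemma dent_eq:
  assumes "2 \<le> k" "0 < \<gamma>" "(x - e) \<bullet> (x - e) = \<gamma>\<^sup>2 / 2"
  shows "dent k e \<gamma> x = \<gamma> ^ (k - 2) * ((x - e) \<bullet> (x - e))"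
proof -
  have "((x - e) /\<^sub>R \<gamma>) \<bullet> ((x - e) /\<^sub>R \<gamma>) = 1 / 2"
    unfolding inner_scaled_self assms(3) using assms(2) by simp
  from bump_eq[OF this] show ?thesis
    using power_times_div_square[OF assms(1,2), of "(x - e) \<bullet> (x - e)"] unfolding dent_def inner_scaled_self by simp
qed

lemma dent_zero: "0 < \<gamma> \<Longrightarrow> \<gamma> \<le> norm (x - e) \<Longrightarrow> dent k e \<gamma> x = 0"
  unfolding dent_def by (subst bump_zero) (auto simp: divide_inverse[symmetric] mult.commute[of "inverse _"])

lemma dent_centre: "dent k e \<gamma> e = 0"
  by (simp add: dent_def bump_def)

lemma Cb_dent: "Cb k {0<..1} (\<lambda>_. UNIV) (\<lambda>\<gamma>. dent k e \<gamma> :: 'e::euclidean_space \<Rightarrow> real)"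
  unfolding dent_def by (rule Cb_rescale[OF Cb_bump]) auto

lemma det_le_fact:
  fixes A :: "real^'d::finite^'d"
  assumes "\<And>i j. \<bar>A $ i $ j\<bar> \<le> c"
  shows "\<bar>det A\<bar> \<le> fact CARD('d) * c ^ CARD('d)"
proof -
  have "\<bar>det A\<bar> \<le> (\<Sum>p | p permutes (UNIV :: 'd set). \<bar>of_int (sign p) * (\<Prod>i\<in>UNIV. A $ i $ p i)\<bar>)"
    unfolding det_def by (rule sum_abs)
  also have "\<dots> \<le> (\<Sum>p | p permutes (UNIV :: 'd set). c ^ CARD('d))"
  proof (rule sum_mono)
    fix p :: "'d \<Rightarrow> 'd"
    have "\<bar>of_int (sign p) * (\<Prod>i\<in>UNIV. A $ i $ p i)\<bar> = (\<Prod>i\<in>UNIV. \<bar>A $ i $ p i\<bar>)"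
      by (simp add: abs_mult abs_prod sign_def)
    also have "\<dots> \<le> (\<Prod>i\<in>(UNIV::'d set). c)" by (rule prod_mono) (use assms in auto)
    finally show "\<bar>of_int (sign p) * (\<Prod>i\<in>UNIV. A $ i $ p i)\<bar> \<le> c ^ CARD('d)" by simp
  qed
  also have "\<dots> = fact CARD('d) * c ^ CARD('d)"
    by (simp add: card_permutations[of UNIV "CARD('d)"])
  finally show ?thesis .
qed

text \<open>
  The constant \<open>C\<close> bounds the dents of all widths \<open>\<gamma> \<le> 1\<close> up to second order, and the amplitude \<open>\<beta>\<close>
  is so small that a dent perturbs the defining function \<open>x \<bullet> x - 1\<close> of the sphere, and its first two
  derivatives, by at most \<open>1 / 4\<close>.
\<close>

locale dented_sphere =
  fixes k :: nat and e :: "'e::euclidean_space" and C \<beta> :: real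
  assumes k: "3 \<le> k" and e: "norm e = 1" and dim2: "2 \<le> DIM('e)" and \<beta>: "0 < \<beta>" "\<beta> * C \<le> 1 / 4"
    and dent_bounds: "\<And>\<gamma> x. 0 < \<gamma> \<Longrightarrow> \<gamma> \<le> 1 \<Longrightarrow> \<bar>dent k e \<gamma> x\<bar> \<le> C"
      "\<And>\<gamma> x. 0 < \<gamma> \<Longrightarrow> \<gamma> \<le> 1 \<Longrightarrow> norm (grad (dent k e \<gamma>) x) \<le> C"
      "\<And>\<gamma> x y. 0 < \<gamma> \<Longrightarrow> \<gamma> \<le> 1 \<Longrightarrow> norm (grad (dent k e \<gamma>) x - grad (dent k e \<gamma>) y) \<le> C * norm (x - y)"
      "\<And>\<gamma> x. 0 < \<gamma> \<Longrightarrow> \<gamma> \<le> 1 \<Longrightarrow> (dent k e \<gamma> has_derivative (\<lambda>h. grad (dent k e \<gamma>) x \<bullet> h)) (at x)"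
begin

definition F :: "real \<Rightarrow> real \<Rightarrow> 'e \<Rightarrow> real" where "F \<theta> \<gamma> x = x \<bullet> x - 1 + \<theta> * dent k e \<gamma> x"
definition gr :: "real \<Rightarrow> real \<Rightarrow> 'e \<Rightarrow> 'e" where "gr \<theta> \<gamma> x = 2 *\<^sub>R x + \<theta> *\<^sub>R grad (dent k e \<gamma>) x"
definition params :: "(real \<times> real) set" where "params = {0..\<beta>} \<times> {0<..1}"

lemma paramsD: "(\<theta>, \<gamma>) \<in> params \<Longrightarrow> 0 \<le> \<theta> \<and> \<theta> \<le> \<beta> \<and> 0 < \<gamma> \<and> \<gamma> \<le> 1"
  by (simp add: params_def)

lemma F_has_derivative:
  assumes p: "(\<theta>, \<gamma>) \<in> params"
  shows "(F \<theta> \<gamma> has_derivative (\<lambda>h. gr \<theta> \<gamma> x \<bullet> h)) (at x)"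
proof -
  have d: "(dent k e \<gamma> has_derivative (\<lambda>h. grad (dent k e \<gamma>) x \<bullet> h)) (at x)"
    using dent_bounds(4) paramsD[OF p] by blast
  have "((\<lambda>x. x \<bullet> x - 1 + \<theta> * dent k e \<gamma> x) has_derivative
      (\<lambda>h. (x \<bullet> h + h \<bullet> x) - 0 + \<theta> * (grad (dent k e \<gamma>) x \<bullet> h))) (at x)"
    by (intro has_derivative_add has_derivative_diff has_derivative_inner has_derivative_ident
        has_derivative_const has_derivative_mult_right d)
  then show ?thesis unfolding F_def[abs_def] gr_def
    by (rule has_derivative_eq_rhs) (auto simp: inner_add_left inner_add_right inner_commute)
qed

lemma dent_scaled_le:
  assumes p: "(\<theta>, \<gamma>) \<in> params"
  shows "0 \<le> \<theta> * dent k e \<gamma> x" "\<theta> * dent k e \<gamma> x \<le> 1 / 4" "norm (\<theta> *\<^sub>R grad (dent k e \<gamma>) x) \<le> 1 / 4"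
proof -
  note q = paramsD[OF p]
  show "0 \<le> \<theta> * dent k e \<gamma> x" using q dent_nonneg[of \<gamma> k e x] by simp
  have "\<theta> * dent k e \<gamma> x \<le> \<beta> * C"
    using q dent_bounds(1)[of \<gamma> x] dent_nonneg[of \<gamma> k e x] \<beta> by (intro mult_mono) auto
  then show "\<theta> * dent k e \<gamma> x \<le> 1 / 4" using \<beta> by simp
  have "\<theta> * norm (grad (dent k e \<gamma>) x) \<le> \<beta> * C"
    using q dent_bounds(2)[of \<gamma> x] \<beta> by (intro mult_mono) auto
  then show "norm (\<theta> *\<^sub>R grad (dent k e \<gamma>) x) \<le> 1 / 4" using \<beta> q by simp
qed

lemma zero_norm:
  assumes p: "(\<theta>, \<gamma>) \<in> params" and x: "F \<theta> \<gamma> x = 0"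
  shows "4 / 5 \<le> norm x" "norm x \<le> 1"
proof -
  have n: "x \<bullet> x = (norm x)\<^sup>2" by (simp add: power2_norm_eq_inner)
  have "(4 / 5)\<^sup>2 \<le> (norm x)\<^sup>2" "(norm x)\<^sup>2 \<le> 1\<^sup>2"
    using dent_scaled_le(1,2)[OF p, of x] x unfolding F_def n by (simp_all add: power2_eq_square)
  from power2_le_imp_le[OF this(1)] power2_le_imp_le[OF this(2)]
  show "4 / 5 \<le> norm x" "norm x \<le> 1" by simp_all
qed

text \<open>
  For the sphere itself the gradient \<open>2 * x\<close> has Lipschitz constant \<open>2\<close> and norm \<open>2\<close>; the
  constants \<open>1\<close> and \<open>3\<close> leave room for the perturbation.
\<close>

lemma hypersurface:
  assumes p: "(\<theta>, \<gamma>) \<in> params"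
  shows "regular_hypersurface (F \<theta> \<gamma>) (gr \<theta> \<gamma>) 1 3"
proof
  note q = paramsD[OF p]
  show "(F \<theta> \<gamma> has_derivative (\<lambda>h. gr \<theta> \<gamma> x \<bullet> h)) (at x)" for x by (rule F_has_derivative[OF p])
  show "norm (gr \<theta> \<gamma> x - gr \<theta> \<gamma> y) \<le> 3 * norm (x - y)" for x y
  proof -
    have "gr \<theta> \<gamma> x - gr \<theta> \<gamma> y = 2 *\<^sub>R (x - y) + \<theta> *\<^sub>R (grad (dent k e \<gamma>) x - grad (dent k e \<gamma>) y)"
      by (simp add: gr_def algebra_simps)
    also have "norm \<dots> \<le> norm (2 *\<^sub>R (x - y)) + norm (\<theta> *\<^sub>R (grad (dent k e \<gamma>) x - grad (dent k e \<gamma>) y))"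
      by (rule norm_triangle_ineq)
    also have "\<dots> \<le> 2 * norm (x - y) + \<beta> * (C * norm (x - y))"
      using q dent_bounds(3)[of \<gamma> x y] \<beta> by (auto intro!: mult_mono)
    also have "\<dots> \<le> 2 * norm (x - y) + 1 * norm (x - y)"
      unfolding mult.assoc[symmetric] using \<beta> by (intro add_mono mult_right_mono) auto
    finally show ?thesis by simp
  qed
  show "1 \<le> norm (gr \<theta> \<gamma> x)" if "F \<theta> \<gamma> x = 0" for x
  proof -
    have "norm (2 *\<^sub>R x) \<le> norm (gr \<theta> \<gamma> x) + norm (\<theta> *\<^sub>R grad (dent k e \<gamma>) x)"
      using norm_triangle_ineq4[of "gr \<theta> \<gamma> x" "\<theta> *\<^sub>R grad (dent k e \<gamma>) x"] by (simp add: gr_def)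
    then show ?thesis using zero_norm(1)[OF p that] dent_scaled_le(3)[OF p, of x] by simp
  qed
qed auto

text \<open>
  The exact constants of the sphere, which give its reach \<open>2 / 2 = 1\<close>.
\<close>

lemma sphere_hypersurface: "regular_hypersurface (F 0 \<gamma>) (\<lambda>x. 2 *\<^sub>R x) 2 2"
proof
  show "(F 0 \<gamma> has_derivative (\<lambda>h. (2 *\<^sub>R x) \<bullet> h)) (at x)" for x
  proof -
    have "((\<lambda>x. x \<bullet> x - 1) has_derivative (\<lambda>h. (x \<bullet> h + h \<bullet> x) - 0)) (at x)"
      by (intro has_derivative_diff has_derivative_inner has_derivative_ident has_derivative_const)
    then show ?thesis unfolding F_def[abs_def]
      by (simp add: inner_commute)
  qed
  show "2 \<le> norm (2 *\<^sub>R x)" if "F 0 \<gamma> x = 0" for x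
  proof -
    have "(norm x)\<^sup>2 = 1" using that by (simp add: F_def power2_norm_eq_inner)
    then have "norm x = 1" using norm_ge_zero[of x] unfolding power2_eq_1_iff by linarith
    then show ?thesis by simp
  qed
qed (auto simp: scaleR_diff_right[symmetric] simp del: scaleR_diff_right)

definition surface :: "real \<Rightarrow> real \<Rightarrow> 'e set" where "surface \<theta> \<gamma> = {x. F \<theta> \<gamma> x = 0}"

lemma F_continuous:
  assumes "(\<theta>, \<gamma>) \<in> params"
  shows "continuous_on S (F \<theta> \<gamma>)"
  by (intro continuous_at_imp_continuous_on ballI)
    (rule has_derivative_continuous[OF F_has_derivative[OF assms]])

lemma compact_surface:
  assumes p: "(\<theta>, \<gamma>) \<in> params"
  shows "compact (surface \<theta> \<gamma>)"
proof -
  have "closed (surface \<theta> \<gamma>)" unfolding surface_def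
    by (rule closed_Collect_eq) (use F_continuous[OF p] in auto)
  moreover have "bounded (surface \<theta> \<gamma>)"
    using zero_norm(2)[OF p] by (intro boundedI[of _ 1]) (auto simp: surface_def)
  ultimately show ?thesis by (simp add: compact_eq_bounded_closed)
qed

text \<open>
  Along a ray the defining function increases where its zeros can lie, so each ray meets the
  surface at most once.
\<close>

lemma radial_unique:
  assumes p: "(\<theta>, \<gamma>) \<in> params" and u: "norm u = 1" and t: "0 < t1" "t1 < t2" "F \<theta> \<gamma> (t1 *\<^sub>R u) = 0"
    "F \<theta> \<gamma> (t2 *\<^sub>R u) = 0"
  shows False
proof -
  have t1: "4 / 5 \<le> t1" using zero_norm(1)[OF p t(3)] u t(1) by simp
  have d: "((\<lambda>t. F \<theta> \<gamma> (t *\<^sub>R u)) has_real_derivative gr \<theta> \<gamma> (t *\<^sub>R u) \<bullet> u) (at t)" for t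
  proof -
    have "((\<lambda>t. t *\<^sub>R u) has_derivative (\<lambda>h. h *\<^sub>R u)) (at t)" by (auto intro!: derivative_eq_intros)
    from has_derivative_compose[OF this F_has_derivative[OF p]]
    show ?thesis unfolding has_field_derivative_def by (simp add: mult_commute_abs)
  qed
  obtain z where z: "t1 < z" "z < t2" "F \<theta> \<gamma> (t2 *\<^sub>R u) - F \<theta> \<gamma> (t1 *\<^sub>R u) = (t2 - t1) * (gr \<theta> \<gamma> (z *\<^sub>R u) \<bullet> u)"
    using MVT2[OF t(2), of "\<lambda>t. F \<theta> \<gamma> (t *\<^sub>R u)" "\<lambda>t. gr \<theta> \<gamma> (t *\<^sub>R u) \<bullet> u"] d by auto
  have uu: "u \<bullet> u = 1" using u by (simp add: power2_norm_eq_inner[symmetric])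
  have "\<bar>(\<theta> *\<^sub>R grad (dent k e \<gamma>) (z *\<^sub>R u)) \<bullet> u\<bar> \<le> 1 / 4"
    using Cauchy_Schwarz_ineq2[of "\<theta> *\<^sub>R grad (dent k e \<gamma>) (z *\<^sub>R u)" u] dent_scaled_le(3)[OF p, of "z *\<^sub>R u"] u by simp
  moreover have "gr \<theta> \<gamma> (z *\<^sub>R u) \<bullet> u = 2 * z + (\<theta> *\<^sub>R grad (dent k e \<gamma>) (z *\<^sub>R u)) \<bullet> u"
    unfolding gr_def inner_add_left by (simp add: uu)
  ultimately have "0 < gr \<theta> \<gamma> (z *\<^sub>R u) \<bullet> u" using t1 z(1) by linarith
  then show False using z(3) t by simp
qed

lemma radial_exists:
  assumes p: "(\<theta>, \<gamma>) \<in> params" and u: "norm u = 1"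
  shows "\<exists>t>0. F \<theta> \<gamma> (t *\<^sub>R u) = 0"
proof -
  have uu: "u \<bullet> u = 1" using u by (simp add: power2_norm_eq_inner[symmetric])
  have "F \<theta> \<gamma> (0 *\<^sub>R u) \<le> 0" "0 \<le> F \<theta> \<gamma> (2 *\<^sub>R u)"
    using dent_scaled_le(1,2)[OF p, of 0] dent_scaled_le(1,2)[OF p, of "2 *\<^sub>R u"] by (auto simp: F_def uu)
  moreover have "continuous_on {0..2} (\<lambda>t. F \<theta> \<gamma> (t *\<^sub>R u))"
    by (rule continuous_on_compose2[OF F_continuous[OF p, of UNIV]]) (auto intro!: continuous_intros)
  ultimately obtain t where t: "0 \<le> t" "t \<le> 2" "F \<theta> \<gamma> (t *\<^sub>R u) = 0"
    using IVT'[of "\<lambda>t. F \<theta> \<gamma> (t *\<^sub>R u)" 0 0 2] by auto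
  have "t \<noteq> 0" using zero_norm(1)[OF p t(3)] by auto
  then show ?thesis using t by (intro exI[of _ t]) auto
qed

text \<open>
  Radial projection is a continuous bijection from the compact surface onto the sphere,
  hence a homeomorphism.
\<close>

lemma connected_surface:
  assumes p: "(\<theta>, \<gamma>) \<in> params"
  shows "connected (surface \<theta> \<gamma>)"
proof -
  have nz: "0 < norm x" if "x \<in> surface \<theta> \<gamma>" for x
    using zero_norm(1)[OF p that[unfolded surface_def mem_Collect_eq]] by linarith
  have im: "(\<lambda>x. x /\<^sub>R norm x) ` surface \<theta> \<gamma> = sphere 0 1"
  proof (intro equalityI subsetI)
    fix u assume "u \<in> (\<lambda>x. x /\<^sub>R norm x) ` surface \<theta> \<gamma>"
    then show "u \<in> sphere 0 1" using nz by auto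
  next
    fix u :: 'e assume "u \<in> sphere 0 1"
    then have u: "norm u = 1" by simp
    obtain t where t: "t > 0" "F \<theta> \<gamma> (t *\<^sub>R u) = 0" using radial_exists[OF p u] by blast
    have "u = (t *\<^sub>R u) /\<^sub>R norm (t *\<^sub>R u)" using t u by simp
    then show "u \<in> (\<lambda>x. x /\<^sub>R norm x) ` surface \<theta> \<gamma>"
      by (rule image_eqI) (simp add: t(2) surface_def)
  qed
  have inj: "inj_on (\<lambda>x. x /\<^sub>R norm x) (surface \<theta> \<gamma>)"
  proof (rule inj_onI)
    fix x y assume xy: "x \<in> surface \<theta> \<gamma>" "y \<in> surface \<theta> \<gamma>" "x /\<^sub>R norm x = y /\<^sub>R norm y"
    define u where "u = x /\<^sub>R norm x"
    have u: "norm u = 1" using nz[OF xy(1)] by (simp add: u_def)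
    have x: "x = norm x *\<^sub>R u" using nz[OF xy(1)] by (simp add: u_def)
    have y: "y = norm y *\<^sub>R u" using nz[OF xy(2)] by (simp add: u_def xy(3))
    have Fx: "F \<theta> \<gamma> (norm x *\<^sub>R u) = 0" unfolding x[symmetric] using xy(1) by (simp add: surface_def)
    have Fy: "F \<theta> \<gamma> (norm y *\<^sub>R u) = 0" unfolding y[symmetric] using xy(2) by (simp add: surface_def)
    have "norm x = norm y"
      using radial_unique[OF p u nz[OF xy(1)] _ Fx Fy] radial_unique[OF p u nz[OF xy(2)] _ Fy Fx]
      by (meson linorder_neqE_linordered_idom)
    then show "x = y" by (subst x, subst y) simp
  qed
  obtain g where "homeomorphism (surface \<theta> \<gamma>) (sphere 0 1) (\<lambda>x. x /\<^sub>R norm x) g"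
  proof -
    have "continuous_on (surface \<theta> \<gamma>) (\<lambda>x. x /\<^sub>R norm x)"
      by (intro continuous_intros) (use nz in force)
    from homeomorphism_compact[OF compact_surface[OF p] this im inj] show ?thesis using that by blast
  qed
  then have "continuous_on (sphere 0 1) g" "g ` sphere 0 1 = surface \<theta> \<gamma>" unfolding homeomorphism_def by auto
  then show ?thesis using connected_continuous_image[OF _ connected_sphere[OF dim2]] by metis
qed

lemma pole_on_surface: "F \<theta> \<gamma> e = 0"
  using e by (simp add: F_def dent_centre power2_norm_eq_inner[symmetric])

lemma surface_off_dent: "0 < \<gamma> \<Longrightarrow> \<gamma> \<le> norm (x - e) \<Longrightarrow> F \<theta> \<gamma> x = F 0 \<gamma>' x"
  by (simp add: F_def dent_zero)

text \<open>
  Completing the square, \<open>(1 + b) * (x - c) \<bullet> (x - c)\<close> with \<open>c = b / (1 + b)\<close> times \<open>e\<close> equals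
  \<open>x \<bullet> x - 1 + b * (x - e) \<bullet> (x - e)\<close> up to the constant \<open>(1 + b) * \<rho>\<^sup>2\<close> with \<open>\<rho> = 1 / (1 + b)\<close>. On
  the surface this is nonnegative by \<open>dent_le\<close>, so the surface keeps distance \<open>\<rho>\<close> from \<open>c\<close>; at points
  with \<open>(x - e) \<bullet> (x - e) = \<gamma>\<^sup>2 / 2\<close> it vanishes by \<open>dent_eq\<close>. Two such points on the surface are found in
  a plane that contains \<open>e\<close>, so \<open>c\<close> has two nearest points.
\<close>

lemma reach_dented_le:
  fixes J :: "'e \<Rightarrow> 'a::real_inner"
  assumes \<gamma>: "0 < \<gamma>" "\<gamma> \<le> 1" and J: "linear J" "\<And>y. norm (J y) = norm y" "range J \<subseteq> E"
  defines "b \<equiv> \<beta> * \<gamma> ^ (k - 2)"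
  assumes b1: "b \<le> 1"
  shows "reach E (J ` surface \<beta> \<gamma>) \<le> ereal (1 / (1 + b))"
proof -
  have p: "(\<beta>, \<gamma>) \<in> params" using \<gamma> \<beta> by (simp add: params_def)
  have b: "0 < b" using \<beta> \<gamma> by (simp add: b_def)
  have ee: "e \<bullet> e = 1" using e by (simp add: power2_norm_eq_inner[symmetric])
  define c where "c = (b / (1 + b)) *\<^sub>R e"
  define \<rho> where "\<rho> = 1 / (1 + b)"
  have \<rho>: "0 < \<rho>" using b by (simp add: \<rho>_def)
  have cen: "(1 + b) * ((x - c) \<bullet> (x - c)) = x \<bullet> x - 1 + b * ((x - e) \<bullet> (x - e)) + (1 + b) * \<rho>\<^sup>2" for x
  proof -
    have xc: "(x - c) \<bullet> (x - c) = x \<bullet> x - 2 * (b / (1 + b)) * (x \<bullet> e) + (b / (1 + b))\<^sup>2"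
      unfolding c_def by (simp add: inner_diff_left inner_diff_right inner_commute ee power2_eq_square)
    have xe: "(x - e) \<bullet> (x - e) = x \<bullet> x - 2 * (x \<bullet> e) + 1"
      by (simp add: inner_diff_left inner_diff_right inner_commute ee)
    have nz: "1 + b \<noteq> 0" using b by simp
    have k1: "(1 + b) * (b / (1 + b)) = b" using nz by simp
    have k2: "b * (b / (1 + b)) = b - 1 + \<rho>" using nz by (simp add: \<rho>_def field_simps)
    have k3: "(1 + b) * \<rho>\<^sup>2 = \<rho>" using nz by (simp add: \<rho>_def power2_eq_square)
    have "(1 + b) * ((x - c) \<bullet> (x - c)) = (1 + b) * (x \<bullet> x - 2 * (b / (1 + b)) * (x \<bullet> e) + (b / (1 + b))\<^sup>2)" unfolding xc ..
    also have "\<dots> = (1 + b) * (x \<bullet> x) - 2 * ((1 + b) * (b / (1 + b))) * (x \<bullet> e) + ((1 + b) * (b / (1 + b))) * (b / (1 + b))"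
      by (simp only: distrib_left right_diff_distrib power2_eq_square mult_ac)
    also have "\<dots> = (1 + b) * (x \<bullet> x) - 2 * b * (x \<bullet> e) + (b - 1 + \<rho>)"
      unfolding k1 k2 ..
    also have "\<dots> = x \<bullet> x - 1 + b * ((x - e) \<bullet> (x - e)) + (1 + b) * \<rho>\<^sup>2"
      unfolding k3 xe by (simp add: algebra_simps)
    finally show ?thesis .
  qed
  have far: "\<rho> \<le> norm (x - c)" if x: "x \<in> surface \<beta> \<gamma>" for x
  proof -
    have "\<beta> * dent k e \<gamma> x \<le> \<beta> * (\<gamma> ^ (k - 2) * ((x - e) \<bullet> (x - e)))"
      using dent_le[of k \<gamma> e x] k \<gamma> \<beta> by (intro mult_left_mono) auto
    then have "0 \<le> x \<bullet> x - 1 + b * ((x - e) \<bullet> (x - e))"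
      using x by (simp add: surface_def F_def b_def mult.assoc)
    then have "(1 + b) * \<rho>\<^sup>2 \<le> (1 + b) * (norm (x - c))\<^sup>2" using cen[of x] by (simp add: power2_norm_eq_inner)
    then have "\<rho>\<^sup>2 \<le> (norm (x - c))\<^sup>2" using b by simp
    then show ?thesis by (rule power2_le_imp_le) simp
  qed
  obtain w :: 'e where w: "norm w = 1" "e \<bullet> w = 0"
  proof -
    have "e \<noteq> 0" using e by auto
    then have "dim {y. e \<bullet> y = 0} \<noteq> 0" using dim_hyperplane[of e] dim2 by simp
    then have "\<not> {y. e \<bullet> y = 0} \<subseteq> {0}" unfolding dim_eq_0 .
    then obtain y where "y \<noteq> 0" "e \<bullet> y = 0" by blast
    then show ?thesis using that[of "y /\<^sub>R norm y"] by simp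
  qed
  have ww: "w \<bullet> w = 1" using w by (simp add: power2_norm_eq_inner[symmetric])
  \<comment> \<open>The points \<open>e + l e + t w\<close> with \<open>l\<^sup>2 + t\<^sup>2 = \<gamma>\<^sup>2 / 2\<close> are those where \<open>dent_eq\<close> applies; \<open>l\<close> solves
    the remaining equation \<open>2 * l + (1 + b) * \<gamma>\<^sup>2 / 2 = 0\<close> of the surface.\<close>
  define l where "l = - (1 + b) * \<gamma>\<^sup>2 / 4"
  define m where "m = sqrt (\<gamma>\<^sup>2 / 2 - l\<^sup>2)"
  have l2: "l\<^sup>2 \<le> \<gamma>\<^sup>2 / 4"
  proof -
    have "\<bar>l\<bar> \<le> \<gamma> / 2"
    proof -
      have "\<bar>l\<bar> = (1 + b) * \<gamma> * \<gamma> / 4" using b by (simp add: l_def power2_eq_square abs_mult)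
      also have "\<dots> \<le> 2 * 1 * \<gamma> / 4" using b b1 \<gamma> by (intro divide_right_mono mult_right_mono mult_mono) auto
      finally show ?thesis by simp
    qed
    from power_mono[OF this abs_ge_zero, of 2] show ?thesis by (simp add: power2_eq_square)
  qed
  have m: "0 < m" "m\<^sup>2 = \<gamma>\<^sup>2 / 2 - l\<^sup>2"
  proof -
    have "0 < \<gamma>\<^sup>2" using \<gamma> by simp
    then have "0 < \<gamma>\<^sup>2 / 2 - l\<^sup>2" using l2 by linarith
    then show "0 < m" "m\<^sup>2 = \<gamma>\<^sup>2 / 2 - l\<^sup>2" by (simp_all add: m_def)
  qed
  have pts: "e + l *\<^sub>R e + t *\<^sub>R w \<in> surface \<beta> \<gamma> \<and> norm (e + l *\<^sub>R e + t *\<^sub>R w - c) = \<rho>" if t: "t\<^sup>2 = m\<^sup>2" for t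
  proof -
    let ?x = "e + l *\<^sub>R e + t *\<^sub>R w"
    have "(?x - e) \<bullet> (?x - e) = l\<^sup>2 + t\<^sup>2"
      by (simp add: inner_add_left inner_add_right inner_commute ee ww w(2) power2_eq_square)
    then have xe: "(?x - e) \<bullet> (?x - e) = \<gamma>\<^sup>2 / 2" using t m by simp
    have "?x \<bullet> ?x = (1 + l)\<^sup>2 + t\<^sup>2"
      by (simp add: inner_add_left inner_add_right inner_commute ee ww w(2) power2_eq_square algebra_simps)
    then have xx: "?x \<bullet> ?x = 1 + 2 * l + \<gamma>\<^sup>2 / 2" using t m by (simp add: power2_eq_square algebra_simps)
    have d: "\<beta> * dent k e \<gamma> ?x = b * (\<gamma>\<^sup>2 / 2)"
    proof -
      have "2 \<le> k" using k by simp
      from dent_eq[OF this \<gamma>(1) xe] show ?thesis unfolding xe by (simp add: b_def)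
    qed
    have Fx: "F \<beta> \<gamma> ?x = 0" unfolding F_def xx d by (simp add: l_def field_simps)
    have "(1 + b) * (norm (?x - c))\<^sup>2 = (1 + b) * \<rho>\<^sup>2"
      using cen[of ?x] Fx d unfolding F_def xe by (simp add: power2_norm_eq_inner)
    then have "(norm (?x - c))\<^sup>2 = \<rho>\<^sup>2" using b by simp
    then have "norm (?x - c) = \<rho>" using \<rho> by (simp add: power2_eq_iff_nonneg)
    then show ?thesis using Fx by (simp add: surface_def)
  qed
  define x1 where "x1 = e + l *\<^sub>R e + m *\<^sub>R w"
  define x2 where "x2 = e + l *\<^sub>R e + (- m) *\<^sub>R w"
  have x1: "x1 \<in> surface \<beta> \<gamma>" "norm (x1 - c) = \<rho>" and x2: "x2 \<in> surface \<beta> \<gamma>" "norm (x2 - c) = \<rho>"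
    using pts[of m] pts[of "- m"] unfolding x1_def x2_def by auto
  have ne: "x1 \<noteq> x2"
  proof
    assume "x1 = x2"
    then have "(2 * m) *\<^sub>R w = 0" by (simp add: x1_def x2_def scaleR_2[symmetric] algebra_simps)
    then show False using m w by auto
  qed
  have dJ: "dist (J x) (J y) = norm (y - x)" for x y
    by (simp add: dist_norm linear_diff[OF J(1), symmetric] J(2) norm_minus_commute)
  show ?thesis
    unfolding reach_def \<rho>_def[symmetric]
  proof (rule Sup_least, clarify)
    fix \<delta> :: real
    assume \<delta>: "0 \<le> \<delta>" and un: "\<forall>x\<in>E \<inter> (\<Union>p\<in>J ` surface \<beta> \<gamma>. ball p \<delta>).
       \<exists>!q. q \<in> J ` surface \<beta> \<gamma> \<and> (\<forall>p\<in>J ` surface \<beta> \<gamma>. dist x q \<le> dist x p)"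
    show "ereal \<delta> \<le> ereal \<rho>"
    proof (rule ccontr)
      assume "\<not> ereal \<delta> \<le> ereal \<rho>"
      then have "\<rho> < \<delta>" by simp
      then have "J c \<in> E \<inter> (\<Union>p\<in>J ` surface \<beta> \<gamma>. ball p \<delta>)"
        using x1 J(3) dJ[of x1 c] by (auto simp: norm_minus_commute intro!: bexI[of _ x1])
      then have "\<exists>!q. q \<in> J ` surface \<beta> \<gamma> \<and> (\<forall>p\<in>J ` surface \<beta> \<gamma>. dist (J c) q \<le> dist (J c) p)"
        using un by blast
      moreover have "J x1 \<in> J ` surface \<beta> \<gamma> \<and> (\<forall>p\<in>J ` surface \<beta> \<gamma>. dist (J c) (J x1) \<le> dist (J c) p)"
        using x1 far by (auto simp: dJ)
      moreover have "J x2 \<in> J ` surface \<beta> \<gamma> \<and> (\<forall>p\<in>J ` surface \<beta> \<gamma>. dist (J c) (J x2) \<le> dist (J c) p)"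
        using x2 far by (auto simp: dJ)
      ultimately have "J x1 = J x2" by blast
      then show False using ne isometry_inj[OF J(1,2)] by (auto dest: injD)
    qed
  qed
qed

end

section \<open>Uniform regularity and volume of dented spheres\<close>

context dented_sphere
begin

abbreviation r :: real where "r \<equiv> regular_hypersurface.r 1 3"
abbreviation \<nu> :: "real \<Rightarrow> real \<Rightarrow> 'e \<Rightarrow> 'e" where "\<nu> \<theta> \<gamma> \<equiv> regular_hypersurface.\<nu> (gr \<theta> \<gamma>)"
abbreviation is_graph where "is_graph \<theta> \<gamma> \<equiv> regular_hypersurface.is_graph (F \<theta> \<gamma>) (gr \<theta> \<gamma>) 1 3"

lemma r_eq: "r = 1 / 12"
  using regular_hypersurface.r_def[OF hypersurface[of 0 1]] \<beta> by (simp add: params_def)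

text \<open>
  All graph functions of all dented spheres, at all base points and in all frames, form a
  single family to which \<open>Cb_implicit_graph\<close> applies. The index consists of the parameters, the base
  point, the frame and the graph function itself.
\<close>

lemma uniform_graph_bounds:
  obtains K where "0 < K" "\<And>\<theta> \<gamma> x (Q :: real^'d::finite \<Rightarrow> 'e) s. (\<theta>, \<gamma>) \<in> params \<Longrightarrow> F \<theta> \<gamma> x = 0 \<Longrightarrow>
      isometric_frame Q (gr \<theta> \<gamma> x) \<Longrightarrow> is_graph \<theta> \<gamma> x Q s \<Longrightarrow> Ck_on k (ball 0 r) s \<and>
        (\<forall>v hs. norm v < r \<and> length hs \<le> k \<and> (\<forall>h\<in>set hs. norm h \<le> 1) \<longrightarrow> \<bar>iter_deriv hs s v\<bar> \<le> K)"
proof -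
  define I where "I = {((\<theta>, \<gamma>), x, Q :: real^'d \<Rightarrow> 'e, s). (\<theta>, \<gamma>) \<in> params \<and> F \<theta> \<gamma> x = 0 \<and>
      isometric_frame Q (gr \<theta> \<gamma> x) \<and> is_graph \<theta> \<gamma> x Q s}"
  define th ga where "th = (\<lambda>i :: (real \<times> real) \<times> 'e \<times> (real^'d \<Rightarrow> 'e) \<times> (real^'d \<Rightarrow> real). fst (fst i))"
    and "ga = (\<lambda>i :: (real \<times> real) \<times> 'e \<times> (real^'d \<Rightarrow> 'e) \<times> (real^'d \<Rightarrow> real). snd (fst i))"
  define xx QQ ss where "xx = (\<lambda>i :: (real \<times> real) \<times> 'e \<times> (real^'d \<Rightarrow> 'e) \<times> (real^'d \<Rightarrow> real). fst (snd i))"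
    and "QQ = (\<lambda>i :: (real \<times> real) \<times> 'e \<times> (real^'d \<Rightarrow> 'e) \<times> (real^'d \<Rightarrow> real). fst (snd (snd i)))"
    and "ss = (\<lambda>i :: (real \<times> real) \<times> 'e \<times> (real^'d \<Rightarrow> 'e) \<times> (real^'d \<Rightarrow> real). snd (snd (snd i)))"
  note defs = th_def ga_def xx_def QQ_def ss_def
  have I: "(th i, ga i) \<in> params" "F (th i) (ga i) (xx i) = 0" "isometric_frame (QQ i) (gr (th i) (ga i) (xx i))"
    "is_graph (th i) (ga i) (xx i) (QQ i) (ss i)" if "i \<in> I" for i
    using that unfolding I_def defs by auto
  have opI: "\<forall>i\<in>I. open (ball (0::'e) 2)" by simp
  have F: "Cb k I (\<lambda>_. ball 0 2) (\<lambda>i. F (th i) (ga i))"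
  proof -
    have sq: "Cb k I (\<lambda>_. ball (0::'e) 2) (\<lambda>_ x. x \<bullet> x)"
      by (rule Cb_inner_square[OF opI, of 2]) auto
    have c1: "Cb k I (\<lambda>_. ball (0::'e) 2) (\<lambda>_ x. - 1)" by (rule Cb_const[of _ _ 1]) simp
    have cth: "Cb k I (\<lambda>_. ball (0::'e) 2) (\<lambda>i x. th i)"
      by (rule Cb_const[of _ _ \<beta>]) (use I(1) paramsD in force)
    have "Cb k I (\<lambda>i. UNIV) (\<lambda>i. dent k e (ga i))"
      by (rule Cb_reindex[OF Cb_dent]) (use I(1) paramsD in force)
    then have d: "Cb k I (\<lambda>_. ball (0::'e) 2) (\<lambda>i. dent k e (ga i))" by (rule Cb_subset) simp
    have "Cb k I (\<lambda>_. ball (0::'e) 2) (\<lambda>i x. (x \<bullet> x + - 1) + th i * dent k e (ga i) x)"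
      by (rule Cb_add[OF opI Cb_add[OF opI sq c1] Cb_mult[OF opI cth d]])
    then show ?thesis by (simp add: F_def[abs_def])
  qed
  have rr: "r = 1 / 12" by (rule r_eq)
  have "Cb k I (\<lambda>_. ball 0 r) ss"
  proof (rule Cb_implicit_graph[where gr = "\<lambda>i. gr (th i) (ga i)" and x = xx and n = "\<lambda>i. \<nu> (th i) (ga i) (xx i)"
        and Q = QQ and R = 2 and c = "1 / 2", OF F])
    fix i assume i: "i \<in> I"
    interpret H: regular_hypersurface "F (th i) (ga i)" "gr (th i) (ga i)" 1 3
      by (rule hypersurface[OF I(1)[OF i]])
    note fr = H.frameD[OF I(3)[OF i]]
    show "(F (th i) (ga i) has_derivative (\<lambda>h. gr (th i) (ga i) y \<bullet> h)) (at y)" for y by (rule H.der)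
    show "linear (QQ i)" "norm (QQ i v) = norm v" for v using fr by auto
    show "norm (H.\<nu> (xx i)) = 1" by (rule H.normal_facts(1)[OF I(2)[OF i]])
    have nx: "norm (xx i) \<le> 1" by (rule zero_norm(2)[OF I(1,2)[OF i]])
    then show "norm (xx i) \<le> 2" by simp
    fix v :: "real^'d" assume "v \<in> ball 0 H.r"
    then have v: "norm v < H.r" by simp
    note g = H.graphD[OF I(4)[OF i] v]
    show "\<bar>ss i v\<bar> \<le> H.r" using g(1) by simp
    have pt: "xx i + QQ i v + ss i v *\<^sub>R H.\<nu> (xx i) = H.pt (xx i) (QQ i) v (ss i v)" by (simp add: H.pt_def)
    have "norm (H.pt (xx i) (QQ i) v (ss i v)) \<le> norm (xx i) + norm (H.pt (xx i) (QQ i) v (ss i v) - xx i)"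
      by (rule norm_triangle_sub)
    also have "\<dots> \<le> 1 + (norm v + \<bar>ss i v\<bar>)"
      using nx H.norm_pt_diff_le[OF I(2,3)[OF i], of v "ss i v"] by (rule add_mono)
    finally show "xx i + QQ i v + ss i v *\<^sub>R H.\<nu> (xx i) \<in> ball 0 2"
      unfolding pt using v g(1) rr by simp
    show "(ss i has_derivative (\<lambda>h. - (gr (th i) (ga i) (xx i + QQ i v + ss i v *\<^sub>R H.\<nu> (xx i)) \<bullet> QQ i h) /
         (gr (th i) (ga i) (xx i + QQ i v + ss i v *\<^sub>R H.\<nu> (xx i)) \<bullet> H.\<nu> (xx i)))) (at v)"
      unfolding pt by (rule H.graph_has_derivative[OF I(2,3,4)[OF i] v])
    show "1 / 2 \<le> gr (th i) (ga i) (xx i + QQ i v + ss i v *\<^sub>R H.\<nu> (xx i)) \<bullet> H.\<nu> (xx i)"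
      unfolding pt by (rule H.gr_pt_normal_ge[OF I(2,3)[OF i]]) (use v g(1) in auto)
  qed simp
  note Cb = this
  have op: "\<forall>i\<in>I. open (ball (0::real^'d) r)" by simp
  obtain K where K: "K > 0" "\<forall>i\<in>I. \<forall>v\<in>ball 0 r. \<forall>hs. length hs \<le> k \<and> (\<forall>h\<in>set hs. norm h \<le> 1) \<longrightarrow>
      \<bar>iter_deriv hs (ss i) v\<bar> \<le> K"
    using Cb_iter_deriv_bound[OF op Cb] by blast
  show ?thesis
  proof (rule that[OF K(1)])
    fix \<theta> \<gamma> x and Q :: "real^'d \<Rightarrow> 'e" and s
    assume a: "(\<theta>, \<gamma>) \<in> params" "F \<theta> \<gamma> x = 0" "isometric_frame Q (gr \<theta> \<gamma> x)" "is_graph \<theta> \<gamma> x Q s"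
    let ?i = "((\<theta>, \<gamma>), x, Q, s)"
    have i: "?i \<in> I" using a by (simp add: I_def)
    have si: "ss ?i = s" by (simp add: ss_def)
    show "Ck_on k (ball 0 r) s \<and>
        (\<forall>v hs. norm v < r \<and> length hs \<le> k \<and> (\<forall>h\<in>set hs. norm h \<le> 1) \<longrightarrow> \<bar>iter_deriv hs s v\<bar> \<le> K)"
      using Cb_imp_Ck_on[OF op Cb i] K(2)[rule_format, OF i] unfolding si by simp
  qed
qed

text \<open>
  The constant \<open>Lp\<close> is at least \<open>3\<close> so that the ball of radius \<open>1 / (4 * Lp)\<close>, on which the
  class demands a graph, fits into the radius \<open>1 / 12\<close> of the charts.
\<close>

lemma surface_in_manifold_class:
  assumes dim: "DIM('e) = CARD('d::finite) + 1"
  obtains Lp where "0 < Lp"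
    "\<And>\<theta> \<gamma> (J :: 'e \<Rightarrow> 'a::real_inner) E. (\<theta>, \<gamma>) \<in> params \<Longrightarrow> linear J \<Longrightarrow> (\<And>y. norm (J y) = norm y) \<Longrightarrow>
      range J \<subseteq> E \<Longrightarrow> J ` surface \<theta> \<gamma> \<in> manifold_class TYPE('d) E k (1 / 3) Lp (\<lambda>_. Lp)"
proof -
  obtain K where K: "0 < K" "\<And>\<theta> \<gamma> x (Q :: real^'d::finite \<Rightarrow> 'e) s. (\<theta>, \<gamma>) \<in> params \<Longrightarrow> F \<theta> \<gamma> x = 0 \<Longrightarrow>
      isometric_frame Q (gr \<theta> \<gamma> x) \<Longrightarrow> is_graph \<theta> \<gamma> x Q s \<Longrightarrow> Ck_on k (ball 0 r) s \<and>
        (\<forall>v hs. norm v < r \<and> length hs \<le> k \<and> (\<forall>h\<in>set hs. norm h \<le> 1) \<longrightarrow> \<bar>iter_deriv hs s v\<bar> \<le> K)"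
    by (rule uniform_graph_bounds) blast
  define Lp where "Lp = max K 3"
  show ?thesis
  proof (rule that[of Lp])
    show "0 < Lp" by (simp add: Lp_def)
    fix \<theta> \<gamma> and J :: "'e \<Rightarrow> 'a" and E
    assume p: "(\<theta>, \<gamma>) \<in> params" and J: "linear J" "\<And>y. norm (J y) = norm y" "range J \<subseteq> E"
    interpret H: regular_hypersurface "F \<theta> \<gamma>" "gr \<theta> \<gamma>" 1 3 by (rule hypersurface[OF p])
    let ?M = "J ` surface \<theta> \<gamma>"
    have M: "?M = J ` {x. F \<theta> \<gamma> x = 0}" by (simp add: surface_def)
    have cont: "continuous_on S J" for S
      by (rule linear_continuous_on[OF isometry_bounded_linear[OF J(1,2)]])
    have cM: "compact ?M" by (rule compact_continuous_image[OF cont compact_surface[OF p]])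
    have ch: "\<exists>(Q :: real^'d \<Rightarrow> 'e) s. q = J x \<and> F \<theta> \<gamma> x = 0 \<and> isometric_frame Q (gr \<theta> \<gamma> x) \<and> H.is_graph x Q s \<and> Ck_on k (ball 0 H.r) s"
      if qx: "F \<theta> \<gamma> x = 0" "q = J x" for q x
    proof -
      obtain Q :: "real^'d \<Rightarrow> 'e" where Q: "isometric_frame Q (gr \<theta> \<gamma> x)"
        using isometric_frame_exists[OF H.gr_nonzero[OF qx(1)] dim] by blast
      obtain s where "H.is_graph x Q s" by (rule H.graph_exists[OF qx(1) Q])
      then show ?thesis using K(2)[OF p qx(1) Q] qx Q by blast
    qed
    have sub: "submanifold TYPE('d) k ?M" unfolding submanifold_def
    proof
      fix q assume "q \<in> ?M"
      then obtain x where x: "q = J x" "F \<theta> \<gamma> x = 0" by (auto simp: surface_def)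
      obtain Q :: "real^'d \<Rightarrow> 'e" and s where Q: "isometric_frame Q (gr \<theta> \<gamma> x)" "H.is_graph x Q s" "Ck_on k (ball 0 H.r) s"
        using ch[OF x(2,1)] by blast
      have "q = J x + J (Q 0) + s 0 *\<^sub>R J (H.\<nu> x)"
        by (simp add: x(1) H.graph_at_0[OF x(2) Q(1,2)] linear_0[OF H.frameD(1)[OF Q(1)]] linear_0[OF J(1)])
      then have "q \<in> (\<lambda>v. J x + J (Q v) + s v *\<^sub>R J (H.\<nu> x)) ` ball 0 H.r"
        by (rule image_eqI) (use H.r_pos in simp)
      then show "\<exists>(U :: (real^'d) set) \<phi>. local_param k ?M U \<phi> \<and> q \<in> \<phi> ` U"
        using H.graph_local_param(1)[OF J(1,2) M x(2) Q] by blast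
    qed
    have gp: "\<exists>(\<iota> :: real^'d \<Rightarrow> 'a) \<rho> N. graph_param k Lp (\<lambda>_. Lp) E ?M q \<iota> \<rho> N" if "q \<in> ?M" for q
    proof -
      obtain x where x: "q = J x" "F \<theta> \<gamma> x = 0" using \<open>q \<in> ?M\<close> unfolding surface_def by blast
      obtain Q :: "real^'d \<Rightarrow> 'e" and s where Q: "isometric_frame Q (gr \<theta> \<gamma> x)" "H.is_graph x Q s" "Ck_on k (ball 0 H.r) s"
        using ch[OF x(2,1)] by blast
      have "graph_param k Lp (\<lambda>_. Lp) E ?M (J x) (\<lambda>v. J (Q v)) H.r (\<lambda>v. s v *\<^sub>R J (H.\<nu> x))"
      proof (rule H.graph_graph_param[OF J(1,2) M x(2) Q _ J(3)])
        show "2 \<le> k" using k by simp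
        show "\<bar>iter_deriv hs s v\<bar> \<le> K" if "norm v < H.r" "length hs \<le> k" "\<forall>h\<in>set hs. norm h \<le> 1" for v hs
          using K(2)[OF p x(2) Q(1,2)] that by blast
        show "1 / (4 * Lp) \<le> H.r" unfolding r_eq by (simp add: Lp_def field_simps)
        show "K \<le> Lp" "\<And>i. K \<le> Lp" by (simp_all add: Lp_def)
      qed
      then show ?thesis unfolding x(1) by blast
    qed
    have "ereal (1 / 3) \<le> reach E ?M" by (rule H.reach_ge[OF J(1,2) M dim cM])
    moreover have "connected ?M" by (rule connected_continuous_image[OF cont connected_surface[OF p]])
    moreover have "?M \<subseteq> E" using J(3) by auto
    ultimately show "?M \<in> manifold_class TYPE('d) E k (1 / 3) Lp (\<lambda>_. Lp)"
      unfolding manifold_class_def using cM sub gp by blast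
  qed
qed

lemma sphere_reach_ge:
  fixes J :: "'e \<Rightarrow> 'a::real_inner"
  assumes dim: "DIM('e) = CARD('d::finite) + 1" and p: "(0, \<gamma>) \<in> params" and J: "linear J" "\<And>y. norm (J y) = norm y"
  shows "ereal 1 \<le> reach E (J ` surface 0 \<gamma>)"
proof -
  interpret S: regular_hypersurface "F 0 \<gamma>" "\<lambda>x. 2 *\<^sub>R x" 2 2 by (rule sphere_hypersurface)
  have "compact (J ` surface 0 \<gamma>)"
    by (rule compact_continuous_image[OF linear_continuous_on[OF isometry_bounded_linear[OF J]] compact_surface[OF p]])
  from S.reach_ge[OF J _ dim this, of E] show ?thesis by (simp add: surface_def)
qed

text \<open>
  The points of the surface within distance \<open>t\<close> of the pole lie in the graph chart at the pole,
  and their coordinates lie in the ball of radius \<open>t\<close> because the chart does not decrease distances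
  to the pole. The Jacobian is bounded uniformly in the parameters.
\<close>

lemma volume_near_pole:
  assumes dim: "DIM('e) = CARD('d::finite) + 1"
  obtains K where "0 < K"
    "\<And>\<theta> \<gamma> (J :: 'e \<Rightarrow> 'a::real_inner) \<mu> t. (\<theta>, \<gamma>) \<in> params \<Longrightarrow> linear J \<Longrightarrow> (\<And>y. norm (J y) = norm y) \<Longrightarrow>
      volume_measure TYPE('d) UNIV (J ` surface \<theta> \<gamma>) \<mu> \<Longrightarrow> 0 < t \<Longrightarrow> t < 1 / 12 \<Longrightarrow>
      emeasure \<mu> (cball (J e) t) \<le> ennreal (K * t ^ CARD('d))"
proof -
  obtain K where K: "0 < K" "\<And>\<theta> \<gamma> x (Q :: real^'d::finite \<Rightarrow> 'e) s. (\<theta>, \<gamma>) \<in> params \<Longrightarrow> F \<theta> \<gamma> x = 0 \<Longrightarrow>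
      isometric_frame Q (gr \<theta> \<gamma> x) \<Longrightarrow> is_graph \<theta> \<gamma> x Q s \<Longrightarrow> Ck_on k (ball 0 r) s \<and>
        (\<forall>v hs. norm v < r \<and> length hs \<le> k \<and> (\<forall>h\<in>set hs. norm h \<le> 1) \<longrightarrow> \<bar>iter_deriv hs s v\<bar> \<le> K)"
    by (rule uniform_graph_bounds) blast
  define c where "c = sqrt (fact CARD('d) * ((1 + K)\<^sup>2) ^ CARD('d))"
  have cpos: "0 < c" using K(1) by (simp add: c_def)
  define K' where "K' = c * unit_ball_vol (real CARD('d))"
  show ?thesis
  proof (rule that[of K'])
    show "0 < K'" using cpos by (simp add: K'_def)
    fix \<theta> \<gamma> t :: real and J :: "'e \<Rightarrow> 'a" and \<mu>
    assume p: "(\<theta>, \<gamma>) \<in> params" and J: "linear J" "\<And>y. norm (J y) = norm y"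
      and vol: "volume_measure TYPE('d) UNIV (J ` surface \<theta> \<gamma>) \<mu>" and t: "0 < t" "t < 1 / 12"
    interpret H: regular_hypersurface "F \<theta> \<gamma>" "gr \<theta> \<gamma>" 1 3 by (rule hypersurface[OF p])
    let ?M = "J ` surface \<theta> \<gamma>"
    have M: "?M = J ` {x. F \<theta> \<gamma> x = 0}" by (simp add: surface_def)
    have cM: "compact ?M"
      by (rule compact_continuous_image[OF linear_continuous_on[OF isometry_bounded_linear[OF J]] compact_surface[OF p]])
    have x: "F \<theta> \<gamma> e = 0" by (rule pole_on_surface)
    obtain Q :: "real^'d \<Rightarrow> 'e" where Q: "isometric_frame Q (gr \<theta> \<gamma> e)"
      using isometric_frame_exists[OF H.gr_nonzero[OF x] dim] by blast
    obtain s where s: "H.is_graph e Q s" by (rule H.graph_exists[OF x Q])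
    have Ck: "Ck_on k (ball 0 H.r) s" using K(2)[OF p x Q s] by blast
    let ?\<phi> = "\<lambda>v. J e + J (Q v) + s v *\<^sub>R J (H.\<nu> e)"
    note lp = H.graph_local_param[OF J M x Q s Ck]
    have lp1: "local_param 1 ?M (ball 0 H.r) ?\<phi>" by (rule local_param_mono[OF lp(1)]) (use k in simp)
    have nn: "norm (J (H.\<nu> e)) = 1" "J (H.\<nu> e) \<bullet> J (H.\<nu> e) = 1"
      using H.normal_facts(1)[OF x] by (simp_all add: J(2) power2_norm_eq_inner[symmetric])
    let ?B = "cball (J e) t \<inter> ?M"
    have Bb: "?B \<in> sets borel" using compact_imp_closed[OF cM] by auto
    have tr: "t < H.r" using t by (simp add: r_eq)
    have Bsub: "?B \<subseteq> ?\<phi> ` ball 0 H.r"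
    proof
      fix y assume y: "y \<in> ?B"
      define w where "w = y - J e"
      have w: "norm w \<le> t" using y by (simp add: w_def dist_norm norm_minus_commute)
      have "\<bar>w \<bullet> J (H.\<nu> e)\<bar> \<le> norm w" using Cauchy_Schwarz_ineq2[of w "J (H.\<nu> e)"] nn by simp
      moreover have "norm (w - (w \<bullet> J (H.\<nu> e)) *\<^sub>R J (H.\<nu> e)) \<le> norm w"
      proof (rule power2_le_imp_le)
        have "(norm (w - (w \<bullet> J (H.\<nu> e)) *\<^sub>R J (H.\<nu> e)))\<^sup>2 = (norm w)\<^sup>2 - (w \<bullet> J (H.\<nu> e))\<^sup>2"
          unfolding power2_norm_eq_inner by (simp add: inner_diff_left inner_diff_right inner_commute nn power2_eq_square)
        then show "(norm (w - (w \<bullet> J (H.\<nu> e)) *\<^sub>R J (H.\<nu> e)))\<^sup>2 \<le> (norm w)\<^sup>2" by simp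
      qed simp
      ultimately show "y \<in> ?\<phi> ` ball 0 H.r"
        unfolding H.graph_image(1)[OF J M x Q s] using y w tr unfolding w_def by auto
    qed
    have pre: "ball 0 H.r \<inter> ?\<phi> -` ?B \<subseteq> cball 0 t"
    proof
      fix v assume v: "v \<in> ball 0 H.r \<inter> ?\<phi> -` ?B"
      have QN: "Q v \<bullet> H.\<nu> e = 0"
        using H.frameD(3)[OF Q, of v] H.normal_facts(5)[OF x] by (simp add: inner_commute)
      have "?\<phi> v - J e = J (Q v + s v *\<^sub>R H.\<nu> e)" by (simp add: linear_add[OF J(1)] linear_cmul[OF J(1)])
      then have n: "norm (?\<phi> v - J e) = norm (Q v + s v *\<^sub>R H.\<nu> e)" by (simp add: J(2))
      have "(norm (Q v))\<^sup>2 \<le> (norm (Q v + s v *\<^sub>R H.\<nu> e))\<^sup>2"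
        unfolding power2_norm_eq_inner
        by (simp add: inner_add_left inner_add_right QN inner_commute[of "H.\<nu> e" "Q v"] H.normal_facts(2)[OF x])
      then have "norm (Q v) \<le> norm (?\<phi> v - J e)" unfolding n by (rule power2_le_imp_le) simp
      moreover have "norm (?\<phi> v - J e) \<le> t"
      proof -
        have "dist (J e) (?\<phi> v) \<le> t" using v by (simp only: Int_iff vimage_eq mem_cball)
        then show ?thesis unfolding dist_norm by (subst norm_minus_commute)
      qed
      ultimately show "v \<in> cball 0 t" by (simp add: H.frameD(2)[OF Q])
    qed
    have jac: "jacobian ?\<phi> v \<le> c" if v: "norm v < H.r" for v
    proof -
      let ?D = "frechet_derivative ?\<phi> (at v)"
      have D: "norm (?D (axis i 1)) \<le> 1 + K" for i
      proof -
        have "\<bar>iter_deriv [axis i 1] s v\<bar> \<le> K"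
          by (rule conjunct2[OF K(2)[OF p x Q s], rule_format]) (use v k in auto)
        then have ds: "\<bar>frechet_derivative s (at v) (axis i 1)\<bar> \<le> K" by simp
        have "norm (?D (axis i 1)) \<le> norm (J (Q (axis i 1))) + norm (frechet_derivative s (at v) (axis i 1) *\<^sub>R J (H.\<nu> e))"
          unfolding lp(3)[OF v] by (rule norm_triangle_ineq)
        also have "\<dots> \<le> 1 + K" using ds nn by (simp add: J(2) H.frameD(2)[OF Q])
        finally show ?thesis .
      qed
      have "\<bar>?D (axis i 1) \<bullet> ?D (axis j 1)\<bar> \<le> (1 + K)\<^sup>2" for i j
      proof -
        have "\<bar>?D (axis i 1) \<bullet> ?D (axis j 1)\<bar> \<le> norm (?D (axis i 1)) * norm (?D (axis j 1))"
          by (rule Cauchy_Schwarz_ineq2)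
        also have "\<dots> \<le> (1 + K) * (1 + K)" using D K(1) by (intro mult_mono) auto
        finally show ?thesis by (simp add: power2_eq_square)
      qed
      then have "\<bar>det (gram ?D)\<bar> \<le> fact CARD('d) * ((1 + K)\<^sup>2) ^ CARD('d)"
        by (intro det_le_fact) (simp add: gram_def)
      then show ?thesis unfolding jacobian_gram c_def by (intro real_sqrt_le_mono) simp
    qed
    have "emeasure \<mu> (cball (J e) t) = emeasure \<mu> ?B"
      using volume_measure_Int[OF vol cM, of "cball (J e) t"] by simp
    also have "\<dots> \<le> ennreal c * emeasure lborel (cball (0 :: real^'d) t)"
      by (rule volume_measure_le[OF vol lp1 Bb Bsub pre]) (use jac in auto)
    also have "\<dots> = ennreal (K' * t ^ CARD('d))"
      using t cpos by (simp add: emeasure_cball K'_def ennreal_mult[symmetric] mult.assoc)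
    finally show "emeasure \<mu> (cball (J e) t) \<le> ennreal (K' * t ^ CARD('d))" .
  qed
qed

end

section \<open>The lower bound\<close>

lift_definition unit_fseq :: "nat \<Rightarrow> fseq" is "\<lambda>i j. if j = i then 1 else 0"
  by simp

lemma inner_unit_fseq: "unit_fseq i \<bullet> x = coord x i"
proof -
  have "unit_fseq i \<bullet> x = (\<Sum>j\<in>{i}. coord (unit_fseq i) j * coord x j)"
    by (rule inner_fseq_superset) (auto simp: unit_fseq.rep_eq)
  then show ?thesis by (simp add: unit_fseq.rep_eq)
qed

lemma closed_Rn: "closed (Rn D)"
proof -
  have "Rn D = (\<Inter>i\<in>{D..}. {x. unit_fseq i \<bullet> x = 0})"
    by (auto simp: Rn_def inner_unit_fseq)
  moreover have "closed {x. unit_fseq i \<bullet> x = 0}" for i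
    by (intro closed_Collect_eq continuous_intros)
  ultimately show ?thesis by auto
qed

text \<open>
  The same embedding serves all ambient dimensions \<open>D \<ge> DIM('e)\<close>. This matters for the
  constants of the model: they are derived from the volume of the embedded sphere and must not
  depend on \<open>D\<close>.
\<close>

lemma isometric_embedding:
  obtains J :: "'e::euclidean_space \<Rightarrow> fseq" where "linear J" "\<And>y. norm (J y) = norm y"
    "\<And>D. DIM('e) \<le> D \<Longrightarrow> range J \<subseteq> Rn D"
proof -
  obtain h where h: "bij_betw h {0..<DIM('e)} (Basis :: 'e set)"
    using ex_bij_betw_nat_finite[OF finite_Basis] by blast
  define J where "J y = Abs_fseq (\<lambda>i. if i < DIM('e) then y \<bullet> h i else 0)" for y :: 'e
  have c: "coord (J y) i = (if i < DIM('e) then y \<bullet> h i else 0)" for y i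
  proof -
    have "finite {i. (if i < DIM('e) then y \<bullet> h i else 0) \<noteq> 0}"
      by (rule finite_subset[of _ "{..<DIM('e)}"]) auto
    then show ?thesis unfolding J_def by (subst Abs_fseq_inverse) auto
  qed
  show ?thesis
  proof (rule that)
    show "linear J"
      by (rule linearI) (auto intro!: fseq_eqI simp: c inner_add_left)
    show "norm (J y) = norm y" for y
    proof -
      have "J y \<bullet> J y = (\<Sum>i\<in>{0..<DIM('e)}. coord (J y) i * coord (J y) i)"
        by (rule inner_fseq_superset) (auto simp: c split: if_splits)
      also have "\<dots> = (\<Sum>i\<in>{0..<DIM('e)}. (y \<bullet> h i) * (y \<bullet> h i))" by (simp add: c)
      also have "\<dots> = (\<Sum>b\<in>Basis. (y \<bullet> b) * (y \<bullet> b))" by (rule sum.reindex_bij_betw[OF h])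
      also have "\<dots> = y \<bullet> y" by (simp add: euclidean_inner[symmetric])
      finally show ?thesis by (simp add: norm_eq_sqrt_inner)
    qed
    show "range J \<subseteq> Rn D" if "DIM('e) \<le> D" for D
      using that by (auto simp: Rn_def c)
  qed
qed

lemma space_volume_measure:
  assumes "volume_measure TYPE('d::finite) UNIV M \<mu>"
  shows "space \<mu> = UNIV"
  using sets_eq_imp_space_eq[OF volume_measureD(1)[OF assms]] by simp

text \<open>
  The support of the uniform distribution is all of \<open>M\<close> because every chart has positive
  volume density.
\<close>

lemma uniform_distribution:
  fixes M :: "'a::real_inner set"
  assumes M: "M \<in> manifold_class TYPE('d::finite) E k Rmin Lperp L" and k: "1 \<le> k" and E: "closed E"
    and vol: "volume_measure TYPE('d) UNIV M \<mu>" and V: "emeasure \<mu> UNIV = ennreal V" "0 < V"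
    and f: "fmin \<le> 1 / V" "1 / V \<le> fmax"
  defines "P \<equiv> density (restrict_space \<mu> E) (\<lambda>_. ennreal (1 / V))"
  shows "P \<in> distribution_class TYPE('d) E k Rmin Lperp L fmin fmax" and "prob_space P"
    and "sets P = sets (borel_on E)" and "measure_support E P = M"
    and "emeasure (restrict_space \<mu> E) (space (restrict_space \<mu> E)) = ennreal V"
proof -
  have cM: "compact M" and sub: "submanifold TYPE('d) k M" and ME: "M \<subseteq> E"
    using M unfolding manifold_class_def by auto
  note sp = space_volume_measure[OF vol] and s = volume_measureD(1)[OF vol]
  have Es: "E \<inter> space \<mu> \<in> sets \<mu>" using E s sp by auto
  have volE: "volume_measure TYPE('d) E M (restrict_space \<mu> E)" by (rule volume_measure_restrict[OF vol E ME cM])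
  have em: "emeasure (restrict_space \<mu> E) B = emeasure \<mu> B" if "B \<subseteq> E" for B
    by (rule emeasure_restrict_space[OF Es that])
  have spE: "space (restrict_space \<mu> E) = E" using sp by (simp add: space_restrict_space)
  have "emeasure \<mu> E = emeasure \<mu> (E \<inter> M)" using volume_measure_Int[OF vol cM, of E] E by auto
  also have "E \<inter> M = UNIV \<inter> M" using ME by auto
  also have "emeasure \<mu> (UNIV \<inter> M) = ennreal V" using volume_measure_Int[OF vol cM, of UNIV] V(1) by simp
  finally have VE: "emeasure \<mu> E = ennreal V" .
  then show tot: "emeasure (restrict_space \<mu> E) (space (restrict_space \<mu> E)) = ennreal V"
    unfolding spE em[OF order_refl] .
  show sP: "sets P = sets (borel_on E)"
    using volE unfolding P_def volume_measure_def by simp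
  have emP: "emeasure P B = ennreal (1 / V) * emeasure \<mu> B" if "B \<in> sets (restrict_space \<mu> E)" for B
  proof -
    have "B \<subseteq> E" using sets.sets_into_space[OF that] spE by simp
    then show ?thesis unfolding P_def using that by (simp add: emeasure_density_const em)
  qed
  show pP: "prob_space P"
  proof (rule prob_spaceI)
    have "emeasure P (space P) = ennreal (1 / V) * ennreal V"
      using emP[OF sets.top] by (simp add: P_def spE VE)
    also have "\<dots> = 1" using V(2) by (simp add: ennreal_mult[symmetric])
    finally show "emeasure P (space P) = 1" .
  qed
  show "P \<in> distribution_class TYPE('d) E k Rmin Lperp L fmin fmax"
    unfolding distribution_class_def
  proof (intro CollectI conjI bexI[OF _ M] exI[of _ "restrict_space \<mu> E"] exI[of _ "\<lambda>_. 1 / V"])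
    show "(\<lambda>_. 1 / V) \<in> borel_measurable (borel_on E)" by simp
  qed (use pP volE f in \<open>auto simp: P_def\<close>)
  have opE: "U \<inter> E \<in> sets (restrict_space \<mu> E)" if "U \<in> sets borel" for U
    using that s E by (auto simp: sets_restrict_space)
  show "measure_support E P = M"
  proof (intro set_eqI iffI)
    fix x assume x: "x \<in> measure_support E P"
    show "x \<in> M"
    proof (rule ccontr)
      assume "x \<notin> M"
      then have "0 < emeasure P (- M \<inter> E)"
        using x compact_imp_closed[OF cM] unfolding measure_support_def by auto
      also have "emeasure P (- M \<inter> E) = ennreal (1 / V) * emeasure \<mu> (- M \<inter> E)"
        by (rule emP[OF opE]) (use compact_imp_closed[OF cM] in auto)
      also have "emeasure \<mu> (- M \<inter> E) \<le> emeasure \<mu> (UNIV - M)"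
        by (rule emeasure_mono) (use s compact_imp_closed[OF cM] in auto)
      finally show False using volume_measureD(2)[OF vol] by (simp add: mult_left_mono)
    qed
  next
    fix x assume x: "x \<in> M"
    show "x \<in> measure_support E P" unfolding measure_support_def
    proof (intro CollectI conjI allI impI)
      show "x \<in> E" using x ME by auto
      fix U :: "'a set" assume U: "open U \<and> x \<in> U"
      have "0 < emeasure \<mu> U" by (rule volume_measure_open_pos[OF vol cM sub k x]) (use U in auto)
      also have "emeasure \<mu> U = emeasure \<mu> (U \<inter> M)" using volume_measure_Int[OF vol cM, of U] U by auto
      also have "\<dots> \<le> emeasure \<mu> (U \<inter> E)" by (rule emeasure_mono) (use U E ME s in auto)
      finally have "0 < emeasure \<mu> (U \<inter> E)" .
      moreover have "emeasure P (U \<inter> E) = ennreal (1 / V) * emeasure \<mu> (U \<inter> E)" by (rule emP[OF opE]) (use U in auto)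
      ultimately show "0 < emeasure P (U \<inter> E)" using V(2) by (simp add: ennreal_zero_less_mult_iff)
    qed
  qed
qed

lemma overlap_mass_ge:
  fixes V \<epsilon> :: real and n :: nat
  assumes "0 < V" "0 \<le> \<epsilon>" "\<epsilon> \<le> V / (4 * real n)" "1 \<le> n"
  shows "1 - 1 / (2 * real n) \<le> (V - \<epsilon>) / (V + \<epsilon>)"
proof -
  have n: "0 < real n" using assms by simp
  have 1: "2 * \<epsilon> / V \<le> 1 / (2 * real n)"
    using assms n by (simp add: field_simps)
  have "(1 - 2 * \<epsilon> / V) * (V + \<epsilon>) = V - \<epsilon> - 2 * \<epsilon> * \<epsilon> / V"
    using assms(1) by (simp add: field_simps)
  also have "\<dots> \<le> V - \<epsilon>" using assms by simp
  finally have "1 - 2 * \<epsilon> / V \<le> (V - \<epsilon>) / (V + \<epsilon>)"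
    using assms by (simp add: pos_le_divide_eq)
  then show ?thesis using 1 by simp
qed

theorem theorem2:
  fixes k :: nat
  assumes "k \<ge> 3"
  shows "\<exists>(Rmin::real) (Lperp::real) (L::nat \<Rightarrow> real) (fmin::real) (fmax::real) (c::real).
           Rmin > 0 \<and> Lperp > 0 \<and> (\<forall>i\<in>{3..k}. L i > 0) \<and> 0 < fmin \<and> fmin \<le> fmax \<and> c > 0 \<and>
           (\<forall>D > CARD('d::finite). \<forall>n\<ge>1.
              minimax_reach_risk (Rn D) n
                (distribution_class TYPE('d) (Rn D) k Rmin Lperp L fmin fmax)
              \<ge> ennreal (c * real n powr (- (real k - 2) / real CARD('d))))"
proof -
  let ?d = "CARD('d)"
  have d: "1 \<le> ?d" by (simp add: Suc_leI)
  define e :: "(real^'d) \<times> real" where "e = (0, 1)"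
  have e: "norm e = 1" by (simp add: e_def norm_Pair)
  have dim: "DIM((real^'d) \<times> real) = ?d + 1" by simp
  have k2: "k = Suc (Suc (k - 2))" using assms by simp
  obtain C where C: "0 < C" "\<And>i x. i \<in> {0<..1} \<Longrightarrow> \<bar>dent k e i x\<bar> \<le> C"
    "\<And>i x. i \<in> {0<..1} \<Longrightarrow> norm (grad (dent k e i) x) \<le> C"
    "\<And>i x y. i \<in> {0<..1} \<Longrightarrow> norm (grad (dent k e i) x - grad (dent k e i) y) \<le> C * norm (x - y)"
    "\<And>i x. i \<in> {0<..1} \<Longrightarrow> (dent k e i has_derivative (\<lambda>h. grad (dent k e i) x \<bullet> h)) (at x)"
    using Cb_grad_bounds[of "k - 2" "{0<..1}" "\<lambda>\<gamma>. dent k e \<gamma>"] Cb_dent[of k e] k2 by metis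
  define \<beta> where "\<beta> = min 1 (1 / (4 * C))"
  have \<beta>: "0 < \<beta>" "\<beta> \<le> 1" "\<beta> * C \<le> 1 / 4"
  proof -
    show "0 < \<beta>" "\<beta> \<le> 1" using C(1) by (auto simp: \<beta>_def)
    have "\<beta> * C \<le> 1 / (4 * C) * C" using C(1) by (intro mult_right_mono) (auto simp: \<beta>_def)
    then show "\<beta> * C \<le> 1 / 4" using C(1) by simp
  qed
  interpret S: dented_sphere k e C \<beta>
    using assms e dim d \<beta> C by unfold_locales auto
  obtain Lp where Lp: "0 < Lp"
    "\<And>\<theta> \<gamma> (J :: (real^'d) \<times> real \<Rightarrow> fseq) E. (\<theta>, \<gamma>) \<in> S.params \<Longrightarrow> linear J \<Longrightarrow> (\<And>y. norm (J y) = norm y) \<Longrightarrow>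
      range J \<subseteq> E \<Longrightarrow> J ` S.surface \<theta> \<gamma> \<in> manifold_class TYPE('d) E k (1 / 3) Lp (\<lambda>_. Lp)"
    using S.surface_in_manifold_class[OF dim] by metis
  obtain K where K: "0 < K"
    "\<And>\<theta> \<gamma> (J :: (real^'d) \<times> real \<Rightarrow> fseq) \<mu> t. (\<theta>, \<gamma>) \<in> S.params \<Longrightarrow> linear J \<Longrightarrow> (\<And>y. norm (J y) = norm y) \<Longrightarrow>
      volume_measure TYPE('d) UNIV (J ` S.surface \<theta> \<gamma>) \<mu> \<Longrightarrow> 0 < t \<Longrightarrow> t < 1 / 12 \<Longrightarrow>
      emeasure \<mu> (cball (J e) t) \<le> ennreal (K * t ^ ?d)"
    using S.volume_near_pole[OF dim] by metis
  obtain J :: "(real^'d) \<times> real \<Rightarrow> fseq" where J: "linear J" "\<And>y. norm (J y) = norm y"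
    "\<And>D. ?d + 1 \<le> D \<Longrightarrow> range J \<subseteq> Rn D"
    using isometric_embedding[where 'e = "(real^'d) \<times> real"] unfolding dim by metis
  have vol: "\<exists>\<mu> V. volume_measure TYPE('d) UNIV (J ` S.surface \<theta> \<gamma>) \<mu> \<and> emeasure \<mu> UNIV = ennreal V \<and> 0 < V"
    if p: "(\<theta>, \<gamma>) \<in> S.params" for \<theta> \<gamma>
  proof -
    have "J ` S.surface \<theta> \<gamma> \<in> manifold_class TYPE('d) UNIV k (1 / 3) Lp (\<lambda>_. Lp)"
      by (rule Lp(2)[OF p J(1,2)]) auto
    then have M: "compact (J ` S.surface \<theta> \<gamma>)" "submanifold TYPE('d) k (J ` S.surface \<theta> \<gamma>)"
      unfolding manifold_class_def by auto
    have k1: "1 \<le> k" using assms by simp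
    obtain \<mu> where \<mu>: "volume_measure TYPE('d) UNIV (J ` S.surface \<theta> \<gamma>) \<mu>"
      by (rule volume_measure_exists[OF M k1])
    have Je: "J e \<in> J ` S.surface \<theta> \<gamma>" using S.pole_on_surface by (simp add: S.surface_def)
    have pos: "0 < emeasure \<mu> UNIV" by (rule volume_measure_open_pos[OF \<mu> M k1 Je]) auto
    have fin: "emeasure \<mu> UNIV < \<infinity>"
      using volume_measure_finite[OF \<mu> M k1] volume_measure_Int[OF \<mu> M(1), of UNIV] by simp
    obtain V where "emeasure \<mu> UNIV = ennreal V" "0 \<le> V"
      using fin by (cases "emeasure \<mu> UNIV" rule: ennreal_cases) auto
    then show ?thesis using \<mu> pos by (intro exI[of _ \<mu>] exI[of _ V]) auto
  qed
  have p0: "(0, 1) \<in> S.params" using \<beta> by (simp add: S.params_def)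
  obtain \<mu>0 V0 where \<mu>0: "volume_measure TYPE('d) UNIV (J ` S.surface 0 1) \<mu>0"
    "emeasure \<mu>0 UNIV = ennreal V0" "0 < V0"
    using vol[OF p0] by blast
  \<comment> \<open>The bound \<open>1 / 24\<close> keeps dents inside one chart; the other bound makes the volume around the
    dent at most a quarter of that of the sphere, and of order \<open>V0 / n\<close> after scaling.\<close>
  define \<gamma>0 where "\<gamma>0 = min (1 / 24) (V0 / (4 * K))"
  have \<gamma>0: "0 < \<gamma>0" "\<gamma>0 \<le> 1 / 24" "K * \<gamma>0 ^ ?d \<le> V0 / 4"
  proof -
    show g: "0 < \<gamma>0" "\<gamma>0 \<le> 1 / 24" using \<mu>0(3) K(1) by (auto simp: \<gamma>0_def)
    have "\<gamma>0 ^ ?d \<le> \<gamma>0 ^ 1" by (rule power_decreasing[OF d]) (use g in auto)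
    then have "K * \<gamma>0 ^ ?d \<le> K * (V0 / (4 * K))"
      using K(1) by (intro mult_left_mono) (auto simp: \<gamma>0_def)
    then show "K * \<gamma>0 ^ ?d \<le> V0 / 4" using K(1) by simp
  qed
  define c where "c = \<beta> * \<gamma>0 ^ (k - 2) / 8"
  have c: "0 < c" using \<beta> \<gamma>0 by (simp add: c_def)
  have main: "ennreal (c * real n powr (- (real k - 2) / real ?d)) \<le>
      minimax_reach_risk (Rn D) n (distribution_class TYPE('d) (Rn D) k (1 / 3) Lp (\<lambda>_. Lp) (1 / (2 * V0)) (2 / V0))"
    if D: "?d < D" and n: "1 \<le> n" for D n
  proof -
    have JE: "range J \<subseteq> Rn D" using J(3) D by simp
    define \<gamma> where "\<gamma> = \<gamma>0 * real n powr (- 1 / real ?d)"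
    have rn: "1 \<le> real n" using n by simp
    have "real n powr (- 1 / real ?d) \<le> real n powr 0" by (rule powr_mono) (use rn in auto)
    then have pw: "real n powr (- 1 / real ?d) \<le> 1" using rn by simp
    have \<gamma>: "0 < \<gamma>" "\<gamma> \<le> \<gamma>0" using \<gamma>0 rn pw by (auto simp: \<gamma>_def mult_le_cancel_left1)
    have \<gamma>d: "\<gamma> ^ ?d = \<gamma>0 ^ ?d / real n"
    proof -
      have "(real n powr (- 1 / real ?d)) ^ ?d = real n powr (- 1)"
        using rn by (simp add: powr_realpow[symmetric] powr_powr)
      then show ?thesis using rn by (simp add: \<gamma>_def power_mult_distrib powr_minus divide_inverse)
    qed
    have \<gamma>k: "\<gamma> ^ (k - 2) = \<gamma>0 ^ (k - 2) * real n powr (- (real k - 2) / real ?d)"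
    proof -
      have "(real n powr (- 1 / real ?d)) ^ (k - 2) = real n powr (- 1 / real ?d * real (k - 2))"
        using rn by (simp add: powr_realpow[symmetric] powr_powr)
      moreover have "- 1 / real ?d * real (k - 2) = - (real k - 2) / real ?d"
      proof -
        have "real (k - 2) = real k - 2" using assms by (simp add: of_nat_diff)
        then show ?thesis by (simp only: times_divide_eq_left mult_minus1)
      qed
      ultimately show ?thesis by (simp add: \<gamma>_def power_mult_distrib)
    qed
    \<comment> \<open>Bound on the volume that either manifold has in the ball where they differ.\<close>
    define \<epsilon> where "\<epsilon> = K * \<gamma> ^ ?d"
    have \<epsilon>0: "0 \<le> \<epsilon>" using K \<gamma> by (simp add: \<epsilon>_def)
    have "\<epsilon> = K * \<gamma>0 ^ ?d / real n" by (simp add: \<epsilon>_def \<gamma>d)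
    also have "\<dots> \<le> V0 / 4 / real n" using \<gamma>0(3) rn by (intro divide_right_mono) auto
    finally have \<epsilon>n: "\<epsilon> \<le> V0 / (4 * real n)" by simp
    also have "\<dots> \<le> V0 / (4 * 1)" using \<mu>0(3) rn by (intro divide_left_mono) auto
    finally have \<epsilon>4: "\<epsilon> \<le> V0 / 4" by simp
    have p1: "(\<beta>, \<gamma>) \<in> S.params" using \<beta> \<gamma> \<gamma>0 by (simp add: S.params_def)
    obtain \<mu>1 V1 where \<mu>1: "volume_measure TYPE('d) UNIV (J ` S.surface \<beta> \<gamma>) \<mu>1"
      "emeasure \<mu>1 UNIV = ennreal V1" "0 < V1"
      using vol[OF p1] by blast
    let ?M0 = "J ` S.surface 0 1" and ?M1 = "J ` S.surface \<beta> \<gamma>"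
    have M0: "?M0 \<in> manifold_class TYPE('d) (Rn D) k (1 / 3) Lp (\<lambda>_. Lp)" by (rule Lp(2)[OF p0 J(1,2) JE])
    have M1: "?M1 \<in> manifold_class TYPE('d) (Rn D) k (1 / 3) Lp (\<lambda>_. Lp)" by (rule Lp(2)[OF p1 J(1,2) JE])
    have k1: "1 \<le> k" using assms by simp
    have M0': "compact ?M0" "submanifold TYPE('d) k ?M0" "?M0 \<subseteq> Rn D" and M1': "compact ?M1" "?M1 \<subseteq> Rn D"
      using M0 M1 unfolding manifold_class_def by auto
    let ?B = "cball (J e) \<gamma>"
    have t: "\<gamma> < 1 / 12" using \<gamma> \<gamma>0 by simp
    have b0: "emeasure \<mu>0 ?B \<le> ennreal \<epsilon>" unfolding \<epsilon>_def by (rule K(2)[OF p0 J(1,2) \<mu>0(1) \<gamma>(1) t])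
    have b1: "emeasure \<mu>1 ?B \<le> ennreal \<epsilon>" unfolding \<epsilon>_def by (rule K(2)[OF p1 J(1,2) \<mu>1(1) \<gamma>(1) t])
    have agree: "?M0 \<inter> - ?B = ?M1 \<inter> - ?B"
    proof -
      have "S.F \<beta> \<gamma> x = S.F 0 1 x" if "J x \<notin> ?B" for x
      proof -
        have "\<gamma> \<le> norm (x - e)"
          using that by (simp add: dist_norm linear_diff[OF J(1), symmetric] J(2) norm_minus_commute)
        then show ?thesis by (rule S.surface_off_dent[OF \<gamma>(1)])
      qed
      then show ?thesis by (auto simp: S.surface_def)
    qed
    have loc: "emeasure \<mu>0 B = emeasure \<mu>1 B" if "B \<in> sets borel" "B \<subseteq> - ?B" for B
      by (rule volume_measure_local[OF M0'(1,2) k1 M1'(1) \<mu>0(1) \<mu>1(1) _ agree that]) (simp add: open_Compl)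
    note s0 = volume_measureD(1)[OF \<mu>0(1)] and s1 = volume_measureD(1)[OF \<mu>1(1)]
    note sp0 = space_volume_measure[OF \<mu>0(1)] and sp1 = space_volume_measure[OF \<mu>1(1)]
    \<comment> \<open>The uniform density \<open>1 / V1\<close> must lie in a range fixed in advance of \<open>\<gamma>\<close>.\<close>
    have V1: "3 / 4 * V0 \<le> V1" "V1 \<le> 5 / 4 * V0"
    proof -
      have "emeasure \<mu>0 (- ?B) \<le> ennreal V0"
        unfolding \<mu>0(2)[symmetric] by (rule emeasure_mono) (use s0 in auto)
      then obtain a where a: "emeasure \<mu>0 (- ?B) = ennreal a" "0 \<le> a" "a \<le> V0"
        using \<mu>0(3) by (cases "emeasure \<mu>0 (- ?B)" rule: ennreal_cases) (auto simp: top_unique)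
      have sp: "emeasure \<mu> UNIV = emeasure \<mu> (- ?B) + emeasure \<mu> ?B" if "sets \<mu> = sets borel" for \<mu>
        by (subst plus_emeasure) (use that in \<open>auto simp: Compl_disjoint2 intro!: arg_cong[where f="emeasure \<mu>"]\<close>)
      have "ennreal V0 \<le> ennreal a + ennreal \<epsilon>" using sp[OF s0] a(1) b0 \<mu>0(2) by (metis add_left_mono)
      then have 1: "V0 \<le> a + \<epsilon>" using a(2) \<epsilon>0 by (simp add: ennreal_plus[symmetric] del: ennreal_plus)
      have a': "emeasure \<mu>1 (- ?B) = ennreal a" using loc[of "- ?B"] a(1) by simp
      have "ennreal V1 \<le> ennreal a + ennreal \<epsilon>" using sp[OF s1] a' b1 \<mu>1(2) by (metis add_left_mono)
      then have 2: "V1 \<le> a + \<epsilon>" using a(2) \<epsilon>0 by (simp add: ennreal_plus[symmetric] del: ennreal_plus)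
      have "ennreal a \<le> ennreal V1"
        unfolding \<mu>1(2)[symmetric] a'[symmetric] by (rule emeasure_mono) (use s1 in auto)
      then have 3: "a \<le> V1" using \<mu>1(3) by simp
      show "3 / 4 * V0 \<le> V1" "V1 \<le> 5 / 4 * V0" using 1 2 3 a(3) \<epsilon>4 by simp_all
    qed
    let ?fmin = "1 / (2 * V0)" and ?fmax = "2 / V0"
    have f0: "?fmin \<le> 1 / V0" "1 / V0 \<le> ?fmax" using \<mu>0(3) by (auto simp: field_simps)
    have f1: "?fmin \<le> 1 / V1" "1 / V1 \<le> ?fmax" using \<mu>0(3) \<mu>1(3) V1 by (auto simp: field_simps)
    note u0 = uniform_distribution[OF M0 k1 closed_Rn \<mu>0 f0]
    note u1 = uniform_distribution[OF M1 k1 closed_Rn \<mu>1 f1]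
    let ?N0 = "restrict_space \<mu>0 (Rn D)" and ?N1 = "restrict_space \<mu>1 (Rn D)"
    let ?P0 = "density ?N0 (\<lambda>_. ennreal (1 / V0))" and ?P1 = "density ?N1 (\<lambda>_. ennreal (1 / V1))"
    have sN: "sets ?N1 = sets ?N0" using s0 s1 by (simp cong: sets_restrict_space_cong)
    have R: "Rn D \<in> sets borel" using closed_Rn by auto
    have em: "emeasure (restrict_space \<mu> (Rn D)) B = emeasure \<mu> B" if "B \<subseteq> Rn D" "sets \<mu> = sets borel" for \<mu> B
      by (rule emeasure_restrict_space) (use that R sets_eq_imp_space_eq[OF that(2)] in auto)
    have spN: "space ?N0 = Rn D" "space ?N1 = Rn D" using sp0 sp1 by (auto simp: space_restrict_space)
    define A where "A = Rn D - ?B"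
    have A: "A \<in> sets ?N0" using s0 R by (auto simp: A_def sets_restrict_space_iff sp0)
    have eqA: "emeasure ?N0 B = emeasure ?N1 B" if "B \<in> sets ?N0" "B \<subseteq> A" for B
    proof -
      have "B \<in> sets borel" using that(1) s0 R by (auto simp: sets_restrict_space_iff sp0)
      moreover have "B \<subseteq> - ?B" "B \<subseteq> Rn D" using that(2) by (auto simp: A_def)
      ultimately show ?thesis using loc em[OF _ s0] em[OF _ s1] by simp
    qed
    have out: "emeasure (restrict_space \<mu> (Rn D)) (Rn D - A) \<le> ennreal \<epsilon>"
      if "emeasure \<mu> ?B \<le> ennreal \<epsilon>" "sets \<mu> = sets borel" for \<mu>
    proof -
      have "emeasure (restrict_space \<mu> (Rn D)) (Rn D - A) = emeasure \<mu> (Rn D - A)" by (rule em) (use that in auto)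
      also have "\<dots> \<le> emeasure \<mu> ?B" by (rule emeasure_mono) (use that in \<open>auto simp: A_def\<close>)
      finally show ?thesis using that(1) by (rule order_trans)
    qed
    have out0: "emeasure ?N0 (space ?N0 - A) \<le> ennreal \<epsilon>" unfolding spN by (rule out[OF b0 s0])
    have out1: "emeasure ?N1 (space ?N1 - A) \<le> ennreal \<epsilon>" unfolding spN by (rule out[OF b1 s1])
    obtain w0 w1 where w: "w0 \<in> borel_measurable ?P0" "w1 \<in> borel_measurable ?P1"
      "\<And>x. w0 x \<le> (1::ennreal)" "\<And>x. w1 x \<le> (1::ennreal)" "density ?P0 w0 = density ?P1 w1"
      "ennreal ((V0 - \<epsilon>) / (V0 + \<epsilon>)) \<le> emeasure (density ?P0 w0) (space ?P0)"
      by (rule density_const_overlap[OF sN A eqA u0(5) u1(5) \<mu>0(3) \<mu>1(3) out0 out1 \<epsilon>0]) (assumption | rule that)+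
    have mass: "ennreal (1 - 1 / (2 * real n)) \<le> emeasure (density ?P0 w0) (space ?P0)"
      using w(6) overlap_mass_ge[OF \<mu>0(3) \<epsilon>0 \<epsilon>n n] by (meson ennreal_leI order_trans)
    define b where "b = \<beta> * \<gamma> ^ (k - 2)"
    have b: "0 < b" "b \<le> 1"
    proof -
      show "0 < b" using \<beta> \<gamma> by (simp add: b_def)
      have "\<gamma> ^ (k - 2) \<le> 1" using \<gamma> \<gamma>0 by (intro power_le_one) auto
      then show "b \<le> 1" using \<beta> \<gamma> by (simp add: b_def mult_le_one)
    qed
    have r0: "ereal 1 \<le> reach (Rn D) (measure_support (Rn D) ?P0)"
      unfolding u0(4) by (rule S.sphere_reach_ge[OF dim p0 J(1,2)])
    have r1: "reach (Rn D) (measure_support (Rn D) ?P1) \<le> ereal (1 / (1 + b))"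
      unfolding u1(4) b_def by (rule S.reach_dented_le[OF \<gamma>(1) _ J(1,2) JE]) (use \<gamma> \<gamma>0 b in \<open>auto simp: b_def\<close>)
    have "c * real n powr (- (real k - 2) / real ?d) = b / 8"
      by (simp add: c_def b_def \<gamma>k)
    also have "\<dots> \<le> (1 - 1 / (1 + b)) / 4"
    proof -
      define q where "q = b / (1 + b)"
      have "1 - 1 / (1 + b) = q" unfolding q_def using b by (simp add: field_simps)
      moreover have "b / 2 \<le> q" unfolding q_def using b by (intro divide_left_mono) auto
      ultimately show ?thesis by simp
    qed
    finally have "ennreal (c * real n powr (- (real k - 2) / real ?d)) \<le> ennreal ((1 - 1 / (1 + b)) / 4)"
      by (rule ennreal_leI)
    also have "\<dots> \<le> minimax_reach_risk (Rn D) n (distribution_class TYPE('d) (Rn D) k (1 / 3) Lp (\<lambda>_. Lp) ?fmin ?fmax)"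
      by (rule minimax_reach_risk_two_point[OF u0(1) u1(1) u0(2) u1(2) u0(3) u1(3) w(1-5) mass n r0 r1])
        (use b in \<open>simp add: field_simps\<close>)
    finally show ?thesis .
  qed
  show ?thesis
    by (rule exI[of _ "1 / 3"], rule exI[of _ Lp], rule exI[of _ "\<lambda>_. Lp"], rule exI[of _ "1 / (2 * V0)"],
        rule exI[of _ "2 / V0"], rule exI[of _ c])
      (use Lp(1) \<mu>0(3) c main in \<open>auto simp: field_simps\<close>)
qed

end
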